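(* Let $\Gamma$ be a Fuchsian group of the first kind with $\Gamma\backslash\mathbb H$ non-compact, let $\mathfrak a,\mathfrak b$ be cusps of $\Gamma$ with scaling matrices $\sigma_{\mathfrak a},\sigma_{\mathfrak b}$, let $z=x+iy\in\mathbb H$, and let $v_z=v_z(\theta)=y\cdot(-\sin\theta,\cos\theta)\in T_z\mathbb H$, for some $\theta\in[0,2\pi)$, be a unit hyperbolic vector. Then for $\mathrm{Re}(s)>1$, $$ \begin{aligned} E^1_{\mathfrak a}\big(\sigma_{\mathfrak b}(z,v_z(\theta)),s\big) ={}& \delta_{\mathfrak a\mathfrak b}\,y^{s+1}\sin\theta +\sqrt{\pi}\,y^{-s}\sin\theta\,\frac{1}{s+1}\,\frac{\Gamma(s+\frac12)}{\Gamma(s)}\,\varphi_{\mathfrak a\mathfrak b}(s)\\ &-2\pi^{s+1}y^{1/2}\sin\theta\;\Gamma(s+1)^{-1}\sum_{n\neq0}e(nx)\,|n|^{s+\frac12}\,K_{s+\frac12}(2\pi|n|y)\,\varphi_{\mathfrak a\mathfrak b}(n,s)\\ &+4\pi^{s+2}y^{3/2}\sin\theta\;\Gamma(s+2)^{-1}\sum_{n\neq0}e(nx)\,|n|^{s+\frac32}\,K_{s+\frac32}(2\pi|n|y)\,\varphi_{\mathfrak a\mathfrak b}(n,s)\\ &+8\pi^{s+1}y^{3/2}\cos\theta\,\sin(\pi s)\,\Gamma(-s-1)\sum_{n>0}\sin(2\pi nx)\,n^{s+\frac32}\,K_{-s-\frac12}(2\pi ny)\,\varphi_{\mathfrak a\mathfrak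 b,1}(n,s)\\ &+8\pi^{s+1}y^{3/2}\cos\theta\,\sin(\pi s)\,\Gamma(-s-1)\sum_{n>0}\cos(2\pi nx)\,n^{s+\frac32}\,K_{-s-\frac12}(2\pi ny)\,\varphi_{\mathfrak a\mathfrak b,2}(n,s), \end{aligned} $$ where $\Gamma(\cdot)$ with a complex argument is the Gamma function and sums over $n$ are over integers.
   Context: $\mathbb H=\{x+iy: y>0\}$ is the upper half-plane with the metric $(dx^2+dy^2)/y^2$. A matrix $g=\begin{pmatrix}a&b\\c&d\end{pmatrix}\in \mathrm{SL}(2,\mathbb R)$ acts on the tangent bundle $T\mathbb H$ by $g\cdot(z,v)=\big(\frac{az+b}{cz+d},\frac{v}{(cz+d)^2}\big)$, tangent vectors being identified with complex numbers (so $(-\sin\theta,\cos\theta)$ is $-\sin\theta+i\cos\theta$). The matrices $g$ and $-g$ act identically; groups, stabilizers and cosets below are understood modulo $\pm I$. Write $e(w)=\exp(2\pi i w)$. The angle $\theta$ is measured counter-clockwise from the vertical: $v_z(\theta)=\mathrm{Im}(z)\cdot(-\sin\theta,\cos\theta)$, which has hyperbolic norm $1$. For a cusp $\mathfrak a$ of $\Gamma$, $\Gamma_{\mathfrak a}$ is its (infinite cyclic) stabilizer in $\Gamma$, and the scaling matrix $\sigma_{\mathfrak a}\in\mathrm{SL}(2,\mathbb R)$ satisfies $\sigma_{\mathfrak a}(\infty)=\mathfrak a$ and $\sigma_{\mathfrak a}^{-1}\Gamma_{\mathfrak a}\sigma_{\mathfrak a}=B:=\left\{\begin{pmatrix}1&k\\0&1\end{pmatrix}:k\in\mathbb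 Z\right\}$. For $s\in\mathbb C$ let $\alpha^1(z,v_z)=\mathrm{Im}(z)^s\,dx(v_z)$. For $\mathrm{Re}(s)>1$ and a tangent vector $v_z$ of hyperbolic norm at most $1$, define the absolutely convergent sum $$E^1_{\mathfrak a}\big((z,v_z),s\big)=\sum_{\gamma\in\Gamma_{\mathfrak a}\backslash\Gamma}\alpha^1\big(\sigma_{\mathfrak a}^{-1}\gamma(z,v_z)\big).$$ $\delta_{\mathfrak a\mathfrak b}=1$ if $\mathfrak a=\mathfrak b$, and $\delta_{\mathfrak a\mathfrak b}=0$ if $\mathfrak a\neq\mathfrak b$. For $c>0$, let $D_{\mathfrak a\mathfrak b}(c)$ be the set of double cosets in $B\backslash\sigma_{\mathfrak a}^{-1}\Gamma\sigma_{\mathfrak b}/B$ represented by matrices $\begin{pmatrix}*&*\\c&d\end{pmatrix}$ with lower-left entry $c$ (equivalently, one takes the occurring values of $d$ modulo $c$). For $n\in\mathbb Z$ define $$\varphi_{\mathfrak a\mathfrak b}(s)=\sum_{c>0}c^{-2s-2}\,\#D_{\mathfrak a\mathfrak b}(c),\qquad \varphi_{\mathfrak a\mathfrak b}(n,s)=\sum_{c>0}c^{-2s-2}\sum_{D_{\mathfrak a\mathfrak b}(c)}e\big(n\tfrac dc\big),$$ $$\varphi_{\mathfrak a\mathfrak b,1}(n,s)=\sum_{c>0}c^{-2s-2}\sum_{D_{\mathfrak a\mathfrak b}(c)}\cos\big(2\pi n\tfrac dc\big),\qquad \varphi_{\mathfrak a\mathfrak b,2}(n,s)=\sum_{c>0}c^{-2s-2}\sum_{D_{\mathfrak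 a\mathfrak b}(c)}\sin\big(2\pi n\tfrac dc\big),$$ where $c>0$ runs over the lower-left entries that occur. $K_\nu$ is the modified Bessel function of the second kind. The product $\sin(\pi s)\Gamma(-s-1)$ is understood by continuity at integers $s$.
   Formalization: The first term is proved with a minus sign, −δ_{ab} y^{s+1} sin θ, since dx(v_z(θ)) = −y sin θ makes the printed plus sign false; and δ_{ab} = 1 whenever a and b are Γ-equivalent, not only when equal. *)

theory Defs
  imports "HOL-Analysis.Analysis"
begin

type_synonym mat2 = "real^2^2"

definition SL2R :: "mat2 set" where
  "SL2R = {g. det g = 1}"

definition upper_half_plane :: "complex set" where
  "upper_half_plane = {z. Im z > 0}"

definition SL2R_subgroup :: "mat2 set \<Rightarrow> bool" where
  "SL2R_subgroup \<Gamma> \<longleftrightarrow> \<Gamma> \<subseteq> SL2R \<and> mat 1 \<in> \<Gamma> \<and>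
     (\<forall>g\<in>\<Gamma>. \<forall>h\<in>\<Gamma>. g ** h \<in> \<Gamma>) \<and> (\<forall>g\<in>\<Gamma>. matrix_inv g \<in> \<Gamma>)"

text \<open>Groups are only considered modulo \<open>\<plusminus>I\<close>. A group \<open>\<Gamma>\<close> may or may not contain \<open>-I\<close>;
  identities of sets of matrices modulo \<open>\<plusminus>I\<close> are identities after applying \<open>pm\<close>.\<close>

definition pm :: "mat2 set \<Rightarrow> mat2 set" where
  "pm S = S \<union> uminus ` S"

subsection \<open>Actions\<close>

definition autfac :: "mat2 \<Rightarrow> complex \<Rightarrow> complex" where
  "autfac g z = of_real (g$2$1) * z + of_real (g$2$2)"

definition moebius :: "mat2 \<Rightarrow> complex \<Rightarrow> complex" where
  "moebius g z = (of_real (g$1$1) * z + of_real (g$1$2)) / autfac g z"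

definition tangent_act :: "mat2 \<Rightarrow> complex \<times> complex \<Rightarrow> complex \<times> complex" where
  "tangent_act g = (\<lambda>(z, v). (moebius g z, v / (autfac g z)\<^sup>2))"

text \<open>The boundary \<open>\<real> \<union> {\<infinity>}\<close> of the upper half-plane.\<close>

datatype boundary = Finite real | Infinity

fun boundary_act :: "mat2 \<Rightarrow> boundary \<Rightarrow> boundary" where
  "boundary_act g (Finite x) =
     (if g$2$1 * x + g$2$2 = 0 then Infinity
      else Finite ((g$1$1 * x + g$1$2) / (g$2$1 * x + g$2$2)))"
| "boundary_act g Infinity =
     (if g$2$1 = 0 then Infinity else Finite (g$1$1 / g$2$1))"

subsection \<open>Fuchsian groups of the first kind, cusps and scaling matrices\<close>

definition orbit :: "mat2 set \<Rightarrow> complex \<Rightarrow> complex set" where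
  "orbit \<Gamma> z = (\<lambda>g. moebius g z) ` \<Gamma>"

fun boundary_limit_point :: "complex set \<Rightarrow> boundary \<Rightarrow> bool" where
  "boundary_limit_point S (Finite x) \<longleftrightarrow> complex_of_real x islimpt S"
| "boundary_limit_point S Infinity \<longleftrightarrow> \<not> bounded S"

text \<open>First kind: every point of \<open>\<real> \<union> {\<infinity>}\<close> is a limit point of some orbit.\<close>

definition fuchsian_first_kind :: "mat2 set \<Rightarrow> bool" where
  "fuchsian_first_kind \<Gamma> \<longleftrightarrow> SL2R_subgroup \<Gamma> \<and> discrete \<Gamma> \<and>
     (\<forall>p. \<exists>z\<in>upper_half_plane. boundary_limit_point (orbit \<Gamma> z) p)"

text \<open>The quotient topology on the set of orbits.\<close>

definition orbit_space :: "mat2 set \<Rightarrow> complex set topology" where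
  "orbit_space \<Gamma> = topology (\<lambda>U. U \<subseteq> orbit \<Gamma> ` upper_half_plane \<and>
     openin (top_of_set upper_half_plane) {z \<in> upper_half_plane. orbit \<Gamma> z \<in> U})"

lemma openin_orbit_space:
  "openin (orbit_space \<Gamma>) U \<longleftrightarrow> U \<subseteq> orbit \<Gamma> ` upper_half_plane \<and>
     openin (top_of_set upper_half_plane) {z \<in> upper_half_plane. orbit \<Gamma> z \<in> U}"
proof -
  let ?P = "\<lambda>U. U \<subseteq> orbit \<Gamma> ` upper_half_plane \<and>
     openin (top_of_set upper_half_plane) {z \<in> upper_half_plane. orbit \<Gamma> z \<in> U}"
  have "istopology ?P"
    unfolding istopology_def
  proof (intro conjI allI impI)
    fix S T assume "?P S" "?P T"
    moreover have "{z \<in> upper_half_plane. orbit \<Gamma> z \<in> S \<inter> T} =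
      {z \<in> upper_half_plane. orbit \<Gamma> z \<in> S} \<inter> {z \<in> upper_half_plane. orbit \<Gamma> z \<in> T}"
      by auto
    ultimately show "S \<inter> T \<subseteq> orbit \<Gamma> ` upper_half_plane"
      "openin (top_of_set upper_half_plane) {z \<in> upper_half_plane. orbit \<Gamma> z \<in> S \<inter> T}"
      by (auto intro: openin_Int)
  next
    fix \<K> assume K: "\<forall>K\<in>\<K>. ?P K"
    show "\<Union>\<K> \<subseteq> orbit \<Gamma> ` upper_half_plane" using K by blast
    have "{z \<in> upper_half_plane. orbit \<Gamma> z \<in> \<Union>\<K>} =
      (\<Union>K\<in>\<K>. {z \<in> upper_half_plane. orbit \<Gamma> z \<in> K})" by auto
    then show "openin (top_of_set upper_half_plane) {z \<in> upper_half_plane. orbit \<Gamma> z \<in> \<Union>\<K>}"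
      using K by (auto intro!: openin_Union)
  qed
  then show ?thesis
    unfolding orbit_space_def by (simp add: topology_inverse')
qed

definition boundary_stabilizer :: "mat2 set \<Rightarrow> boundary \<Rightarrow> mat2 set" where
  "boundary_stabilizer \<Gamma> p = {g \<in> \<Gamma>. boundary_act g p = p}"

definition parabolic :: "mat2 \<Rightarrow> bool" where
  "parabolic g \<longleftrightarrow> g \<in> SL2R \<and> \<bar>trace g\<bar> = 2 \<and> g \<noteq> mat 1 \<and> g \<noteq> - mat 1"

definition cusp :: "mat2 set \<Rightarrow> boundary \<Rightarrow> bool" where
  "cusp \<Gamma> p \<longleftrightarrow> (\<exists>g \<in> boundary_stabilizer \<Gamma> p. parabolic g)"

definition translation :: "int \<Rightarrow> mat2" where
  "translation k = vector [vector [1, of_int k], vector [0, 1]]"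

definition scaling_matrix :: "mat2 set \<Rightarrow> boundary \<Rightarrow> mat2 \<Rightarrow> bool" where
  "scaling_matrix \<Gamma> p \<sigma> \<longleftrightarrow> \<sigma> \<in> SL2R \<and> boundary_act \<sigma> Infinity = p \<and>
     pm ((\<lambda>g. matrix_inv \<sigma> ** g ** \<sigma>) ` boundary_stabilizer \<Gamma> p) = pm (range translation)"

text \<open>Cusps are identified when they are \<open>\<Gamma>\<close>-equivalent, i.e. when they are the same cusp of
  the quotient.\<close>

definition cusp_delta :: "mat2 set \<Rightarrow> boundary \<Rightarrow> boundary \<Rightarrow> complex" where
  "cusp_delta \<Gamma> p q = (if \<exists>g\<in>\<Gamma>. boundary_act g q = p then 1 else 0)"

subsection \<open>The Eisenstein series\<close>

definition unit_tangent :: "complex \<Rightarrow> real \<Rightarrow> complex" where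
  "unit_tangent z \<theta> = of_real (Im z) * Complex (- sin \<theta>) (cos \<theta>)"

text \<open>In complex coordinates \<open>dx(v) = Re v\<close>.\<close>

definition alpha1 :: "complex \<Rightarrow> complex \<times> complex \<Rightarrow> complex" where
  "alpha1 s = (\<lambda>(z, v). of_real (Im z) powr s * of_real (Re v))"

text \<open>The sign below is that of the \<open>cusp_delta\<close> term in the Fourier expansion, which is the
  contribution of the coset whose matrices have lower-left entry \<open>0\<close>.\<close>

lemma alpha1_unit_tangent:
  assumes "Im z > 0"
  shows "alpha1 s (z, unit_tangent z \<theta>) = - (of_real (Im z) powr (s + 1) * of_real (sin \<theta>))"
  using assms by (simp add: alpha1_def unit_tangent_def powr_add)

text \<open>The cosets of the stabilizer of \<open>p\<close> acting on \<open>\<Gamma>\<close> from the left, modulo \<open>\<plusminus>I\<close>.\<close>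

definition cusp_cosets :: "mat2 set \<Rightarrow> boundary \<Rightarrow> mat2 set set" where
  "cusp_cosets \<Gamma> p = \<Gamma> // {(g, g'). g \<in> \<Gamma> \<and> g' \<in> \<Gamma> \<and>
     (\<exists>h \<in> boundary_stabilizer \<Gamma> p. g' = h ** g \<or> g' = - (h ** g))}"

text \<open>The summand is independent of the representative, because
  \<open>alpha1 s\<close> is invariant under integer translations.\<close>

definition eisenstein_term ::
    "mat2 \<Rightarrow> complex \<Rightarrow> complex \<times> complex \<Rightarrow> mat2 set \<Rightarrow> complex" where
  "eisenstein_term \<sigma> s w C = alpha1 s (tangent_act (matrix_inv \<sigma> ** (SOME g. g \<in> C)) w)"

definition eisenstein1 ::
    "mat2 set \<Rightarrow> boundary \<Rightarrow> mat2 \<Rightarrow> complex \<times> complex \<Rightarrow> complex \<Rightarrow> complex" where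
  "eisenstein1 \<Gamma> p \<sigma> w s = (\<Sum>\<^sub>\<infinity>C\<in>cusp_cosets \<Gamma> p. eisenstein_term \<sigma> s w C)"

subsection \<open>Double cosets and the Dirichlet series\<close>

definition scaled_matrices :: "mat2 set \<Rightarrow> mat2 \<Rightarrow> mat2 \<Rightarrow> mat2 set" where
  "scaled_matrices \<Gamma> \<sigma>\<^sub>a \<sigma>\<^sub>b = pm ((\<lambda>g. matrix_inv \<sigma>\<^sub>a ** g ** \<sigma>\<^sub>b) ` \<Gamma>)"

text \<open>Double cosets of the group of integer translations, modulo \<open>\<plusminus>I\<close>: each class contains \<open>-g\<close> along with \<open>g\<close>.\<close>

definition double_cosets :: "mat2 set \<Rightarrow> mat2 \<Rightarrow> mat2 \<Rightarrow> mat2 set set" where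
  "double_cosets \<Gamma> \<sigma>\<^sub>a \<sigma>\<^sub>b = scaled_matrices \<Gamma> \<sigma>\<^sub>a \<sigma>\<^sub>b //
     {(g, g'). g \<in> scaled_matrices \<Gamma> \<sigma>\<^sub>a \<sigma>\<^sub>b \<and> g' \<in> scaled_matrices \<Gamma> \<sigma>\<^sub>a \<sigma>\<^sub>b \<and>
       (\<exists>k l. g' = translation k ** g ** translation l \<or>
              g' = - (translation k ** g ** translation l))}"

definition D_set :: "mat2 set \<Rightarrow> mat2 \<Rightarrow> mat2 \<Rightarrow> real \<Rightarrow> mat2 set set" where
  "D_set \<Gamma> \<sigma>\<^sub>a \<sigma>\<^sub>b c = {C \<in> double_cosets \<Gamma> \<sigma>\<^sub>a \<sigma>\<^sub>b. \<exists>g\<in>C. g$2$1 = c}"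

text \<open>The lower-right entry of a representative with lower-left entry \<open>c > 0\<close>; it is determined
  modulo \<open>c\<close>.\<close>

definition lower_right :: "real \<Rightarrow> mat2 set \<Rightarrow> real" where
  "lower_right c C = (SOME g. g \<in> C \<and> g$2$1 = c) $ 2 $ 2"

definition occurring_c :: "mat2 set \<Rightarrow> mat2 \<Rightarrow> mat2 \<Rightarrow> real set" where
  "occurring_c \<Gamma> \<sigma>\<^sub>a \<sigma>\<^sub>b = {c. c > 0 \<and> D_set \<Gamma> \<sigma>\<^sub>a \<sigma>\<^sub>b c \<noteq> {}}"

definition e_char :: "real \<Rightarrow> complex" where
  "e_char w = exp (2 * of_real pi * \<i> * of_real w)"

definition phi0 :: "mat2 set \<Rightarrow> mat2 \<Rightarrow> mat2 \<Rightarrow> complex \<Rightarrow> complex" where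
  "phi0 \<Gamma> \<sigma>\<^sub>a \<sigma>\<^sub>b s = (\<Sum>\<^sub>\<infinity>c\<in>occurring_c \<Gamma> \<sigma>\<^sub>a \<sigma>\<^sub>b.
     of_real c powr (- 2 * s - 2) * of_nat (card (D_set \<Gamma> \<sigma>\<^sub>a \<sigma>\<^sub>b c)))"

definition phi :: "mat2 set \<Rightarrow> mat2 \<Rightarrow> mat2 \<Rightarrow> int \<Rightarrow> complex \<Rightarrow> complex" where
  "phi \<Gamma> \<sigma>\<^sub>a \<sigma>\<^sub>b n s = (\<Sum>\<^sub>\<infinity>c\<in>occurring_c \<Gamma> \<sigma>\<^sub>a \<sigma>\<^sub>b. of_real c powr (- 2 * s - 2) *
     (\<Sum>C\<in>D_set \<Gamma> \<sigma>\<^sub>a \<sigma>\<^sub>b c. e_char (of_int n * (lower_right c C / c))))"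

definition phi1 :: "mat2 set \<Rightarrow> mat2 \<Rightarrow> mat2 \<Rightarrow> int \<Rightarrow> complex \<Rightarrow> complex" where
  "phi1 \<Gamma> \<sigma>\<^sub>a \<sigma>\<^sub>b n s = (\<Sum>\<^sub>\<infinity>c\<in>occurring_c \<Gamma> \<sigma>\<^sub>a \<sigma>\<^sub>b. of_real c powr (- 2 * s - 2) *
     of_real (\<Sum>C\<in>D_set \<Gamma> \<sigma>\<^sub>a \<sigma>\<^sub>b c. cos (2 * pi * of_int n * (lower_right c C / c))))"

definition phi2 :: "mat2 set \<Rightarrow> mat2 \<Rightarrow> mat2 \<Rightarrow> int \<Rightarrow> complex \<Rightarrow> complex" where
  "phi2 \<Gamma> \<sigma>\<^sub>a \<sigma>\<^sub>b n s = (\<Sum>\<^sub>\<infinity>c\<in>occurring_c \<Gamma> \<sigma>\<^sub>a \<sigma>\<^sub>b. of_real c powr (- 2 * s - 2) *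
     of_real (\<Sum>C\<in>D_set \<Gamma> \<sigma>\<^sub>a \<sigma>\<^sub>b c. sin (2 * pi * of_int n * (lower_right c C / c))))"

subsection \<open>Special functions\<close>

text \<open>The modified Bessel function of the second kind, for complex order and positive argument,
  by its standard integral \<open>K\<^sub>\<nu>(x) = \<integral>\<^sub>0\<^sup>\<infinity> exp (-x cosh t) cosh (\<nu>t) dt\<close>, which needs no
  case distinction at integer orders.\<close>

definition bessel_K :: "complex \<Rightarrow> real \<Rightarrow> complex" where
  "bessel_K \<nu> x = (LINT t:{0..}|lborel. of_real (exp (- x * cosh t)) * cosh (\<nu> * of_real t))"

text \<open>The product \<open>sin (\<pi>s) \<Gamma>(-s-1)\<close>, extended by continuity to integer \<open>s\<close>, where
  \<open>Gamma\<close> may have a pole.\<close>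

definition sin_Gamma :: "complex \<Rightarrow> complex" where
  "sin_Gamma s = (if s \<in> \<int>
     then Lim (at s) (\<lambda>w. sin (of_real pi * w) * Gamma (- w - 1))
     else sin (of_real pi * s) * Gamma (- s - 1))"

end

theory Submission
  imports Defs "HOL-Probability.Characteristic_Functions" "HOL-Probability.Sinc_Integral"
    "HOL-Real_Asymp.Real_Asymp"
begin

text \<open>
  Why the expansion holds. For a unimodular \<open>g\<close> the number \<open>alpha1 s (tangent_act g (z, v))\<close>
  depends only on the lower row \<open>(c, d)\<close> of \<open>g\<close>, up to a common sign. Two elements of
  \<open>\<sigma>\<^sub>a\<^sup>-\<^sup>1 \<Gamma> \<sigma>\<^sub>b\<close> have the same lower row up to sign exactly when
  they lie in the same coset of the translations, so the Eisenstein series is a sum over lower rows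
  (\<open>cusp_cosets_bij\<close>). At most one class has \<open>c = 0\<close>; it occurs exactly when the cusps are
  equivalent, and then its row is \<open>(0, 1)\<close>, which gives the \<open>cusp_delta\<close> term
  (\<open>normal_rows_0\<close>). The rows with \<open>c > 0\<close> are \<open>(c, d + mc)\<close> with \<open>m\<close> an integer
  and \<open>d\<close> running over the double cosets with lower-left entry \<open>c\<close> (\<open>lower_rows_bij\<close>).
  Such a row contributes \<open>c\<^sup>-\<^sup>2\<^sup>s\<^sup>-\<^sup>2\<close> times a fixed function \<open>summand\<close> of the real number
  \<open>x + d/c + m\<close> (\<open>row_term_eq_summand\<close>), and the sum over \<open>m\<close> is evaluated by Poisson
  summation (\<open>poisson_summation\<close>).

  The function \<open>summand\<close> is a combination of \<open>(t\<^sup>2 + y\<^sup>2)\<^sup>-\<^sup>a\<close> for \<open>a = s + 1\<close> and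
  \<open>a = s + 2\<close> and of \<open>t (t\<^sup>2 + y\<^sup>2)\<^sup>-\<^sup>s\<^sup>-\<^sup>2\<close>. Writing the power as an
  integral over \<open>v\<close> of \<open>exp (av - (t\<^sup>2 + y\<^sup>2) e\<^sup>v) / Gamma a\<close> makes its Fourier transform a
  superposition of Gaussian transforms, and the integral over \<open>v\<close> that remains is the integral
  representation of the Bessel function (\<open>fourier_radial\<close>), or a Gamma integral at frequency
  \<open>0\<close> (\<open>fourier_radial_0\<close>). The third function is up to a constant the derivative of the first,
  so its transform is \<open>n\<close> times the first one (\<open>fourier_moment_radial\<close>). It is therefore odd
  in \<open>n\<close>: pairing \<open>n\<close> with \<open>-n\<close> produces the sine and cosine series, and the reflection formula
  turns the factor \<open>\<pi> / Gamma (s + 2)\<close> into \<open>sin (\<pi>s) Gamma (-s-1)\<close>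
  (\<open>sin_Gamma_eq\<close>).

  The convergence rests on a separation argument. If \<open>(c, d)\<close> and \<open>(c', d')\<close> are
  lower rows of \<open>g\<close> and \<open>h\<close>, then \<open>c'd - d'c\<close> is the lower-left entry of \<open>h g\<^sup>-\<^sup>1\<close>,
  which lies in a conjugate of \<open>\<Gamma>\<close>; such entries vanish or are bounded away from \<open>0\<close> because
  \<open>\<Gamma>\<close> is discrete and contains a parabolic element
  (\<open>scaled_lower_left_bounded_below\<close>). So the fractions \<open>d/c\<close> modulo \<open>1\<close> with \<open>c \<le> X\<close> are
  separated by a constant times \<open>X\<^sup>-\<^sup>2\<close>, there are \<open>O(X\<^sup>2)\<close> of them
  (\<open>card_index_le\<close>), and \<open>c\<^sup>-\<^sup>w\<close> is summable over the double cosets for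
  \<open>w > 3\<close> (\<open>index_summable\<close>). This crude range suffices, as here \<open>w = 2 Re s + 2 > 4\<close>.
\<close>

section \<open>Convergence of Fourier series\<close>

lemma e_char_eq_cis: "e_char w = cis (2 * pi * w)"
  by (simp add: e_char_def cis_conv_exp mult_ac)

lemma norm_e_char [simp]: "norm (e_char w) = 1"
  by (simp add: e_char_eq_cis)

lemma e_char_add: "e_char (v + w) = e_char v * e_char w"
  by (simp add: e_char_eq_cis cis_mult algebra_simps)

lemma e_char_of_int [simp]: "e_char (of_int n) = 1"
  by (metis e_char_eq_cis cis_multiple_2pi Ints_of_int)

lemma e_char_0 [simp]: "e_char 0 = 1"
  by (simp add: e_char_eq_cis)

lemma cnj_e_char: "cnj (e_char w) = e_char (- w)"
  by (simp add: e_char_eq_cis cis_cnj)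

lemma continuous_on_e_char [continuous_intros]:
  "continuous_on A f \<Longrightarrow> continuous_on A (\<lambda>t. e_char (f t))"
  unfolding e_char_def by (intro continuous_intros)

lemma measurable_e_char [measurable]: "e_char \<in> borel_measurable borel"
  by (intro borel_measurable_continuous_onI continuous_intros)

lemma measurable_cnj [measurable]: "cnj \<in> borel_measurable borel"
  by (intro borel_measurable_continuous_onI continuous_intros)

text \<open>The square norm of \<open>h\<close> minus its orthogonal projection onto the span of the \<open>e i\<close> is
  nonnegative; expanding the product with its conjugate turns this into the inequality.\<close>
lemma bessel_inequality:
  fixes h :: "'a \<Rightarrow> complex" and e :: "'i \<Rightarrow> 'a \<Rightarrow> complex"
  assumes M: "finite_measure M" and [measurable]: "h \<in> borel_measurable M" "\<And>i. e i \<in> borel_measurable M"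
    and h: "\<And>t. t \<in> space M \<Longrightarrow> norm (h t) \<le> B" and e: "\<And>i t. t \<in> space M \<Longrightarrow> norm (e i t) \<le> 1"
    and orth: "\<And>i j. (LINT t|M. e i t * cnj (e j t)) = (if i = j then 1 else 0)"
    and F: "finite F"
  shows "(\<Sum>i\<in>F. (norm (LINT t|M. h t * cnj (e i t)))\<^sup>2) \<le> (LINT t|M. (norm (h t))\<^sup>2)"
proof -
  interpret finite_measure M by fact
  define c where "c i = (LINT t|M. h t * cnj (e i t))" for i
  have int_he: "integrable M (\<lambda>t. h t * cnj (e i t))" for i
    by (rule integrable_const_bound[of _ "B"])
       (auto simp: norm_mult intro!: AE_I2 mult_mono[OF h e, of _ _, simplified] order_trans[OF norm_ge_zero h])
  have int_eh: "integrable M (\<lambda>t. e i t * cnj (h t))" for i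
    using integrable_cnj[OF int_he[of i]] by (simp add: mult.commute)
  have int_ee: "integrable M (\<lambda>t. e i t * cnj (e j t))" for i j
    by (rule integrable_const_bound[of _ "1"])
       (auto simp: norm_mult intro!: AE_I2 mult_le_one e)
  have int_hh: "integrable M (\<lambda>t. h t * cnj (h t))"
    by (rule integrable_const_bound[of _ "B * B"])
       (auto simp: norm_mult intro!: AE_I2 mult_mono h intro: order_trans[OF norm_ge_zero h])
  have eh: "(LINT t|M. e i t * cnj (h t)) = cnj (c i)" for i
    using Bochner_Integration.integral_cnj[of M "\<lambda>t. h t * cnj (e i t)"] by (simp add: mult.commute c_def del: Bochner_Integration.integral_cnj)
  define S where "S t = (\<Sum>i\<in>F. c i * e i t)" for t
  have "0 \<le> (LINT t|M. (norm (h t - S t))\<^sup>2)" by (intro integral_nonneg_AE AE_I2) auto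
  also have "complex_of_real \<dots> = (LINT t|M. (h t - S t) * cnj (h t - S t))"
    unfolding integral_complex_of_real[symmetric] complex_norm_square ..
  also have "\<dots> = (LINT t|M. h t * cnj (h t) - (\<Sum>i\<in>F. cnj (c i) * (h t * cnj (e i t)))
      - (\<Sum>i\<in>F. c i * (e i t * cnj (h t)))
      + (\<Sum>i\<in>F. \<Sum>j\<in>F. c i * cnj (c j) * (e i t * cnj (e j t))))"
  proof (intro Bochner_Integration.integral_cong refl)
    fix t
    have "S t * cnj (S t) = (\<Sum>i\<in>F. \<Sum>j\<in>F. c i * cnj (c j) * (e i t * cnj (e j t)))"
      by (simp add: S_def sum_product mult_ac)
    moreover have "h t * cnj (S t) = (\<Sum>i\<in>F. cnj (c i) * (h t * cnj (e i t)))"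
      by (simp add: S_def sum_distrib_left mult_ac)
    moreover have "S t * cnj (h t) = (\<Sum>i\<in>F. c i * (e i t * cnj (h t)))"
      by (simp add: S_def sum_distrib_left mult_ac)
    ultimately show "(h t - S t) * cnj (h t - S t) = h t * cnj (h t) - (\<Sum>i\<in>F. cnj (c i) * (h t * cnj (e i t)))
      - (\<Sum>i\<in>F. c i * (e i t * cnj (h t)))
      + (\<Sum>i\<in>F. \<Sum>j\<in>F. c i * cnj (c j) * (e i t * cnj (e j t)))"
      by (simp add: algebra_simps)
  qed
  also have "\<dots> = (LINT t|M. h t * cnj (h t)) - (\<Sum>i\<in>F. cnj (c i) * c i)
      - (\<Sum>i\<in>F. c i * cnj (c i)) + (\<Sum>i\<in>F. \<Sum>j\<in>F. c i * cnj (c j) * (if i = j then 1 else 0))"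
    using int_he int_eh int_ee int_hh F
    by (simp add: eh orth flip: c_def)
  also have "\<dots> = of_real (LINT t|M. (norm (h t))\<^sup>2) - of_real (\<Sum>i\<in>F. (norm (c i))\<^sup>2)"
    unfolding integral_complex_of_real[symmetric] of_real_sum complex_norm_square
    using F by (simp add: mult.commute if_distrib sum.delta cong: if_cong)
  finally have "complex_of_real 0 \<le> of_real ((LINT t|M. (norm (h t))\<^sup>2) - (\<Sum>i\<in>F. (norm (c i))\<^sup>2))"
    by (simp add: less_eq_complex_def)
  then show ?thesis by (simp add: c_def less_eq_complex_def)
qed

lemma has_vector_derivative_e_char:
  "((\<lambda>t. e_char (a * t)) has_vector_derivative 2 * of_real pi * \<i> * of_real a * e_char (a * t)) (at t within S)"
proof -
  have "((\<lambda>z. exp (2 * of_real pi * \<i> * of_real a * z)) has_field_derivative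
      2 * of_real pi * \<i> * of_real a * exp (2 * of_real pi * \<i> * of_real a * of_real t)) (at (of_real t))"
    by (auto intro!: derivative_eq_intros)
  from has_vector_derivative_real_field[OF this] show ?thesis
    by (simp add: e_char_def mult_ac)
qed

lemma integral_e_char_unit_interval:
  "(LINT t:{0..1}|lborel. e_char (of_int n * t)) = (if n = 0 then 1 else 0)"
proof (cases "n = 0")
  case True
  then show ?thesis by (simp add: set_lebesgue_integral_def)
next
  case False
  define k where "k = 2 * of_real pi * \<i> * of_int n"
  have k: "k \<noteq> 0" using False by (simp add: k_def)
  have "(LINT t:{0..1}|lborel. e_char (of_int n * t)) = e_char (of_int n * 1) / k - e_char (of_int n * 0) / k"
    unfolding set_lebesgue_integral_def
  proof (rule integral_FTC_Icc)
    fix t :: real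
    show "((\<lambda>t. e_char (of_int n * t) / k) has_vector_derivative e_char (of_int n * t)) (at t within {0..1})"
      using has_vector_derivative_divide[OF has_vector_derivative_e_char[of "of_int n" t "{0..1}"], of k] k
      by (simp add: k_def)
  qed (auto intro!: continuous_intros)
  then show ?thesis using False by simp
qed

text \<open>By the Bessel inequality for the characters the squares of the coefficients are summable
  along every injective sequence of frequencies, so the coefficients tend to \<open>0\<close>.\<close>
lemma riemann_lebesgue_unit_interval:
  fixes h :: "real \<Rightarrow> complex"
  assumes [measurable]: "h \<in> borel_measurable borel" and h: "\<And>t. t \<in> {0..1} \<Longrightarrow> norm (h t) \<le> B"
  defines "c \<equiv> \<lambda>n::int. (LINT t:{0..1}|lborel. h t * e_char (- (of_int n * t)))"
  shows "(\<lambda>k::nat. c (int k)) \<longlonglongrightarrow> 0" and "(\<lambda>k::nat. c (- int k)) \<longlonglongrightarrow> 0"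
proof -
  let ?M = "restrict_space lborel {0..1::real}"
  have fin: "finite_measure ?M"
    by (intro finite_measureI) (simp add: space_restrict_space emeasure_restrict_space)
  have int: "(LINT t|?M. f t) = (LINT t:{0..1}|lborel. f t)" for f :: "real \<Rightarrow> 'b::{banach,second_countable_topology}"
    by (simp add: integral_restrict_space set_lebesgue_integral_def)
  have *: "(\<Sum>n\<in>F. (norm (c n))\<^sup>2) \<le> (LINT t|?M. (norm (h t))\<^sup>2)" if "finite F" for F
  proof -
    have "(LINT t|?M. e_char (of_int n * t) * cnj (e_char (of_int m * t))) = (if n = m then 1 else 0)" for m n
      using integral_e_char_unit_interval[of "n - m"]
      by (simp add: int cnj_e_char e_char_add[symmetric] algebra_simps)
    then have "(\<Sum>n\<in>F. (norm (LINT t|?M. h t * cnj (e_char (of_int n * t))))\<^sup>2) \<le> (LINT t|?M. (norm (h t))\<^sup>2)"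
      using that by (intro bessel_inequality[OF fin, where B = B])
        (auto simp: space_restrict_space h intro!: measurable_restrict_space1)
    then show ?thesis by (simp add: int cnj_e_char c_def)
  qed
  have **: "(\<lambda>k::nat. c (f k)) \<longlonglongrightarrow> 0" if "inj f" for f
  proof -
    have "summable (\<lambda>k. (norm (c (f k)))\<^sup>2)"
    proof (rule bounded_imp_summable)
      fix n show "(\<Sum>k\<le>n. (norm (c (f k)))\<^sup>2) \<le> (LINT t|?M. (norm (h t))\<^sup>2)"
        using *[of "f ` {..n}"] that by (simp add: sum.reindex inj_on_subset)
    qed auto
    from summable_LIMSEQ_zero[OF this] have "(\<lambda>k. sqrt ((norm (c (f k)))\<^sup>2)) \<longlonglongrightarrow> sqrt 0"
      by (intro tendsto_intros)
    then show ?thesis by (simp add: tendsto_norm_zero_iff)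
  qed
  show "(\<lambda>k::nat. c (int k)) \<longlonglongrightarrow> 0" "(\<lambda>k::nat. c (- int k)) \<longlonglongrightarrow> 0"
    by (intro **; simp add: inj_def)+
qed

lemma norm_e_char_minus_1: "norm (e_char t - 1) = 2 * \<bar>sin (pi * t)\<bar>"
proof -
  have "(norm (e_char t - 1))\<^sup>2 = (cos (2 * (pi * t)) - 1)\<^sup>2 + (sin (2 * (pi * t)))\<^sup>2"
    by (simp add: e_char_eq_cis cmod_power2 mult_ac)
  also have "\<dots> = (2 * sin (pi * t))\<^sup>2"
    unfolding cos_double_sin sin_double using sin_cos_squared_add[of "pi * t"] by algebra
  also have "\<dots> = (2 * \<bar>sin (pi * t)\<bar>)\<^sup>2" by (simp add: power_mult_distrib)
  finally show ?thesis by (rule power2_eq_imp_eq) auto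
qed

lemma sin_ge_half:
  assumes "0 \<le> x" "x \<le> pi / 2" shows "x / 2 \<le> sin (x::real)"
proof -
  define f where "f u = sin u - u / 2" for u :: real
  show ?thesis
  proof (cases "x \<le> pi / 3")
    case True
    have "f 0 \<le> f x"
    proof (rule DERIV_nonneg_imp_nondecreasing[OF assms(1)])
      fix u assume "0 \<le> u" "u \<le> x"
      then have "cos (pi / 3) \<le> cos u" using True by (intro cos_monotone_0_pi_le) auto
      then show "\<exists>y. (f has_real_derivative y) (at u) \<and> 0 \<le> y"
        unfolding f_def by (intro exI[of _ "cos u - 1/2"]) (auto intro!: derivative_eq_intros simp: cos_60)
    qed
    then show ?thesis by (simp add: f_def)
  next
    case False
    then have "sin (pi / 3) \<le> sin x" using assms by (intro sin_monotone_2pi_le) auto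
    moreover have "x / 2 \<le> 0.8" using assms pi_less_4 pi_approx by simp
    moreover have "0.8 \<le> sin (pi/3)"
    proof -
      have "1.6 \<le> sqrt (3::real)" by (rule real_le_rsqrt) (simp add: power2_eq_square)
      then show ?thesis by (simp add: sin_60)
    qed
    ultimately show ?thesis by linarith
  qed
qed

text \<open>The zeros of \<open>e_char t - 1\<close> at the integers are simple; this linear lower bound makes the
  quotient in the next lemma bounded.\<close>
lemma norm_e_char_minus_1_ge:
  assumes "0 \<le> t" "t \<le> 1"
  shows "min t (1 - t) \<le> norm (e_char t - 1)"
proof -
  have *: "u \<le> 2 * \<bar>sin (pi * u)\<bar>" if "0 \<le> u" "u \<le> 1/2" for u
  proof -
    have "pi * u / 2 \<le> sin (pi * u)" using that by (intro sin_ge_half) auto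
    moreover have "u \<le> pi * u" using that pi_gt3 by (simp add: mult_le_cancel_right1)
    ultimately show ?thesis by linarith
  qed
  show ?thesis
  proof (cases "t \<le> 1/2")
    case True then show ?thesis using *[of t] assms by (simp add: norm_e_char_minus_1)
  next
    case False
    have "sin (pi * (1 - t)) = sin (pi * t)" by (simp add: algebra_simps)
    then show ?thesis using *[of "1 - t"] False assms by (simp add: norm_e_char_minus_1)
  qed
qed

text \<open>Chernoff's argument: the quotient \<open>h\<close> of \<open>P - p\<close> by \<open>e_char t - 1\<close> is
  bounded because \<open>P\<close> is Lipschitz at the two endpoints. Multiplication by \<open>e_char t - 1\<close>
  acts on Fourier coefficients as a difference operator, so the partial sums of the series of
  \<open>P\<close> telescope to \<open>p\<close> plus two coefficients of \<open>h\<close>, which tend to \<open>0\<close>.\<close>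
lemma fourier_partial_sums_tendsto:
  fixes P :: "real \<Rightarrow> complex"
  assumes [measurable]: "P \<in> borel_measurable borel"
    and L: "\<And>t. t \<in> {0..1} \<Longrightarrow> norm (P t - p) \<le> L * min t (1 - t)"
  defines "c \<equiv> \<lambda>n::int. (LINT t:{0..1}|lborel. P t * e_char (- (of_int n * t)))"
  shows "(\<lambda>N::nat. \<Sum>n\<in>{- int N..int N}. c n) \<longlonglongrightarrow> p"
proof -
  define h where "h t = (P t - p) / (e_char t - 1)" for t
  have [measurable]: "h \<in> borel_measurable borel" unfolding h_def by measurable
  have h: "norm (h t) \<le> \<bar>L\<bar>" if "t \<in> {0..1}" for t
  proof (cases "e_char t = 1")
    case False
    have "norm (P t - p) \<le> L * min t (1 - t)" using L that by auto
    also have "\<dots> \<le> \<bar>L\<bar> * norm (e_char t - 1)"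
      using norm_e_char_minus_1_ge[of t] that by (intro mult_mono) auto
    finally show ?thesis using False by (simp add: h_def norm_divide divide_le_eq)
  qed (simp add: h_def)
  have Ph: "P t = p + h t * (e_char t - 1)" if "t \<in> {0..1}" for t
  proof (cases "e_char t = 1")
    case True
    with norm_e_char_minus_1_ge[of t] that have "min t (1 - t) \<le> 0" by simp
    with L[OF that] that have "norm (P t - p) \<le> 0" by (auto simp: min_def split: if_splits)
    then show ?thesis using True by simp
  qed (simp add: h_def)
  define d where "d n = (LINT t:{0..1}|lborel. h t * e_char (- (of_int n * t)))" for n :: int
  have int_h: "set_integrable lborel {0..1} (\<lambda>t. h t * e_char (- (of_int n * t)))" for n :: int
    unfolding set_integrable_def
    by (rule integrableI_bounded_set_indicator[where B = "\<bar>L\<bar>"])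
       (auto intro!: AE_I2 simp: norm_mult h)
  have int_1: "set_integrable lborel {0..1} (\<lambda>t. p * e_char (of_int n * t))" for n :: int
    by (rule borel_integrable_atLeastAtMost') (intro continuous_intros)
  \<comment> \<open>Multiplying \<open>h\<close> by \<open>e_char t\<close> shifts its coefficients by one.\<close>
  have c: "c n = (if n = 0 then p else 0) + (d (n - 1) - d n)" for n
  proof -
    have "c n = (LINT t:{0..1}|lborel. p * e_char (of_int (-n) * t) + (h t * e_char (- (of_int (n - 1) * t)) - h t * e_char (- (of_int n * t))))"
      unfolding c_def
    proof (rule set_lebesgue_integral_cong, simp, safe)
      fix t :: real assume t: "t \<in> {0..1}"
      have "e_char (- (of_int (n - 1) * t)) = e_char t * e_char (- (of_int n * t))"
        by (simp add: e_char_add[symmetric] algebra_simps)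
      then show "P t * e_char (- (of_int n * t)) = p * e_char (of_int (-n) * t) + (h t * e_char (- (of_int (n - 1) * t)) - h t * e_char (- (of_int n * t)))"
        unfolding Ph[OF t] by (simp add: ring_distribs mult.assoc)
    qed
    also have "\<dots> = (LINT t:{0..1}|lborel. p * e_char (of_int (-n) * t)) + (d (n - 1) - d n)"
      unfolding d_def using int_1[of "-n"] int_h[of "n-1"] int_h[of n]
      by (simp only: set_integral_add set_integral_diff)
    also have "(LINT t:{0..1}|lborel. p * e_char (of_int (-n) * t)) = (if n = 0 then p else 0)"
      using integral_e_char_unit_interval[of "-n"] by simp
    finally show ?thesis .
  qed
  have sum_c: "(\<Sum>n\<in>{- int N..int N}. c n) = p + d (- int (Suc N)) - d (int N)" for N
  proof (induction N)
    case 0 show ?case by (simp add: c)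
  next
    case (Suc N)
    have "{- int (Suc N)..int (Suc N)} = insert (- int (Suc N)) (insert (int (Suc N)) {- int N..int N})"
      by auto
    then have "(\<Sum>n\<in>{- int (Suc N)..int (Suc N)}. c n) = c (- int (Suc N)) + (c (int (Suc N)) + (\<Sum>n\<in>{- int N..int N}. c n))"
      by simp
    also have "\<dots> = p + d (- int (Suc (Suc N))) - d (int (Suc N))"
      unfolding Suc.IH by (simp add: c algebra_simps)
    finally show ?case .
  qed
  have "(\<lambda>N. p + d (- int (Suc N)) - d (int N)) \<longlonglongrightarrow> p + 0 - 0"
    unfolding d_def
    by (intro tendsto_intros LIMSEQ_Suc[OF riemann_lebesgue_unit_interval(2)[where B = "\<bar>L\<bar>"]] riemann_lebesgue_unit_interval(1)[where B = "\<bar>L\<bar>"])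
       (use h in auto)
  then show ?thesis by (simp add: sum_c)
qed

section \<open>Poisson summation\<close>

lemma summable_on_int_inverse_square: "(\<lambda>m::int. 1 / (1 + (of_int m)\<^sup>2 :: real)) summable_on UNIV"
proof -
  have nat: "(\<lambda>k::nat. 1 / (1 + (of_nat k)\<^sup>2 :: real)) summable_on UNIV"
    unfolding summable_on_UNIV_nonneg_real_iff
  proof (subst summable_on_UNIV_nonneg_real_iff)
    show "summable (\<lambda>k::nat. 1 / (1 + (of_nat k)\<^sup>2 :: real))"
    proof (rule summable_comparison_test_ev[OF _ inverse_power_summable[of 2]])
      show "\<forall>\<^sub>F k in sequentially. norm (1 / (1 + (real k)\<^sup>2)) \<le> inverse (real k ^ 2)"
        using eventually_gt_at_top[of 0] by eventually_elim (auto simp: inverse_eq_divide intro!: divide_left_mono mult_pos_pos add_pos_nonneg)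
    qed auto
  qed auto
  have "(\<lambda>m::int. 1 / (1 + (of_int m)\<^sup>2 :: real)) summable_on range int"
    using nat by (subst summable_on_reindex) (auto simp: o_def)
  moreover have "(\<lambda>m::int. 1 / (1 + (of_int m)\<^sup>2 :: real)) summable_on range (\<lambda>k. - int k)"
    using nat by (subst summable_on_reindex) (auto simp: o_def inj_def)
  moreover have "range int \<union> range (\<lambda>k. - int k) = UNIV"
    by (auto simp: image_def) (metis int_cases2)
  ultimately show ?thesis by (metis summable_on_union)
qed

text \<open>Translating the argument costs a factor that depends on the translation alone. This is
  \<open>1 + t\<^sup>2 \<le> 2 (1 + u\<^sup>2) (1 + (u + t)\<^sup>2)\<close>, whose two sides differ by \<open>1\<close> plus squares.\<close>
lemma inverse_one_plus_square_shift:
  "1 / (1 + (u + t)\<^sup>2) \<le> 2 * (1 + u\<^sup>2) / (1 + (t::real)\<^sup>2)"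
proof -
  have "2 * (1 + u\<^sup>2) * (1 + (u + t)\<^sup>2) - (1 + t\<^sup>2) = (u + (u + t))\<^sup>2 + 1 + 2 * u\<^sup>2 * (u + t)\<^sup>2"
    by (simp add: power2_eq_square algebra_simps)
  also have "\<dots> \<ge> 0" by simp
  finally have "1 + t\<^sup>2 \<le> 2 * (1 + u\<^sup>2) * (1 + (u + t)\<^sup>2)" by simp
  moreover have "1 + t\<^sup>2 > 0" "1 + (u + t)\<^sup>2 > 0" by (auto simp: add_pos_nonneg)
  ultimately show ?thesis by (simp add: field_simps)
qed

lemma infsum_int_shift: "(\<Sum>\<^sub>\<infinity>m::int. f (m + k)) = (\<Sum>\<^sub>\<infinity>m. f m)"
  by (rule infsum_reindex_bij_witness[of _ "\<lambda>m. m - k" "\<lambda>m. m + k"]) auto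

text \<open>The half-line integral comes from the arctangent; the function is the sum of its restriction to the positive
  half-line and the reflection of that restriction, up to the point \<open>0\<close>.\<close>
lemma integrable_inverse_one_plus_square: "integrable lborel (\<lambda>t::real. 1 / (1 + t\<^sup>2))"
proof -
  define f where "f t = indicat_real {0<..} t / (1 + t\<^sup>2)" for t :: real
  have "einterval 0 \<infinity> = {0::real<..}" by (auto simp: einterval_def)
  then have f: "integrable lborel f"
    using integrable_I0i_1_div_plus_square unfolding set_integrable_def f_def interval_lebesgue_integrable_def
    by simp
  then have "integrable lborel (\<lambda>t. f (0 + (-1) * t))"
    by (intro lborel_integrable_real_affine) auto
  with f have "integrable lborel (\<lambda>t. f t + f (- t))" by simp
  also have "?this \<longleftrightarrow> ?thesis"
    by (rule integrable_discrete_difference[of "{0}"]) (auto simp: f_def indicator_def)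
  finally show ?thesis .
qed

text \<open>The decay that makes both the integral over the line and the sum over a translated integer
  lattice converge absolutely.\<close>
definition quadratic_decay :: "(real \<Rightarrow> complex) \<Rightarrow> bool" where
  "quadratic_decay f \<longleftrightarrow> (\<exists>C. \<forall>t. norm (f t) \<le> C / (1 + t\<^sup>2))"

lemma quadratic_decayE:
  assumes "quadratic_decay f"
  obtains C where "C \<ge> 0" "\<And>t. norm (f t) \<le> C * (1 / (1 + t\<^sup>2))"
proof -
  obtain C where C: "\<And>t. norm (f t) \<le> C / (1 + t\<^sup>2)" using assms by (auto simp: quadratic_decay_def)
  from order_trans[OF norm_ge_zero C[of 0]] C show ?thesis by (intro that[of C]) auto
qed

lemma quadratic_decayI: "(\<And>t. norm (f t) \<le> C * (1 / (1 + t\<^sup>2))) \<Longrightarrow> quadratic_decay f"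
  unfolding quadratic_decay_def by (intro exI[of _ C]) simp

lemma quadratic_decay_add:
  assumes "quadratic_decay f" "quadratic_decay g"
  shows "quadratic_decay (\<lambda>t. f t + g t)"
proof -
  obtain C D where "\<And>t. norm (f t) \<le> C * (1 / (1 + t\<^sup>2))" "\<And>t. norm (g t) \<le> D * (1 / (1 + t\<^sup>2))"
    using assms by (elim quadratic_decayE) blast
  then show ?thesis
    by (intro quadratic_decayI[where C = "C + D"] order_trans[OF norm_triangle_ineq]) (simp only: distrib_right add_mono)
qed

lemma quadratic_decay_cmult:
  assumes "quadratic_decay f"
  shows "quadratic_decay (\<lambda>t. k * f t)"
proof -
  obtain C where "\<And>t. norm (f t) \<le> C * (1 / (1 + t\<^sup>2))" using assms by (elim quadratic_decayE) blast
  then show ?thesis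
    by (intro quadratic_decayI[where C = "norm k * C"]) (simp only: norm_mult mult.assoc mult_left_mono norm_ge_zero)
qed

lemma quadratic_decay_diff:
  assumes "quadratic_decay f" "quadratic_decay g"
  shows "quadratic_decay (\<lambda>t. f t - g t)"
  using quadratic_decay_add[OF assms(1) quadratic_decay_cmult[OF assms(2), of "- 1"]] by simp

lemma quadratic_decay_shift:
  assumes "quadratic_decay f"
  shows "quadratic_decay (\<lambda>t. f (u + t))"
proof -
  obtain C where C: "C \<ge> 0" "\<And>t. norm (f t) \<le> C * (1 / (1 + t\<^sup>2))" using quadratic_decayE[OF assms] by blast
  have "norm (f (u + t)) \<le> C * (2 * (1 + u\<^sup>2)) * (1 / (1 + t\<^sup>2))" for t
    using order_trans[OF C(2) mult_left_mono[OF inverse_one_plus_square_shift C(1)], of u t] by simp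
  then show ?thesis by (rule quadratic_decayI)
qed

lemma quadratic_decay_integrable:
  assumes "quadratic_decay f" "f \<in> borel_measurable borel"
  shows "integrable lborel f"
proof -
  obtain C where C: "\<And>t. norm (f t) \<le> C * (1 / (1 + t\<^sup>2))" using quadratic_decayE[OF assms(1)] by blast
  show ?thesis
  proof (rule Bochner_Integration.integrable_bound[OF integrable_mult_right[OF integrable_inverse_one_plus_square, of C]])
    show "AE t in lborel. norm (f t) \<le> norm (C * (1 / (1 + t\<^sup>2)))"
      unfolding real_norm_def by (intro AE_I2 order_trans[OF C abs_ge_self])
  qed (use assms(2) in simp)
qed

lemma quadratic_decay_summable:
  assumes "quadratic_decay f"
  shows "(\<lambda>m::int. norm (f (u + of_int m))) summable_on UNIV"
proof -
  obtain C where "\<And>t. norm (f (u + t)) \<le> C * (1 / (1 + t\<^sup>2))"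
    using quadratic_decay_shift[OF assms, of u] by (elim quadratic_decayE) blast
  then show ?thesis
    by (intro summable_on_comparison_test[OF summable_on_cmult_right[OF summable_on_int_inverse_square]]) auto
qed

text \<open>The mean value inequality on a segment of length at most \<open>1\<close>, along which the bound for
  \<open>F'\<close> varies by at most a factor \<open>4\<close>. The Lipschitz constant inherits the decay, so it can be
  summed over the integer translates of \<open>F\<close>.\<close>
lemma quadratic_decay_lipschitz:
  fixes F :: "real \<Rightarrow> complex"
  assumes deriv: "\<And>t. (F has_vector_derivative F' t) (at t)" and decay: "quadratic_decay F'"
  obtains C where "\<And>t t'. \<bar>t - t'\<bar> \<le> 1 \<Longrightarrow> norm (F t - F t') \<le> C * \<bar>t - t'\<bar> * (1 / (1 + t\<^sup>2))"
proof -
  obtain C where C: "C \<ge> 0" "\<And>t. norm (F' t) \<le> C * (1 / (1 + t\<^sup>2))" using quadratic_decayE[OF decay] by blast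
  have "norm (F t - F t') \<le> 4 * C * \<bar>t - t'\<bar> * (1 / (1 + t\<^sup>2))" if tt: "\<bar>t - t'\<bar> \<le> 1" for t t'
  proof -
    have "norm (F t - F t') \<le> C * (4 / (1 + t\<^sup>2)) * norm (t - t')"
    proof (rule differentiable_bound[of "closed_segment t t'" F "\<lambda>x h. h *\<^sub>R F' x"])
      show "(F has_derivative (\<lambda>h. h *\<^sub>R F' x)) (at x within closed_segment t t')" for x
        using deriv[of x] unfolding has_vector_derivative_def by (rule has_derivative_at_withinI)
      fix x assume "x \<in> closed_segment t t'"
      then have "\<bar>x - t\<bar> \<le> 1" using tt by (auto simp: closed_segment_eq_real_ivl split: if_splits)
      then have "1 + (x - t)\<^sup>2 \<le> 2" using abs_square_le_1[of "x - t"] by simp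
      then have "1 / (1 + ((x - t) + t)\<^sup>2) \<le> 4 / (1 + t\<^sup>2)"
        by (intro order_trans[OF inverse_one_plus_square_shift] divide_right_mono) auto
      then have "norm (F' x) \<le> C * (4 / (1 + t\<^sup>2))"
        using order_trans[OF C(2) mult_left_mono[OF _ C(1)], of x "4 / (1 + t\<^sup>2)"] by simp
      moreover have "onorm (\<lambda>h. h *\<^sub>R F' x) = norm (F' x)"
        using onorm_scaleR_left[of "\<lambda>h::real. h" "F' x"] onorm_id[where 'a = real] by simp
      ultimately show "onorm (\<lambda>h. h *\<^sub>R F' x) \<le> C * (4 / (1 + t\<^sup>2))" by simp
    qed auto
    then show ?thesis by (simp add: mult_ac)
  qed
  then show ?thesis by (rule that)
qed

definition fourier :: "(real \<Rightarrow> complex) \<Rightarrow> int \<Rightarrow> complex" where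
  "fourier F n = (LINT t|lborel. F t * e_char (- (of_int n * t)))"

lemma unit_interval_integral_translate:
  fixes g :: "real \<Rightarrow> complex"
  shows "(LINT t:{0..1}|lborel. g (t + of_int m)) = (LINT t:{of_int m..<of_int m + 1}|lborel. g t)"
proof -
  have "(LINT t:{0..1}|lborel. g (t + of_int m)) = (LINT t|lborel. indicator {of_int m..of_int m + 1} (of_int m + 1 * t) *\<^sub>R g (of_int m + 1 * t))"
    unfolding set_lebesgue_integral_def
    by (intro Bochner_Integration.integral_cong) (auto simp: indicator_def add.commute)
  also have "\<dots> = (LINT t:{of_int m..of_int m + 1}|lborel. g t)"
    using lborel_integral_real_affine[of 1 "\<lambda>t. indicator {of_int m..of_int m + 1} t *\<^sub>R g t" "of_int m"]
    unfolding set_lebesgue_integral_def by simp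
  also have "\<dots> = (LINT t:{of_int m..<of_int m + 1}|lborel. g t)"
    unfolding set_lebesgue_integral_def
    by (rule integral_discrete_difference[of "{of_int m + 1}"]) (auto simp: indicator_def)
  finally show ?thesis .
qed

text \<open>The periodization \<open>P\<close> of \<open>F\<close> is Lipschitz, so its Fourier series converges to \<open>P 0\<close>
  at \<open>0\<close>. The unit intervals \<open>[m, m + 1)\<close> tile the line, so the coefficients of \<open>P\<close> are
  the values of the Fourier transform of \<open>F\<close> at the integers.\<close>
lemma poisson_summation_at_0:
  fixes F :: "real \<Rightarrow> complex"
  assumes deriv: "\<And>t. (F has_vector_derivative F' t) (at t)"
    and decay: "quadratic_decay F" "quadratic_decay F'"
    and abs: "(\<lambda>n. norm (fourier F n)) summable_on UNIV"
  shows "(\<Sum>\<^sub>\<infinity>m::int. F (of_int m)) = (\<Sum>\<^sub>\<infinity>n. fourier F n)"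
proof -
  define S where "S = (\<Sum>\<^sub>\<infinity>m::int. 1 / (1 + (of_int m)\<^sup>2 :: real))"
  define P where "P t = (\<Sum>\<^sub>\<infinity>m::int. F (t + of_int m))" for t
  \<comment> \<open>An enumeration of the integers, as the exchange of sum and integral is stated for sequences.\<close>
  define J where "J k = real_of_int (int_decode k)" for k
  have [measurable]: "F \<in> borel_measurable borel"
    using deriv by (intro borel_measurable_continuous_onI continuous_at_imp_continuous_on ballI has_vector_derivative_continuous)
  obtain C where C: "C \<ge> 0" "\<And>t. norm (F t) \<le> C * (1 / (1 + t\<^sup>2))" using quadratic_decayE[OF decay(1)] by blast
  obtain L where L: "\<And>t t'. \<bar>t - t'\<bar> \<le> 1 \<Longrightarrow> norm (F t - F t') \<le> L * \<bar>t - t'\<bar> * (1 / (1 + t\<^sup>2))"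
    using quadratic_decay_lipschitz[OF deriv decay(2)] by blast
  have bd: "norm (F (t + m)) \<le> C * (2 * (1 + t\<^sup>2)) * (1 / (1 + m\<^sup>2))" for t m
    using order_trans[OF C(2) mult_left_mono[OF inverse_one_plus_square_shift C(1)], of t m] by simp
  have abs_F: "(\<lambda>m::int. norm (F (t + of_int m))) summable_on UNIV" for t
    by (rule quadratic_decay_summable[OF decay(1)])
  have P_suminf: "P t = (\<Sum>k. F (t + J k))" "summable (\<lambda>k. norm (F (t + J k)))" for t
  proof -
    have abs_k: "(\<lambda>k. norm (F (t + J k))) summable_on UNIV"
      using summable_on_reindex_bij_betw[OF bij_int_decode, of "\<lambda>m. norm (F (t + of_int m))"] abs_F[of t] by (simp add: J_def)
    then show "summable (\<lambda>k. norm (F (t + J k)))"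
      by (intro summable_on_imp_summable)
    have "P t = (\<Sum>\<^sub>\<infinity>k. F (t + J k))"
      unfolding P_def J_def by (rule infsum_reindex_bij_betw[OF bij_int_decode, symmetric])
    also have "((\<lambda>k. F (t + J k)) has_sum (\<Sum>\<^sub>\<infinity>k. F (t + J k))) UNIV"
      using abs_summable_summable[OF abs_k] by simp
    then have "(\<Sum>\<^sub>\<infinity>k. F (t + J k)) = (\<Sum>k. F (t + J k))"
      using has_sum_imp_sums sums_unique by blast
    finally show "P t = (\<Sum>k. F (t + J k))" .
  qed
  have [measurable]: "P \<in> borel_measurable borel"
    unfolding P_suminf by measurable
  have P_lip: "norm (P t - P (of_int j)) \<le> L * S * \<bar>t - of_int j\<bar>" if "\<bar>t - of_int j\<bar> \<le> 1" for t j
  proof -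
    let ?b = "\<lambda>m::int. L * \<bar>t - of_int j\<bar> * (1 / (1 + (of_int (m + j))\<^sup>2))"
    have b: "norm (F (t + of_int m) - F (of_int j + of_int m)) \<le> ?b m" for m
      using L[of "of_int j + of_int m" "t + of_int m"] that
      by (simp add: norm_minus_commute abs_minus_commute add.commute)
    have S_shift: "(\<lambda>m::int. 1 / (1 + (of_int (m + j))\<^sup>2 :: real)) summable_on UNIV"
      using summable_on_reindex_bij_witness[of UNIV "\<lambda>m. m - j" "\<lambda>m. m + j" UNIV "\<lambda>m. 1 / (1 + (of_int m)\<^sup>2 :: real)" "\<lambda>m. 1 / (1 + (of_int (m + j))\<^sup>2 :: real)"]
        summable_on_int_inverse_square by simp
    have "P t - P (of_int j) = (\<Sum>\<^sub>\<infinity>m::int. F (t + of_int m) - F (of_int j + of_int m))"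
      unfolding P_def using has_sum_infsum[OF abs_summable_summable[OF abs_F[of t]]]
        has_sum_infsum[OF abs_summable_summable[OF abs_F[of "of_int j"]]]
      by (simp only: diff_conv_add_uminus) (intro infsumI[symmetric] has_sum_add has_sum_uminusI)
    also have "norm \<dots> \<le> (\<Sum>\<^sub>\<infinity>m::int. ?b m)"
    proof (rule norm_infsum_le[where X = UNIV, OF has_sum_infsum has_sum_infsum b])
      show b_sum: "?b summable_on UNIV" by (intro summable_on_cmult_right S_shift)
      show "(\<lambda>m. F (t + of_int m) - F (of_int j + of_int m)) summable_on UNIV"
        by (rule abs_summable_summable[OF summable_on_comparison_test[OF b_sum b]]) auto
    qed
    also have "\<dots> = L * \<bar>t - of_int j\<bar> * (\<Sum>\<^sub>\<infinity>m::int. 1 / (1 + (of_int (m + j))\<^sup>2))"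
      by (rule infsum_cmult_right) (rule S_shift)
    also have "\<dots> = L * \<bar>t - of_int j\<bar> * S"
      unfolding S_def by (subst infsum_int_shift[of "\<lambda>m. 1 / (1 + (of_int m)\<^sup>2)"]) simp
    finally show ?thesis by (simp add: mult_ac)
  qed
  have P1: "P 1 = P 0"
    unfolding P_def using infsum_int_shift[of "\<lambda>m. F (of_int m)" 1] by (simp add: add.commute)
  have lim: "(\<lambda>N::nat. \<Sum>n\<in>{- int N..int N}. (LINT t:{0..1}|lborel. P t * e_char (- (of_int n * t)))) \<longlonglongrightarrow> P 0"
  proof (rule fourier_partial_sums_tendsto[where L = "L * S"])
    fix t :: real assume t: "t \<in> {0..1}"
    show "norm (P t - P 0) \<le> L * S * min t (1 - t)"
      using P_lip[of t 0] P_lip[of t 1] t P1 by (simp add: min_def)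
  qed measurable
  have coeff: "(LINT t:{0..1}|lborel. P t * e_char (- (of_int n * t))) = fourier F n" for n
  proof -
    define g where "g t = F t * e_char (- (of_int n * t))" for t
    have [measurable]: "g \<in> borel_measurable borel" unfolding g_def by measurable
    have norm_g: "norm (g t) = norm (F t)" for t by (simp add: g_def norm_mult)
    have int_g: "integrable lborel g"
      using C(2) by (intro quadratic_decay_integrable quadratic_decayI[where C = C]) (auto simp: norm_g)
    define A where "A k = {J k..<J k + 1 :: real}" for k
    have gk: "F (t + J k) * e_char (- (of_int n * t)) = g (t + J k)" for t k
    proof -
      have "e_char (- (of_int n * (t + J k))) = e_char (- (of_int n * t)) * e_char (of_int (- (n * int_decode k)))"
        by (simp add: J_def algebra_simps flip: e_char_add)
      then show ?thesis by (simp only: g_def e_char_of_int mult_1_right)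
    qed
    define h where "h k t = indicat_real {0..1} t *\<^sub>R g (t + J k)" for k t
    define b where "b k = C * 4 * (1 / (1 + (J k)\<^sup>2))" for k
    have bd': "norm (h k t) \<le> b k * indicat_real {0..1} t" for t k
    proof (cases "t \<in> {0..1}")
      case True
      have "norm (g (t + J k)) \<le> C * (2 * (1 + t\<^sup>2)) * (1 / (1 + (J k)\<^sup>2))"
        unfolding norm_g by (rule bd)
      also have "\<dots> \<le> b k" unfolding b_def
        using True C power_le_one[of t 2] by (intro mult_right_mono mult_left_mono) auto
      finally show ?thesis using True by (simp add: h_def)
    qed (simp add: h_def)
    have sum_b: "summable b"
      using summable_on_reindex_bij_betw[OF bij_int_decode, of "\<lambda>m. 1 / (1 + (of_int m)\<^sup>2 :: real)"] summable_on_int_inverse_square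
      unfolding b_def by (intro summable_mult summable_on_imp_summable) (simp add: J_def)
    have int_h: "integrable lborel (h k)" for k
    proof (rule Bochner_Integration.integrable_bound[OF _ _ AE_I2[OF order_trans[OF bd' abs_ge_self, folded real_norm_def]]])
      show "h k \<in> borel_measurable lborel" unfolding h_def[abs_def] by measurable
    qed auto
    have "(LINT t:{0..1}|lborel. P t * e_char (- (of_int n * t))) = (LINT t|lborel. (\<Sum>k. h k t))"
      unfolding set_lebesgue_integral_def
    proof (intro Bochner_Integration.integral_cong refl)
      fix t
      have s: "summable (\<lambda>k. F (t + J k))" using P_suminf(2) by (rule summable_norm_cancel)
      have s': "summable (\<lambda>k. g (t + J k))" unfolding gk[symmetric] by (intro summable_mult2 s)
      have "P t * e_char (- (of_int n * t)) = (\<Sum>k. g (t + J k))"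
        unfolding P_suminf(1) gk[symmetric] by (rule suminf_mult2[OF s])
      then show "indicat_real {0..1} t *\<^sub>R (P t * e_char (- (of_int n * t))) = (\<Sum>k. h k t)"
        using suminf_scaleR_right[OF s'] by (simp add: h_def)
    qed
    also have "\<dots> = (\<Sum>k. integral\<^sup>L lborel (h k))"
    proof (rule integral_suminf[OF int_h AE_I2])
      show "summable (\<lambda>k. norm (h k t))" for t
        by (rule summable_comparison_test'[OF summable_mult2[OF sum_b, of "indicat_real {0..1} t"], of 0]) (use bd'[of _ t] in auto)
      show "summable (\<lambda>k. LINT t|lborel. norm (h k t))"
      proof (rule summable_comparison_test'[OF sum_b, of 0])
        fix k
        have "(LINT t|lborel. norm (h k t)) \<le> (LINT t|lborel. b k * indicat_real {0..1::real} t)"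
          by (intro integral_mono bd' integrable_norm int_h) auto
        then show "norm (LINT t|lborel. norm (h k t)) \<le> b k" by (simp add: integral_nonneg_AE)
      qed
    qed
    also have "\<dots> = (\<Sum>k. LINT t:A k|lborel. g t)"
      unfolding A_def J_def unit_interval_integral_translate[symmetric] by (simp add: h_def[abs_def] J_def set_lebesgue_integral_def)
    also have "\<dots> = (LINT t:(\<Union>k. A k)|lborel. g t)"
    proof (rule lebesgue_integral_countable_add[symmetric])
      show "A i \<inter> A j = {}" if "i \<noteq> j" for i j
      proof -
        have "int_decode i \<noteq> int_decode j" using that inj_int_decode by (metis injD)
        moreover have "int_decode i = int_decode j" if "t \<in> A i" "t \<in> A j" for t
          using that unfolding A_def J_def by simp
        ultimately show ?thesis by blast
      qed
      show "set_integrable lborel (\<Union>i. A i) g"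
        unfolding set_integrable_def by (intro integrable_mult_indicator int_g) (auto simp: A_def)
    qed (auto simp: A_def)
    also have "(\<Union>k. A k) = UNIV"
    proof -
      have "t \<in> A (int_encode \<lfloor>t\<rfloor>)" for t unfolding A_def J_def by simp
      then show ?thesis by blast
    qed
    finally show ?thesis by (simp add: set_lebesgue_integral_def fourier_def g_def)
  qed
  have "filterlim (\<lambda>N::nat. {- int N..int N}) (finite_subsets_at_top UNIV) sequentially"
    unfolding filterlim_finite_subsets_at_top
  proof (intro allI impI)
    fix X :: "int set" assume "finite X \<and> X \<subseteq> UNIV"
    then have fin: "finite ((\<lambda>m. nat \<bar>m\<bar>) ` X)" by simp
    show "\<forall>\<^sub>F N in sequentially. finite {- int N..int N} \<and> X \<subseteq> {- int N..int N} \<and> {- int N..int N} \<subseteq> UNIV"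
      using eventually_ge_at_top[of "Max (insert 0 ((\<lambda>m. nat \<bar>m\<bar>) ` X))"]
    proof eventually_elim
      case (elim N)
      then have "nat \<bar>m\<bar> \<le> N" if "m \<in> X" for m using that fin by simp
      then show ?case by force
    qed
  qed
  then have "(\<lambda>N::nat. \<Sum>n\<in>{- int N..int N}. fourier F n) \<longlonglongrightarrow> (\<Sum>\<^sub>\<infinity>n. fourier F n)"
    using has_sum_infsum[OF abs_summable_summable[OF abs]] unfolding has_sum_def by (rule filterlim_compose[rotated])
  with lim have "P 0 = (\<Sum>\<^sub>\<infinity>n. fourier F n)" unfolding coeff by (rule LIMSEQ_unique)
  then show ?thesis by (simp add: P_def)
qed

lemma poisson_summation:
  fixes F :: "real \<Rightarrow> complex"
  assumes deriv: "\<And>t. (F has_vector_derivative F' t) (at t)"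
    and decay: "quadratic_decay F" "quadratic_decay F'"
    and abs: "(\<lambda>n. norm (fourier F n)) summable_on UNIV"
  shows "(\<Sum>\<^sub>\<infinity>m::int. F (u + of_int m)) = (\<Sum>\<^sub>\<infinity>n. fourier F n * e_char (of_int n * u))"
proof -
  define G where "G t = F (u + t)" for t
  have fG: "fourier G n = fourier F n * e_char (of_int n * u)" for n
  proof -
    have "fourier F n = (LINT t|lborel. G t * e_char (- (of_int n * t)) * e_char (- (of_int n * u)))"
      unfolding fourier_def
      by (subst lborel_integral_real_affine[of 1 _ u])
         (auto simp: G_def algebra_simps e_char_add[symmetric] intro!: Bochner_Integration.integral_cong)
    then have "fourier F n = fourier G n * e_char (- (of_int n * u))" by (simp add: fourier_def)
    then show ?thesis by (simp add: mult.assoc flip: e_char_add)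
  qed
  have "(\<Sum>\<^sub>\<infinity>m::int. G (of_int m)) = (\<Sum>\<^sub>\<infinity>n. fourier G n)"
  proof (rule poisson_summation_at_0)
    show "(G has_vector_derivative F' (u + t)) (at t)" for t
    proof -
      have "((\<lambda>t. u + t) has_vector_derivative 1) (at t)" by (auto intro!: derivative_eq_intros)
      from vector_diff_chain_at[OF this deriv] show ?thesis by (simp add: G_def[abs_def] o_def)
    qed
    show "quadratic_decay G" "quadratic_decay (\<lambda>t. F' (u + t))"
      unfolding G_def[abs_def] by (intro quadratic_decay_shift decay)+
    show "(\<lambda>n. norm (fourier G n)) summable_on UNIV" using abs by (simp add: fG norm_mult)
  qed
  then show ?thesis by (simp add: G_def fG)
qed

section \<open>The Fourier transform of a power of a quadratic polynomial\<close>

text \<open>Euler's integral after the substitution \<open>t = e\<^sup>v\<close>. In the variable \<open>v\<close> every scaling of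
  \<open>t\<close> becomes a translation, under which Lebesgue measure on the line is invariant.\<close>
lemma Gamma_integral_exp_substitution:
  assumes a: "Re a > 0"
  shows "has_bochner_integral lborel (\<lambda>v. exp (a * of_real v - of_real (exp v))) (Gamma a)"
proof -
  let ?f = "\<lambda>t. complex_of_real t powr (a - 1) / of_real (exp t)"
  let ?g = "\<lambda>v. exp (a * of_real v - complex_of_real (exp v))"
  have [measurable]: "?g \<in> borel_measurable borel"
    by (intro borel_measurable_continuous_onI continuous_intros)
  have inj: "inj_on exp (UNIV :: real set)" by (simp add: inj_on_def)
  have range: "range exp = {0::real<..}" by (auto, metis exp_ln rangeI)
  have eq: "\<bar>exp v\<bar> *\<^sub>R ?f (exp v) = ?g v" for v :: real
    by (simp add: powr_def exp_diff scaleR_conv_of_real Ln_of_real algebra_simps exp_minus field_simps flip: exp_of_real)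
  have "(\<lambda>v. \<bar>exp v\<bar> *\<^sub>R ?f (exp v)) absolutely_integrable_on UNIV \<and> integral UNIV (\<lambda>v. \<bar>exp v\<bar> *\<^sub>R ?f (exp v)) = Gamma a
     \<longleftrightarrow> ?f absolutely_integrable_on range exp \<and> integral (range exp) ?f = Gamma a"
    by (rule has_absolute_integral_change_of_variables_real) (auto simp: inj)
  then have "(\<lambda>v. \<bar>exp v\<bar> *\<^sub>R ?f (exp v)) absolutely_integrable_on UNIV \<and> integral UNIV (\<lambda>v. \<bar>exp v\<bar> *\<^sub>R ?f (exp v)) = Gamma a"
    unfolding range using absolutely_integrable_Gamma_integral'[OF a] Gamma_integral_complex'[OF a] by (auto intro: integral_unique)
  then have *: "?g absolutely_integrable_on UNIV" "integral UNIV ?g = Gamma a"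
    unfolding eq by auto
  then have "integrable lborel ?g"
    by (simp add: set_integrable_def integrable_completion)
  moreover have "integral\<^sup>L lborel ?g = Gamma a"
    using *(2) integral_lborel[OF \<open>integrable lborel ?g\<close>] by simp
  ultimately show ?thesis by (simp add: has_bochner_integral_iff)
qed

lemma has_bochner_integral_translate:
  fixes f :: "real \<Rightarrow> complex"
  assumes "has_bochner_integral lborel f I"
  shows "has_bochner_integral lborel (\<lambda>v. f (v + b)) I"
  using assms lborel_has_bochner_integral_real_affine_iff[of 1 f I b] by (simp add: add.commute)

lemma has_bochner_integral_exp_neg_mult_exp:
  assumes a: "Re a > 0" and A: "A > 0"
  shows "has_bochner_integral lborel (\<lambda>v. exp (a * of_real v - of_real (A * exp v))) (Gamma a * of_real A powr (- a))"
proof -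
  have "has_bochner_integral lborel (\<lambda>v. exp (a * of_real (v + ln A) - of_real (exp (v + ln A))) * of_real A powr (-a)) (Gamma a * of_real A powr (-a))"
    by (intro has_bochner_integral_mult_left has_bochner_integral_translate[OF Gamma_integral_exp_substitution[OF a]])
  also have "(\<lambda>v. exp (a * of_real (v + ln A) - of_real (exp (v + ln A))) * of_real A powr (-a)) = (\<lambda>v. exp (a * of_real v - of_real (A * exp v)))"
  proof
    fix v
    have "exp (v + ln A) = A * exp v" using A by (simp add: exp_add)
    then show "exp (a * of_real (v + ln A) - of_real (exp (v + ln A))) * of_real A powr (-a) = exp (a * of_real v - of_real (A * exp v))"
      using A by (simp add: powr_def Ln_of_real algebra_simps flip: exp_add)
  qed
  finally show ?thesis .
qed

text \<open>A rescaling of the characteristic function of the standard normal distribution.\<close>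
lemma gaussian_fourier:
  assumes r: "r > 0"
  shows "has_bochner_integral lborel (\<lambda>t. of_real (exp (- r * t\<^sup>2)) * e_char (- (w * t)))
     (of_real (sqrt (pi / r) * exp (- (pi * w)\<^sup>2 / r)))"
proof -
  \<comment> \<open>The scaling that turns \<open>exp (- r t\<^sup>2)\<close> into the standard normal density, and the matching frequency.\<close>
  define q where "q = sqrt (2 * r)"
  have q: "q > 0" "q\<^sup>2 = 2 * r" using r by (auto simp: q_def)
  define \<xi> where "\<xi> = - 2 * pi * w / q"
  define f where "f x = complex_of_real (std_normal_density x) * iexp (\<xi> * x)" for x
  have "integrable lborel f"
  proof (rule Bochner_Integration.integrable_bound)
    show "integrable lborel std_normal_density" by (rule integrable_normal_density) simp
    show "f \<in> borel_measurable lborel" unfolding f_def by measurable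
  qed (auto simp: f_def norm_mult intro!: AE_I2)
  moreover have "integral\<^sup>L lborel f = of_real (exp (- \<xi>\<^sup>2 / 2))"
    using fun_cong[OF char_std_normal_distribution, of \<xi>] unfolding char_def f_def
    by (subst (asm) integral_density) (auto simp: scaleR_conv_of_real)
  ultimately have "has_bochner_integral lborel f (of_real (exp (- \<xi>\<^sup>2 / 2)))"
    by (simp add: has_bochner_integral_iff)
  then have "has_bochner_integral lborel (\<lambda>t. f (0 + q * t)) (of_real (exp (- \<xi>\<^sup>2 / 2)) /\<^sub>R \<bar>q\<bar>)"
    using lborel_has_bochner_integral_real_affine_iff[of q f "of_real (exp (- \<xi>\<^sup>2 / 2))" 0] q(1) by simp
  then have "has_bochner_integral lborel (\<lambda>t. of_real (sqrt (2 * pi)) * f (0 + q * t)) (of_real (sqrt (2 * pi)) * (of_real (exp (- \<xi>\<^sup>2 / 2)) /\<^sub>R \<bar>q\<bar>))"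
    by (rule has_bochner_integral_mult_right)
  also have "(\<lambda>t. of_real (sqrt (2 * pi)) * f (0 + q * t)) = (\<lambda>t. of_real (exp (- r * t\<^sup>2)) * e_char (- (w * t)))"
    using q by (auto simp: f_def std_normal_density_def e_char_def \<xi>_def power_mult_distrib fun_eq_iff mult_ac)
  also have "of_real (sqrt (2 * pi)) * (of_real (exp (- \<xi>\<^sup>2 / 2)) /\<^sub>R \<bar>q\<bar>) = complex_of_real (sqrt (pi / r) * exp (- (pi * w)\<^sup>2 / r))"
  proof -
    have "\<xi>\<^sup>2 / 2 = (pi * w)\<^sup>2 / r" using q r by (simp add: \<xi>_def power_divide power_mult_distrib)
    moreover have "sqrt (2 * pi) / q = sqrt (pi / r)" using r by (simp add: q_def flip: real_sqrt_divide)
    ultimately show ?thesis using q(1)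
      by (simp add: scaleR_conv_of_real field_simps)
  qed
  finally show ?thesis .
qed

text \<open>The function \<open>(t\<^sup>2 + y\<^sup>2)\<^sup>-\<^sup>a\<close>; the principal branch of the power is applied to a
  positive number when \<open>y > 0\<close>.\<close>
definition radial :: "real \<Rightarrow> complex \<Rightarrow> real \<Rightarrow> complex" where
  "radial y a t = of_real (t\<^sup>2 + y\<^sup>2) powr (- a)"

text \<open>A form in which differentiability and measurability are visible.\<close>
lemma radial_eq_exp:
  assumes "y > 0"
  shows "radial y a t = exp (- a * of_real (ln (t\<^sup>2 + y\<^sup>2)))"
proof -
  have "t\<^sup>2 + y\<^sup>2 > 0" using assms by (auto simp: add_nonneg_pos)
  then show ?thesis unfolding radial_def powr_def of_real_eq_0_iff
    using Ln_of_real[of "t\<^sup>2 + y\<^sup>2"] by auto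
qed

lemma norm_radial: "y > 0 \<Longrightarrow> norm (radial y a t) = (t\<^sup>2 + y\<^sup>2) powr (- Re a)"
  unfolding radial_def by (subst norm_powr_real_powr) (auto simp: add_nonneg_pos)

lemma powr_neg_le_inverse_square:
  assumes "y > 0" "p \<ge> (1::real)"
  shows "(t\<^sup>2 + y\<^sup>2) powr (- p) \<le> (y\<^sup>2) powr (1 - p) / min 1 (y\<^sup>2) / (1 + t\<^sup>2)"
proof -
  have pos: "t\<^sup>2 + y\<^sup>2 > 0" "y\<^sup>2 > 0" "1 + t\<^sup>2 > 0" using assms by (auto simp: add_nonneg_pos add_pos_nonneg)
  have k: "min 1 (y\<^sup>2) * (1 + t\<^sup>2) \<le> t\<^sup>2 + y\<^sup>2"
    by (cases "y\<^sup>2 \<le> 1") (auto simp: min_def algebra_simps mult_left_le)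
  have "(t\<^sup>2 + y\<^sup>2) powr (- p) = (t\<^sup>2 + y\<^sup>2) powr (1 - p) * (1 / (t\<^sup>2 + y\<^sup>2))"
    using pos by (simp add: powr_diff powr_minus field_simps)
  also have "\<dots> \<le> (y\<^sup>2) powr (1 - p) * (1 / (min 1 (y\<^sup>2) * (1 + t\<^sup>2)))"
    using assms pos k by (intro mult_mono powr_mono2' divide_left_mono) auto
  finally show ?thesis by simp
qed

lemma quadratic_decay_powr:
  assumes "y > 0" "p \<ge> (1::real)" "\<And>t. norm (f t) \<le> (t\<^sup>2 + y\<^sup>2) powr (- p)"
  shows "quadratic_decay f"
  unfolding quadratic_decay_def using order_trans[OF assms(3) powr_neg_le_inverse_square[OF assms(1,2)]] by blast

lemma quadratic_decay_radial:
  assumes "y > 0" "Re a \<ge> 1"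
  shows "quadratic_decay (radial y a)"
  by (rule quadratic_decay_powr[OF assms]) (simp add: norm_radial[OF assms(1)])

lemma measurable_radial [measurable (raw)]: "y > 0 \<Longrightarrow> radial y a \<in> borel_measurable borel"
proof -
  assume "y > 0"
  then have "radial y a = (\<lambda>t. exp (- a * of_real (ln (t\<^sup>2 + y\<^sup>2))))" by (simp add: radial_eq_exp fun_eq_iff)
  then show ?thesis by simp
qed

text \<open>Write \<open>Gamma a * radial y a t\<close> as an integral over \<open>v\<close> of
  \<open>exp (av - (t\<^sup>2 + y\<^sup>2) e\<^sup>v)\<close>, exchange the integrals, and evaluate the inner one, which is now a
  Gaussian in \<open>t\<close>. The Gaussian contributes \<open>\<surd>\<pi> e\<^sup>-\<^sup>v\<^sup>/\<^sup>2\<close>, which lowers the exponent from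
  \<open>a\<close> to \<open>a - 1/2\<close>. The exchange is justified by the same computation for the absolute value, where
  \<open>Re a\<close> takes the place of \<open>a\<close> and the character is dropped.\<close>
lemma Gamma_fourier_radial:
  assumes y: "y > 0" and a: "Re a \<ge> 1"
  shows "Gamma a * fourier (radial y a) n = of_real (sqrt pi) *
     (LINT v|lborel. exp ((a - 1/2) * of_real v - of_real (y\<^sup>2 * exp v + (pi * of_int n)\<^sup>2 * exp (- v))))"
proof -
  define f where "f = (\<lambda>(t, v). exp (a * of_real v - of_real ((t\<^sup>2 + y\<^sup>2) * exp v)) * e_char (- (of_int n * t)))"
  have pos: "t\<^sup>2 + y\<^sup>2 > 0" for t using y by (auto simp: add_nonneg_pos)
  have inner: "has_bochner_integral lborel (\<lambda>v. f (t, v)) (Gamma a * radial y a t * e_char (- (of_int n * t)))" for t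
    unfolding f_def radial_def prod.case
    using a by (intro has_bochner_integral_mult_left has_bochner_integral_exp_neg_mult_exp pos) auto
  have norm_f: "norm (f (t, v)) = exp (Re a * v - (t\<^sup>2 + y\<^sup>2) * exp v)" for t v
    by (simp add: f_def norm_mult)
  have "(LINT v|lborel. norm (f (t, v))) = Gamma (Re a) * (t\<^sup>2 + y\<^sup>2) powr (- Re a)" for t
  proof -
    have "has_bochner_integral lborel (\<lambda>v. exp (complex_of_real (Re a) * of_real v - of_real ((t\<^sup>2 + y\<^sup>2) * exp v))) (Gamma (of_real (Re a)) * of_real (t\<^sup>2 + y\<^sup>2) powr (- of_real (Re a)))"
      using a by (intro has_bochner_integral_exp_neg_mult_exp pos) auto
    also have "(\<lambda>v. exp (complex_of_real (Re a) * of_real v - of_real ((t\<^sup>2 + y\<^sup>2) * exp v))) = (\<lambda>v. complex_of_real (norm (f (t, v))))"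
      unfolding norm_f by (simp flip: exp_of_real)
    also have "Gamma (of_real (Re a)) * of_real (t\<^sup>2 + y\<^sup>2) powr (- of_real (Re a)) = complex_of_real (Gamma (Re a) * (t\<^sup>2 + y\<^sup>2) powr (- Re a))"
      using pos[of t] by (simp add: Gamma_complex_of_real less_imp_le powr_of_real[symmetric] del: of_real_add)
    finally have "has_bochner_integral lborel (\<lambda>v. complex_of_real (norm (f (t, v)))) (complex_of_real (Gamma (Re a) * (t\<^sup>2 + y\<^sup>2) powr (- Re a)))" .
    then show ?thesis by (metis has_bochner_integral_integral_eq integral_complex_of_real of_real_eq_iff)
  qed
  moreover have [measurable]: "f \<in> borel_measurable (lborel \<Otimes>\<^sub>M lborel)"
    unfolding f_def by measurable
  moreover have "integrable lborel (\<lambda>t. (t\<^sup>2 + y\<^sup>2) powr (- Re a))"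
    using integrable_norm[OF quadratic_decay_integrable[OF quadratic_decay_radial[OF y a]]] y by (simp add: norm_radial)
  ultimately have int_f: "integrable (lborel \<Otimes>\<^sub>M lborel) f"
    using inner by (intro lborel_pair.Fubini_integrable)
      (auto intro!: integrable_mult_right AE_I2 simp: has_bochner_integral_iff)
  have "Gamma a * fourier (radial y a) n = (LINT t|lborel. LINT v|lborel. f (t, v))"
    using has_bochner_integral_integral_eq[OF inner] by (simp add: fourier_def mult.assoc)
  also have "\<dots> = (LINT v|lborel. LINT t|lborel. f (t, v))"
    using lborel_pair.Fubini_integral[of "\<lambda>t v. f (t, v)"] int_f by simp
  also have "\<dots> = (LINT v|lborel. of_real (sqrt pi) * exp ((a - 1/2) * of_real v - of_real (y\<^sup>2 * exp v + (pi * of_int n)\<^sup>2 * exp (- v))))"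
  proof (intro Bochner_Integration.integral_cong refl)
    fix v :: real
    have "(LINT t|lborel. f (t, v)) = exp (a * of_real v - of_real (y\<^sup>2 * exp v)) * (LINT t|lborel. of_real (exp (- exp v * t\<^sup>2)) * e_char (- (of_int n * t)))"
      unfolding integral_mult_right_zero[symmetric]
      by (intro Bochner_Integration.integral_cong refl)
         (simp add: f_def algebra_simps exp_diff exp_minus exp_add flip: exp_of_real, simp add: field_simps)
    also have "(LINT t|lborel. of_real (exp (- exp v * t\<^sup>2)) * e_char (- (of_int n * t))) = of_real (sqrt (pi / exp v) * exp (- (pi * of_int n)\<^sup>2 / exp v))"
      by (intro has_bochner_integral_integral_eq gaussian_fourier) auto
    also have "sqrt (pi / exp v) = sqrt pi * exp (- v / 2)"
    proof -
      have "sqrt (exp v) = exp (v / 2)" by (rule real_sqrt_unique) (auto simp: power2_eq_square simp flip: exp_add)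
      then show ?thesis by (simp add: real_sqrt_divide exp_minus field_simps)
    qed
    also have "exp (a * of_real v - of_real (y\<^sup>2 * exp v)) * of_real (sqrt pi * exp (- v / 2) * exp (- (pi * of_int n)\<^sup>2 / exp v)) =
       of_real (sqrt pi) * (exp (a * of_real v - of_real (y\<^sup>2 * exp v)) * exp (of_real (- v / 2)) * exp (of_real (- (pi * of_int n)\<^sup>2 / exp v)))"
      unfolding exp_of_real of_real_mult by (simp only: mult_ac)
    also have "exp (a * of_real v - of_real (y\<^sup>2 * exp v)) * exp (of_real (- v / 2)) * exp (of_real (- (pi * of_int n)\<^sup>2 / exp v)) =
       exp ((a - 1/2) * of_real v - of_real (y\<^sup>2 * exp v + (pi * of_int n)\<^sup>2 * exp (- v)))"
    proof -
      have "- (pi * of_int n)\<^sup>2 / exp v = - ((pi * of_int n)\<^sup>2 * exp (- v))" by (simp add: exp_minus divide_inverse)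
      then show ?thesis unfolding exp_add[symmetric]
        by (intro arg_cong[where f = exp]) (simp only: of_real_add of_real_minus of_real_divide of_real_numeral left_diff_distrib, simp)
    qed
    finally show "(LINT t|lborel. f (t, v)) = of_real (sqrt pi) * exp ((a - 1/2) * of_real v - of_real (y\<^sup>2 * exp v + (pi * of_int n)\<^sup>2 * exp (- v)))" .
  qed
  finally show ?thesis by simp
qed

lemma fourier_radial_0:
  assumes y: "y > 0" and a: "Re a \<ge> 1"
  shows "fourier (radial y a) 0 = of_real (sqrt pi) * Gamma (a - 1/2) / Gamma a * of_real y powr (1 - 2 * a)"
proof -
  have "Gamma a * fourier (radial y a) 0 = of_real (sqrt pi) * (Gamma (a - 1/2) * of_real (y\<^sup>2) powr (- (a - 1/2)))"
    using has_bochner_integral_integral_eq[OF has_bochner_integral_exp_neg_mult_exp[of "a - 1/2" "y\<^sup>2"]] a y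
    by (simp add: Gamma_fourier_radial)
  also have "of_real (y\<^sup>2) powr (- (a - 1/2)) = of_real y powr (1 - 2 * a)"
    using y by (simp add: powr_def Ln_of_real ln_realpow algebra_simps flip: of_real_power)
  finally show ?thesis using Gamma_eq_zero_iff[of a] a by (auto simp: field_simps elim!: nonpos_Ints_cases)
qed

text \<open>Since \<open>cosh v \<ge> e\<^sup>v / 2\<close>, a Gamma integrand is a majorant.\<close>
lemma integrable_exp_minus_cosh:
  assumes "x > 0" "Re \<nu> > 0"
  shows "integrable lborel (\<lambda>v. exp (\<nu> * of_real v - of_real (x * cosh v)))"
proof (rule Bochner_Integration.integrable_bound)
  show "integrable lborel (\<lambda>v. exp (\<nu> * of_real v - of_real (x / 2 * exp v)))"
    using has_bochner_integral_exp_neg_mult_exp[of \<nu> "x / 2"] assms by (simp add: has_bochner_integral_iff)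
  show "(\<lambda>v. exp (\<nu> * of_real v - of_real (x * cosh v))) \<in> borel_measurable lborel"
    by (simp, intro borel_measurable_continuous_onI continuous_intros)
  have "x / 2 * exp v \<le> x * cosh v" for v using assms by (simp add: cosh_def field_simps)
  then show "AE v in lborel. norm (exp (\<nu> * of_real v - complex_of_real (x * cosh v))) \<le> norm (exp (\<nu> * of_real v - of_real (x / 2 * exp v)))"
    by (intro AE_I2) (simp add: algebra_simps)
qed

text \<open>Folding the line at \<open>0\<close> replaces \<open>exp (\<nu>v)\<close> by \<open>2 cosh (\<nu>v)\<close>.\<close>
lemma integral_exp_minus_cosh:
  assumes "x > 0" "Re \<nu> > 0"
  shows "(LINT v|lborel. exp (\<nu> * of_real v - of_real (x * cosh v))) = 2 * bessel_K \<nu> x"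
proof -
  define g where "g v = exp (\<nu> * of_real v - of_real (x * cosh v))" for v :: real
  have g: "integrable lborel g" unfolding g_def by (rule integrable_exp_minus_cosh[OF assms])
  have int: "integrable lborel (\<lambda>v. indicat_real {0..} v *\<^sub>R g v)" "integrable lborel (\<lambda>v. indicat_real {..<0} v *\<^sub>R g v)"
    by (intro integrable_mult_indicator g; simp)+
  have "integral\<^sup>L lborel g = (LINT v|lborel. indicat_real {0..} v *\<^sub>R g v + indicat_real {..<0} v *\<^sub>R g v)"
    by (intro Bochner_Integration.integral_cong) (auto simp: indicator_def)
  also have "\<dots> = (LINT v|lborel. indicat_real {0..} v *\<^sub>R g v) + (LINT v|lborel. indicat_real {..<0} v *\<^sub>R g v)"
    by (rule Bochner_Integration.integral_add[OF int])
  also have "(LINT v|lborel. indicat_real {..<0} v *\<^sub>R g v) = (LINT v|lborel. indicat_real {..<0} (0 + (-1) * v) *\<^sub>R g (0 + (-1) * v))"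
    by (subst lborel_integral_real_affine[of "-1" _ 0]) auto
  also have "\<dots> = (LINT v|lborel. indicat_real {0..} v *\<^sub>R g (- v))"
    by (rule integral_discrete_difference[of "{0}"]) (auto simp: indicator_def)
  also have "(LINT v|lborel. indicat_real {0..} v *\<^sub>R g v) + (LINT v|lborel. indicat_real {0..} v *\<^sub>R g (- v)) = (LINT v|lborel. indicat_real {0..} v *\<^sub>R g v + indicat_real {0..} v *\<^sub>R g (- v))"
  proof (rule Bochner_Integration.integral_add[symmetric, OF int(1)])
    have "integrable lborel (\<lambda>v. g (0 + (-1) * v))" using g by (intro lborel_integrable_real_affine) auto
    then show "integrable lborel (\<lambda>v. indicat_real {0..} v *\<^sub>R g (- v))"
      by (intro integrable_mult_indicator) auto
  qed
  also have "\<dots> = (LINT v|lborel. 2 * (indicat_real {0..} v *\<^sub>R (of_real (exp (- x * cosh v)) * cosh (\<nu> * of_real v))))"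
  proof (intro Bochner_Integration.integral_cong refl)
    fix v :: real
    have "g v + g (- v) = 2 * (of_real (exp (- x * cosh v)) * cosh (\<nu> * of_real v))"
    proof -
      have "g u = exp (\<nu> * of_real u) * of_real (exp (- x * cosh u))" for u
        by (simp add: g_def exp_diff exp_minus divide_inverse flip: exp_of_real)
      then show ?thesis by (simp add: cosh_field_def[of "\<nu> * of_real v"] algebra_simps)
    qed
    then show "indicat_real {0..} v *\<^sub>R g v + indicat_real {0..} v *\<^sub>R g (- v) = 2 * (indicat_real {0..} v *\<^sub>R (of_real (exp (- x * cosh v)) * cosh (\<nu> * of_real v)))"
      by (metis mult_scaleR_right scaleR_add_right)
  qed
  also have "\<dots> = 2 * bessel_K \<nu> x"
    unfolding bessel_K_def set_lebesgue_integral_def by (rule Bochner_Integration.integral_mult_right_zero)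
  finally show ?thesis by (simp add: g_def)
qed

lemma bessel_K_minus: "bessel_K (- \<nu>) x = bessel_K \<nu> x"
  by (simp add: bessel_K_def)

text \<open>Exponential decay: as \<open>cosh \<ge> 1\<close>, passing from \<open>x\<^sub>0\<close> to a larger \<open>x\<close> multiplies the
  integrand by at most \<open>exp (x\<^sub>0 - x)\<close>.\<close>
lemma norm_bessel_K_le:
  assumes "x\<^sub>0 > 0" "Re \<nu> > 0"
  obtains B where "\<And>x. x \<ge> x\<^sub>0 \<Longrightarrow> norm (bessel_K \<nu> x) \<le> B * exp (- x)"
proof
  define I where "I = (LINT v|lborel. norm (exp (\<nu> * of_real v - complex_of_real (x\<^sub>0 * cosh v))))"
  fix x assume x: "x \<ge> x\<^sub>0"
  have "2 * norm (bessel_K \<nu> x) = norm (LINT v|lborel. exp (\<nu> * of_real v - complex_of_real (x * cosh v)))"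
    using assms x by (subst integral_exp_minus_cosh) (auto simp: norm_mult)
  also have "\<dots> \<le> (LINT v|lborel. exp (x\<^sub>0 - x) * norm (exp (\<nu> * of_real v - complex_of_real (x\<^sub>0 * cosh v))))"
  proof (rule Bochner_Integration.integral_norm_bound_integral)
    show "integrable lborel (\<lambda>v. exp (\<nu> * of_real v - complex_of_real (x * cosh v)))"
      using assms x by (intro integrable_exp_minus_cosh) auto
    show "integrable lborel (\<lambda>v. exp (x\<^sub>0 - x) * norm (exp (\<nu> * of_real v - complex_of_real (x\<^sub>0 * cosh v))))"
      using assms by (intro integrable_mult_right integrable_norm integrable_exp_minus_cosh) auto
    fix v
    have "x - x\<^sub>0 \<le> (x - x\<^sub>0) * cosh v" using x cosh_real_ge_1[of v] by (simp add: mult_le_cancel_left1)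
    then show "norm (exp (\<nu> * of_real v - complex_of_real (x * cosh v))) \<le> exp (x\<^sub>0 - x) * norm (exp (\<nu> * of_real v - complex_of_real (x\<^sub>0 * cosh v)))"
      by (simp add: algebra_simps flip: exp_add)
  qed
  also have "\<dots> = exp (x\<^sub>0 - x) * I" by (simp add: I_def)
  finally show "norm (bessel_K \<nu> x) \<le> (exp x\<^sub>0 * I / 2) * exp (- x)" by (simp add: exp_diff exp_minus field_simps)
qed

text \<open>In the integral of \<open>Gamma_fourier_radial\<close> the two exponential terms
  \<open>y\<^sup>2 e\<^sup>v\<close> and \<open>(\<pi>n)\<^sup>2 e\<^sup>-\<^sup>v\<close> are balanced by translating \<open>v\<close> by \<open>ln (\<pi>|n|/y)\<close>;
  both then equal \<open>\<pi>|n|y\<close> times an exponential, and together they form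
  \<open>2\<pi>|n|y cosh v\<close>.\<close>
lemma fourier_radial:
  assumes y: "y > 0" and a: "Re a \<ge> 1" and n: "n \<noteq> 0"
  shows "fourier (radial y a) n = 2 * of_real pi powr a * of_int \<bar>n\<bar> powr (a - 1/2) * of_real y powr (1/2 - a)
    * bessel_K (a - 1/2) (2 * pi * of_int \<bar>n\<bar> * y) / Gamma a"
proof -
  define N where "N = real_of_int \<bar>n\<bar>"
  have N: "N > 0" using n by (simp add: N_def)
  \<comment> \<open>The translation by \<open>ln b\<close> that balances the two exponentials.\<close>
  define b where "b = pi * N / y"
  have b: "b > 0" using N y by (simp add: b_def)
  define g where "g v = exp ((a - 1/2) * of_real v - complex_of_real (y\<^sup>2 * exp v + (pi * of_int n)\<^sup>2 * exp (- v)))" for v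
  have "g (v + ln b) = of_real b powr (a - 1/2) * exp ((a - 1/2) * of_real v - of_real (2 * pi * N * y * cosh v))" for v
  proof -
    have nN: "(pi * real_of_int n)\<^sup>2 = (pi * N)\<^sup>2" by (simp add: N_def power_mult_distrib)
    have 1: "y\<^sup>2 * exp (v + ln b) = pi * N * y * exp v"
      using b y by (simp add: exp_add b_def power2_eq_square)
    have 2: "(pi * N)\<^sup>2 * exp (- (v + ln b)) = pi * N * y * exp (- v)"
      using b y N by (simp add: exp_add exp_diff exp_minus b_def power2_eq_square field_simps)
    have "y\<^sup>2 * exp (v + ln b) + (pi * N)\<^sup>2 * exp (- (v + ln b)) = 2 * pi * N * y * cosh v"
      unfolding 1 2 cosh_field_def by (simp add: field_simps)
    then show ?thesis unfolding g_def nN using b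
      by (simp add: powr_def Ln_of_real algebra_simps flip: exp_add)
  qed
  then have "(LINT v|lborel. g (v + ln b)) = of_real b powr (a - 1/2) * (2 * bessel_K (a - 1/2) (2 * pi * N * y))"
    using integral_exp_minus_cosh[of "2 * pi * N * y" "a - 1/2"] N y a by simp
  moreover have "(LINT v|lborel. g (v + ln b)) = integral\<^sup>L lborel g"
    using lborel_integral_real_affine[of 1 g "ln b"] by (simp add: add.commute)
  ultimately have "Gamma a * fourier (radial y a) n = of_real (sqrt pi) * of_real b powr (a - 1/2) * (2 * bessel_K (a - 1/2) (2 * pi * N * y))"
    unfolding Gamma_fourier_radial[OF y a] g_def[symmetric] by (simp add: mult.assoc)
  also have "of_real (sqrt pi) * of_real b powr (a - 1/2) = of_real pi powr a * of_real N powr (a - 1/2) * of_real y powr (1/2 - a)"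
  proof -
    have "complex_of_real (sqrt pi) = of_real pi powr (1/2)"
      using powr_of_real[of pi "1/2"] by (simp add: powr_half_sqrt)
    then show ?thesis
      using N y unfolding b_def by (simp add: powr_def Ln_of_real ln_mult ln_div algebra_simps flip: exp_add of_real_mult of_real_divide)
  qed
  finally have main: "Gamma a * fourier (radial y a) n = of_real pi powr a * of_real N powr (a - 1/2) * of_real y powr (1/2 - a) * (2 * bessel_K (a - 1/2) (2 * pi * N * y))" .
  have "complex_of_int \<bar>n\<bar> = of_real N" unfolding N_def by (simp only: of_real_of_int_eq)
  moreover have "Gamma a \<noteq> 0" using Gamma_eq_zero_iff[of a] a by (auto elim!: nonpos_Ints_cases)
  ultimately show ?thesis unfolding N_def[symmetric] using main
    by (simp add: eq_divide_eq mult_ac)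
qed

lemma has_vector_derivative_radial:
  assumes y: "y > 0"
  shows "(radial y a has_vector_derivative - 2 * a * (of_real t * radial y (a + 1) t)) (at t)"
proof -
  have pos: "t\<^sup>2 + y\<^sup>2 > 0" for t using y by (auto simp: add_nonneg_pos)
  note eq = radial_eq_exp[OF y]
  have "((\<lambda>t. of_real (ln (t\<^sup>2 + y\<^sup>2))) has_vector_derivative (of_real (2 * t / (t\<^sup>2 + y\<^sup>2)) :: complex)) (at t)"
    unfolding has_vector_derivative_def
    apply (rule has_derivative_eq_rhs)
    apply (rule has_derivative_of_real)
    apply (rule has_field_derivative_imp_has_derivative[of _ "2 * t / (t\<^sup>2 + y\<^sup>2)"])
    using pos[of t] by (auto intro!: derivative_eq_intros simp: fun_eq_iff scaleR_conv_of_real mult_ac)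
  then have "((\<lambda>t. - a * of_real (ln (t\<^sup>2 + y\<^sup>2))) has_vector_derivative - a * of_real (2 * t / (t\<^sup>2 + y\<^sup>2))) (at t)"
    by (rule has_vector_derivative_mult_right)
  from field_vector_diff_chain_at[OF this DERIV_exp]
  have "((\<lambda>t. exp (- a * of_real (ln (t\<^sup>2 + y\<^sup>2)))) has_vector_derivative - a * of_real (2 * t / (t\<^sup>2 + y\<^sup>2)) * exp (- a * of_real (ln (t\<^sup>2 + y\<^sup>2)))) (at t)"
    by (simp add: o_def)
  also have "- a * of_real (2 * t / (t\<^sup>2 + y\<^sup>2)) * exp (- a * of_real (ln (t\<^sup>2 + y\<^sup>2))) = - 2 * a * (of_real t * radial y (a + 1) t)"
  proof -
    have "radial y (a + 1) t = exp (- a * of_real (ln (t\<^sup>2 + y\<^sup>2))) / of_real (t\<^sup>2 + y\<^sup>2)"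
    proof -
      have "exp (- (a + 1) * of_real (ln (t\<^sup>2 + y\<^sup>2))) = exp (- a * of_real (ln (t\<^sup>2 + y\<^sup>2))) * exp (complex_of_real (- ln (t\<^sup>2 + y\<^sup>2)))"
        by (simp add: algebra_simps flip: exp_add)
      also have "exp (complex_of_real (- ln (t\<^sup>2 + y\<^sup>2))) = 1 / of_real (t\<^sup>2 + y\<^sup>2)"
        using pos[of t] unfolding exp_of_real by (simp add: exp_minus inverse_eq_divide del: of_real_add)
      finally show ?thesis unfolding eq by simp
    qed
    then show ?thesis by (simp add: field_simps)
  qed
  finally show ?thesis unfolding eq[abs_def] by simp
qed

text \<open>A factor \<open>t\<close> costs half a power of \<open>t\<^sup>2 + y\<^sup>2\<close>.\<close>
lemma quadratic_decay_moment_radial: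
  assumes y: "y > 0" and a: "Re a \<ge> 1"
  shows "quadratic_decay (\<lambda>t. of_real t * radial y (a + 1) t)"
    and "quadratic_decay (\<lambda>t. (of_real t)\<^sup>2 * radial y (a + 1) t)"
proof -
  have pos: "t\<^sup>2 + y\<^sup>2 > 0" for t using y by (auto simp: add_nonneg_pos)
  show "quadratic_decay (\<lambda>t. of_real t * radial y (a + 1) t)"
  proof (rule quadratic_decay_powr[OF y, of "Re a + 1/2"])
    fix t
    have "\<bar>t\<bar> \<le> sqrt (t\<^sup>2 + y\<^sup>2)" by (rule real_le_rsqrt) simp
    also have "\<dots> = (t\<^sup>2 + y\<^sup>2) powr (1/2)" using pos by (simp add: powr_half_sqrt)
    finally have "norm (of_real t * radial y (a + 1) t) \<le> (t\<^sup>2 + y\<^sup>2) powr (1/2) * (t\<^sup>2 + y\<^sup>2) powr (- Re (a + 1))"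
      unfolding norm_mult norm_of_real norm_radial[OF y] by (intro mult_right_mono) auto
    also have "\<dots> = (t\<^sup>2 + y\<^sup>2) powr (- (Re a + 1/2))"
      unfolding powr_add[symmetric] by (rule arg_cong[where f = "\<lambda>p. _ powr p"]) simp
    finally show "norm (of_real t * radial y (a + 1) t) \<le> (t\<^sup>2 + y\<^sup>2) powr (- (Re a + 1/2))" .
  qed (use a in simp)
  show "quadratic_decay (\<lambda>t. (of_real t)\<^sup>2 * radial y (a + 1) t)"
  proof (rule quadratic_decay_powr[OF y a])
    fix t
    have "norm ((of_real t)\<^sup>2 * radial y (a + 1) t) \<le> (t\<^sup>2 + y\<^sup>2) powr 1 * (t\<^sup>2 + y\<^sup>2) powr (- Re (a + 1))"
      using pos[of t] unfolding norm_mult norm_power norm_of_real norm_radial[OF y] by (intro mult_right_mono) auto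
    then show "norm ((of_real t)\<^sup>2 * radial y (a + 1) t) \<le> (t\<^sup>2 + y\<^sup>2) powr (- Re a)"
      unfolding powr_add[symmetric] by simp
  qed
qed

text \<open>The function is \<open>-1/(2a)\<close> times the derivative of \<open>radial y a\<close>; integration by parts has no
  boundary terms, since \<open>radial y a\<close> vanishes at infinity, and it multiplies the transform by
  \<open>2\<pi>in\<close>.\<close>
lemma fourier_moment_radial:
  assumes y: "y > 0" and a: "Re a \<ge> 1"
  shows "fourier (\<lambda>t. of_real t * radial y (a + 1) t) n = - (of_real pi * \<i> * of_int n / a) * fourier (radial y a) n"
proof -
  define G where "G t = radial y a t * e_char (- (of_int n * t))" for t
  define k where "k = 2 * of_real pi * \<i> * complex_of_int n"
  define G' where "G' t = - 2 * a * (of_real t * radial y (a + 1) t) * e_char (- (of_int n * t)) - k * (radial y a t * e_char (- (of_int n * t)))" for t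
  have a0: "a \<noteq> 0" using a by auto
  have e: "((\<lambda>t. e_char (- (of_int n * t))) has_vector_derivative - k * e_char (- (of_int n * t))) (at t)" for t
    using has_vector_derivative_e_char[of "- of_int n" t UNIV] by (simp add: k_def)
  have deriv: "(G has_vector_derivative G' t) (at t)" for t
    unfolding G_def
    by (rule has_vector_derivative_eq_rhs[OF has_vector_derivative_mult[OF has_vector_derivative_radial[OF y, of a t] e[of t]]])
      (simp add: G'_def algebra_simps)
  have cont: "isCont (radial y b) t" for b t
    using has_vector_derivative_radial[OF y] by (rule has_vector_derivative_continuous)
  have contG': "isCont G' t" for t
    unfolding G'_def e_char_def by (intro continuous_intros cont)
  have int_e: "integrable lborel (\<lambda>t. f t * e_char (- (of_int n * t)))"
    if "quadratic_decay f" "f \<in> borel_measurable borel" for f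
  proof (rule Bochner_Integration.integrable_bound[OF quadratic_decay_integrable[OF that]])
    show "AE t in lborel. norm (f t * e_char (- (of_int n * t))) \<le> norm (f t)" by (simp add: norm_mult)
  qed (use that(2) in simp)
  have int1: "integrable lborel (\<lambda>t. of_real t * radial y (a + 1) t * e_char (- (of_int n * t)))"
    by (rule int_e[OF quadratic_decay_moment_radial(1)[OF y a]]) (use y in measurable)
  have int2: "integrable lborel (\<lambda>t. radial y a t * e_char (- (of_int n * t)))"
    by (rule int_e[OF quadratic_decay_radial[OF y a]]) (use y in measurable)
  have intG': "integrable lborel G'"
    unfolding G'_def using integrable_mult_right[OF int1, of "- 2 * a"] integrable_mult_right[OF int2, of k]
    by (intro Bochner_Integration.integrable_diff) (auto simp: mult.assoc)
  obtain C where C: "\<And>t. norm (radial y a t) \<le> C * (1 / (1 + t\<^sup>2))"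
    using quadratic_decayE[OF quadratic_decay_radial[OF y a]] by blast
  have lim: "(G \<longlongrightarrow> 0) F" if "((\<lambda>t. C * (1 / (1 + t\<^sup>2))) \<longlongrightarrow> 0) F" for F
    by (rule Lim_null_comparison[OF always_eventually that]) (use C in \<open>simp add: G_def norm_mult\<close>)
  have "(LBINT t=-\<infinity>..\<infinity>. G' t) = 0 - 0"
  proof (rule interval_integral_FTC_integrable[of "-\<infinity>" "\<infinity>" G G'])
    show "set_integrable lborel (einterval (- \<infinity>) \<infinity>) G'"
      using intG' by (simp add: set_integrable_def)
    show "((G \<circ> real_of_ereal) \<longlongrightarrow> 0) (at_right (- \<infinity>))"
      unfolding ereal_tendsto_simps by (rule lim) real_asymp
    show "((G \<circ> real_of_ereal) \<longlongrightarrow> 0) (at_left \<infinity>)"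
      unfolding ereal_tendsto_simps by (rule lim) real_asymp
  qed (use deriv contG' in auto)
  then have "integral\<^sup>L lborel G' = 0"
    by (simp add: interval_lebesgue_integral_def set_lebesgue_integral_def)
  moreover have "integral\<^sup>L lborel G' = - 2 * a * fourier (\<lambda>t. of_real t * radial y (a + 1) t) n - k * fourier (radial y a) n"
    unfolding G'_def fourier_def using integrable_mult_right[OF int1, of "- 2 * a"] integrable_mult_right[OF int2, of k]
    by (subst Bochner_Integration.integral_diff) (auto simp: mult.assoc)
  ultimately have "k * fourier (radial y a) n = - (2 * (a * fourier (\<lambda>t. of_real t * radial y (a + 1) t) n))"
    by (simp add: mult.assoc)
  then have "2 * (a * fourier (\<lambda>t. of_real t * radial y (a + 1) t) n) = - (k * fourier (radial y a) n)"
    by simp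
  then have "2 * (a * fourier (\<lambda>t. of_real t * radial y (a + 1) t) n) = 2 * - (of_real pi * \<i> * of_int n * fourier (radial y a) n)"
    unfolding k_def by (simp only: mult.assoc mult_minus_right)
  then have "a * fourier (\<lambda>t. of_real t * radial y (a + 1) t) n = - (of_real pi * \<i> * of_int n * fourier (radial y a) n)"
    by (rule mult_left_cancel[THEN iffD1, rotated]) simp
  then have "fourier (\<lambda>t. of_real t * radial y (a + 1) t) n = - (of_real pi * \<i> * of_int n * fourier (radial y a) n) / a"
    using a0 by (metis nonzero_mult_div_cancel_left)
  then show ?thesis by simp
qed

lemma summable_on_int_exp_decay:
  fixes f :: "int \<Rightarrow> complex"
  assumes c: "c > 0" and f: "\<And>n. n \<noteq> 0 \<Longrightarrow> norm (f n) \<le> B * of_int \<bar>n\<bar> powr p * exp (- c * of_int \<bar>n\<bar>)"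
  shows "(\<lambda>n. norm (f n)) summable_on UNIV"
proof -
  have "(\<lambda>k::nat. real k powr p * exp (- c * real k) * (1 + (real k)\<^sup>2)) \<longlonglongrightarrow> 0"
    using c by real_asymp
  then have "Bseq (\<lambda>k::nat. real k powr p * exp (- c * real k) * (1 + (real k)\<^sup>2))"
    by (intro convergent_imp_Bseq convergentI)
  then obtain K where K: "\<And>k::nat. norm (real k powr p * exp (- c * real k) * (1 + (real k)\<^sup>2)) \<le> K"
    by (auto simp: Bseq_def)
  have "norm (f n) \<le> (norm (f 0) + \<bar>B\<bar> * K) * (1 / (1 + (of_int n)\<^sup>2))" for n
  proof (cases "n = 0")
    case True
    have "K \<ge> 0" using K[of 0] by (rule order_trans[OF norm_ge_zero])
    then show ?thesis using True by simp
  next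
    case False
    define X where "X = of_int \<bar>n\<bar> powr p * exp (- c * of_int \<bar>n\<bar>)"
    have pos: "1 + (of_int n)\<^sup>2 > (0::real)" by (simp add: add_pos_nonneg)
    have "X * (1 + (of_int n)\<^sup>2) \<le> K"
      using K[of "nat \<bar>n\<bar>"] by (simp add: X_def abs_mult)
    then have X: "X \<le> K * (1 / (1 + (of_int n)\<^sup>2))" using pos by (simp add: field_simps)
    have "norm (f n) \<le> B * X" using f[OF False] by (simp add: X_def mult.assoc)
    also have "\<dots> \<le> \<bar>B\<bar> * X" by (intro mult_right_mono) (auto simp: X_def)
    also have "\<dots> \<le> \<bar>B\<bar> * (K * (1 / (1 + (of_int n)\<^sup>2)))" by (intro mult_left_mono X) auto
    also have "\<dots> \<le> (norm (f 0) + \<bar>B\<bar> * K) * (1 / (1 + (of_int n)\<^sup>2))"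
      using pos by (simp add: field_simps)
    finally show ?thesis .
  qed
  then show ?thesis
    by (intro summable_on_comparison_test[OF summable_on_cmult_right[OF summable_on_int_inverse_square]]) auto
qed

lemma fourier_radial_summable:
  assumes y: "y > 0" and a: "Re a \<ge> 1"
  shows "(\<lambda>n. norm (fourier (radial y a) n)) summable_on UNIV"
    and "(\<lambda>n. norm (fourier (\<lambda>t. of_real t * radial y (a + 1) t) n)) summable_on UNIV"
proof -
  obtain B where B: "\<And>x. x \<ge> 2 * pi * y \<Longrightarrow> norm (bessel_K (a - 1/2) x) \<le> B * exp (- x)"
    using norm_bessel_K_le[of "2 * pi * y" "a - 1/2"] y a by auto
  define D where "D = norm (2 * of_real pi powr a * of_real y powr (1/2 - a) / Gamma a)"
  have *: "norm (fourier (radial y a) n) \<le> D * B * of_int \<bar>n\<bar> powr (Re a - 1/2) * exp (- (2 * pi * y) * of_int \<bar>n\<bar>)" if n: "n \<noteq> 0" for n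
  proof -
    have n1: "real_of_int \<bar>n\<bar> \<ge> 1" using n by linarith
    have "norm (fourier (radial y a) n) = D * of_int \<bar>n\<bar> powr (Re a - 1/2) * norm (bessel_K (a - 1/2) (2 * pi * of_int \<bar>n\<bar> * y))"
      using norm_powr_real_powr[of "of_int \<bar>n\<bar>" "a - 1/2"]
      by (simp add: fourier_radial[OF y a n] D_def norm_mult norm_divide)
    also have "\<dots> \<le> D * of_int \<bar>n\<bar> powr (Re a - 1/2) * (B * exp (- (2 * pi * of_int \<bar>n\<bar> * y)))"
      using mult_right_mono[OF n1, of "2 * pi * y"] y by (intro mult_left_mono B) (auto simp: D_def mult_ac)
    finally show ?thesis by (simp add: mult_ac)
  qed
  show "(\<lambda>n. norm (fourier (radial y a) n)) summable_on UNIV"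
    using y by (intro summable_on_int_exp_decay[OF _ *]) auto
  have "norm (fourier (\<lambda>t. of_real t * radial y (a + 1) t) n) \<le> (pi / norm a * (D * B)) * of_int \<bar>n\<bar> powr (Re a + 1/2) * exp (- (2 * pi * y) * of_int \<bar>n\<bar>)" if n: "n \<noteq> 0" for n
  proof -
    have n0: "real_of_int \<bar>n\<bar> > 0" using n by simp
    have "norm (fourier (\<lambda>t. of_real t * radial y (a + 1) t) n) = pi / norm a * of_int \<bar>n\<bar> * norm (fourier (radial y a) n)"
      by (simp add: fourier_moment_radial[OF y a] norm_mult norm_divide)
    also have "\<dots> \<le> pi / norm a * of_int \<bar>n\<bar> * (D * B * of_int \<bar>n\<bar> powr (Re a - 1/2) * exp (- (2 * pi * y) * of_int \<bar>n\<bar>))"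
      by (intro mult_left_mono *[OF n]) auto
    also have "\<dots> = (pi / norm a * (D * B)) * (of_int \<bar>n\<bar> powr 1 * of_int \<bar>n\<bar> powr (Re a - 1/2)) * exp (- (2 * pi * y) * of_int \<bar>n\<bar>)"
      using n0 by simp
    also have "real_of_int \<bar>n\<bar> powr 1 * of_int \<bar>n\<bar> powr (Re a - 1/2) = of_int \<bar>n\<bar> powr (Re a + 1/2)"
      unfolding powr_add[symmetric] by (rule arg_cong[where f = "\<lambda>p. real_of_int \<bar>n\<bar> powr p"]) simp
    finally show ?thesis .
  qed
  from summable_on_int_exp_decay[OF _ this]
  show "(\<lambda>n. norm (fourier (\<lambda>t. of_real t * radial y (a + 1) t) n)) summable_on UNIV"
    using y by simp
qed

lemma poisson_radial:
  assumes y: "y > 0" and a: "Re a \<ge> 1"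
  shows "(\<Sum>\<^sub>\<infinity>m::int. radial y a (u + of_int m)) = (\<Sum>\<^sub>\<infinity>n. fourier (radial y a) n * e_char (of_int n * u))"
  by (intro poisson_summation[OF has_vector_derivative_radial[OF y]] fourier_radial_summable[OF y a]
      quadratic_decay_radial[OF y a] quadratic_decay_cmult quadratic_decay_moment_radial[OF y a])

lemma poisson_moment_radial:
  assumes y: "y > 0" and a: "Re a \<ge> 1"
  shows "(\<Sum>\<^sub>\<infinity>m::int. of_real (u + of_int m) * radial y (a + 1) (u + of_int m))
    = (\<Sum>\<^sub>\<infinity>n. fourier (\<lambda>t. of_real t * radial y (a + 1) t) n * e_char (of_int n * u))"
proof (rule poisson_summation)
  show "((\<lambda>t. of_real t * radial y (a + 1) t) has_vector_derivative
      radial y (a + 1) t - 2 * (a + 1) * ((of_real t)\<^sup>2 * radial y (a + 1 + 1) t)) (at t)" for t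
    by (rule has_vector_derivative_eq_rhs[OF has_vector_derivative_mult[OF has_vector_derivative_of_real[OF DERIV_ident] has_vector_derivative_radial[OF y, of "a + 1" t]]])
      (simp add: algebra_simps power2_eq_square)
  show "quadratic_decay (\<lambda>t. radial y (a + 1) t - 2 * (a + 1) * ((of_real t)\<^sup>2 * radial y (a + 1 + 1) t))"
    using a by (intro quadratic_decay_diff quadratic_decay_cmult quadratic_decay_radial quadratic_decay_moment_radial y) auto
qed (intro quadratic_decay_moment_radial[OF y a] fourier_radial_summable[OF y a])+

section \<open>Matrices and scaled groups\<close>

lemma mat2_eq_iff: "A = B \<longleftrightarrow> A$1$1 = B$1$1 \<and> A$1$2 = B$1$2 \<and> A$2$1 = B$2$1 \<and> A$2$2 = (B$2$2 :: real)"
  for A B :: mat2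
  by (auto simp: vec_eq_iff forall_2)

lemma mat2_mult_nth: "(A ** B)$i$j = A$i$1 * B$1$j + A$i$2 * B$2$j" for A B :: mat2
  by (simp add: matrix_matrix_mult_def sum_2)

lemma mat2_one_nth: "(mat 1 :: mat2)$1$1 = 1" "(mat 1 :: mat2)$1$2 = 0" "(mat 1 :: mat2)$2$1 = 0" "(mat 1 :: mat2)$2$2 = 1"
  by (simp_all add: mat_def)

lemma translation_nth:
  "translation k$1$1 = 1" "translation k$1$2 = of_int k" "translation k$2$1 = 0" "translation k$2$2 = 1"
  by (simp_all add: translation_def)

lemma SL2R_iff: "g \<in> SL2R \<longleftrightarrow> g$1$1 * g$2$2 - g$1$2 * g$2$1 = 1"
  by (simp add: SL2R_def det_2)

text \<open>The adjugate, which is the inverse of a unimodular matrix and, unlike \<open>matrix_inv\<close>, is given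
  by a formula for every matrix.\<close>
definition adj2 :: "mat2 \<Rightarrow> mat2" where
  "adj2 g = vector [vector [g$2$2, - g$1$2], vector [- g$2$1, g$1$1]]"

lemma adj2_nth: "adj2 g$1$1 = g$2$2" "adj2 g$1$2 = - g$1$2" "adj2 g$2$1 = - g$2$1" "adj2 g$2$2 = g$1$1"
  by (simp_all add: adj2_def)

lemmas mat2_simps = mat2_eq_iff mat2_mult_nth mat2_one_nth translation_nth adj2_nth

lemma adj2_inverse: "g \<in> SL2R \<Longrightarrow> adj2 g ** g = mat 1" "g \<in> SL2R \<Longrightarrow> g ** adj2 g = mat 1"
  by (auto simp: mat2_simps SL2R_iff algebra_simps)

lemma matrix_inv_SL2R: "g \<in> SL2R \<Longrightarrow> matrix_inv g = adj2 g"
  unfolding matrix_inv_def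
  by (rule some_equality) (auto simp: adj2_inverse, metis adj2_inverse(2) matrix_mul_assoc matrix_mul_lid matrix_mul_rid)

lemma SL2R_mult: "g \<in> SL2R \<Longrightarrow> h \<in> SL2R \<Longrightarrow> g ** h \<in> SL2R"
  by (simp add: SL2R_def det_mul)

lemma SL2R_adj2: "g \<in> SL2R \<Longrightarrow> adj2 g \<in> SL2R"
  by (simp add: SL2R_iff adj2_nth mult.commute)

lemma SL2R_uminus: "g \<in> SL2R \<Longrightarrow> - g \<in> SL2R"
  by (simp add: SL2R_iff)

lemma adj2_mult: "adj2 (g ** h) = adj2 h ** adj2 g"
  by (simp add: mat2_simps algebra_simps)

lemma adj2_adj2: "adj2 (adj2 g) = g"
  by (simp add: mat2_simps)

lemma adj2_uminus: "adj2 (- g) = - adj2 g"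
  by (simp add: mat2_simps)

lemma mat2_uminus_mult: "(- A) ** B = - (A ** B)" "A ** (- B) = - (A ** B)" for A B :: mat2
  by (simp_all add: mat2_simps)

lemma boundary_act_mult_Infinity:
  assumes "g \<in> SL2R" "h \<in> SL2R"
  shows "boundary_act g (boundary_act h Infinity) = boundary_act (g ** h) Infinity"
proof (cases "h$2$1 = 0")
  case True
  then have "h$1$1 \<noteq> 0" using assms(2) by (auto simp: SL2R_iff)
  then show ?thesis using True by (simp add: mat2_mult_nth)
next
  case False
  then have "g$2$1 * (h$1$1 / h$2$1) + g$2$2 = (g$2$1 * h$1$1 + g$2$2 * h$2$1) / h$2$1"
    "g$1$1 * (h$1$1 / h$2$1) + g$1$2 = (g$1$1 * h$1$1 + g$1$2 * h$2$1) / h$2$1"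
    by (simp_all add: field_simps)
  then show ?thesis using False by (simp add: mat2_mult_nth)
qed

lemma boundary_act_Infinity_eq_iff:
  assumes "g \<in> SL2R" "h \<in> SL2R"
  shows "boundary_act g Infinity = boundary_act h Infinity \<longleftrightarrow> (adj2 h ** g)$2$1 = 0"
  using assms by (auto simp: SL2R_iff mat2_mult_nth adj2_nth field_simps)

text \<open>Both sides say that \<open>\<sigma>\<^sup>-\<^sup>1 g \<tau>\<close> fixes the boundary point at infinity.\<close>
lemma boundary_act_scaling_iff:
  assumes "g \<in> SL2R" "\<sigma> \<in> SL2R" "\<tau> \<in> SL2R"
  shows "boundary_act g (boundary_act \<tau> Infinity) = boundary_act \<sigma> Infinity \<longleftrightarrow> (adj2 \<sigma> ** g ** \<tau>)$2$1 = 0"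
  using assms by (simp add: boundary_act_mult_Infinity boundary_act_Infinity_eq_iff SL2R_mult matrix_mul_assoc del: boundary_act.simps)

lemma scaled_matrices_iff:
  assumes "\<sigma> \<in> SL2R"
  shows "g \<in> scaled_matrices \<Gamma> \<sigma> \<tau> \<longleftrightarrow> (\<exists>\<gamma>\<in>\<Gamma>. g = adj2 \<sigma> ** \<gamma> ** \<tau> \<or> g = - (adj2 \<sigma> ** \<gamma> ** \<tau>))"
  using assms by (auto simp: scaled_matrices_def pm_def matrix_inv_SL2R)

lemma scaled_matrices_mult:
  assumes \<Gamma>: "SL2R_subgroup \<Gamma>" and \<sigma>: "\<sigma> \<in> SL2R" and \<tau>: "\<tau> \<in> SL2R"
    and g: "g \<in> scaled_matrices \<Gamma> \<sigma> \<tau>" and h: "h \<in> scaled_matrices \<Gamma> \<tau> \<upsilon>"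
  shows "g ** h \<in> scaled_matrices \<Gamma> \<sigma> \<upsilon>"
proof -
  obtain \<gamma> \<eta> where gh: "\<gamma> \<in> \<Gamma>" "\<eta> \<in> \<Gamma>" "g = adj2 \<sigma> ** \<gamma> ** \<tau> \<or> g = - (adj2 \<sigma> ** \<gamma> ** \<tau>)"
    "h = adj2 \<tau> ** \<eta> ** \<upsilon> \<or> h = - (adj2 \<tau> ** \<eta> ** \<upsilon>)"
    using g h by (auto simp: scaled_matrices_iff[OF \<sigma>] scaled_matrices_iff[OF \<tau>])
  have "(adj2 \<sigma> ** \<gamma> ** \<tau>) ** (adj2 \<tau> ** \<eta> ** \<upsilon>) = adj2 \<sigma> ** \<gamma> ** (\<tau> ** adj2 \<tau>) ** \<eta> ** \<upsilon>"
    by (simp add: matrix_mul_assoc)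
  also have "\<dots> = adj2 \<sigma> ** (\<gamma> ** \<eta>) ** \<upsilon>"
    by (simp add: adj2_inverse[OF \<tau>] matrix_mul_assoc)
  finally show ?thesis
    using gh \<Gamma> unfolding scaled_matrices_iff[OF \<sigma>] SL2R_subgroup_def
    by (intro bexI[of _ "\<gamma> ** \<eta>"]) (auto simp: mat2_uminus_mult)
qed

lemma scaled_matrices_adj2:
  assumes \<Gamma>: "SL2R_subgroup \<Gamma>" and \<sigma>: "\<sigma> \<in> SL2R" and \<tau>: "\<tau> \<in> SL2R"
    and g: "g \<in> scaled_matrices \<Gamma> \<sigma> \<tau>"
  shows "adj2 g \<in> scaled_matrices \<Gamma> \<tau> \<sigma>"
proof -
  obtain \<gamma> where "\<gamma> \<in> \<Gamma>" "g = adj2 \<sigma> ** \<gamma> ** \<tau> \<or> g = - (adj2 \<sigma> ** \<gamma> ** \<tau>)"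
    using g by (auto simp: scaled_matrices_iff[OF \<sigma>])
  moreover from this have "adj2 \<gamma> \<in> \<Gamma>" using \<Gamma> matrix_inv_SL2R unfolding SL2R_subgroup_def by (metis subsetD)
  ultimately show ?thesis
    by (auto simp: scaled_matrices_iff[OF \<tau>] adj2_mult adj2_adj2 adj2_uminus matrix_mul_assoc intro!: bexI[of _ "adj2 \<gamma>"])
qed

lemma scaled_matrices_SL2R:
  assumes \<Gamma>: "SL2R_subgroup \<Gamma>" and \<sigma>: "\<sigma> \<in> SL2R" and \<tau>: "\<tau> \<in> SL2R"
    and g: "g \<in> scaled_matrices \<Gamma> \<sigma> \<tau>"
  shows "g \<in> SL2R"
  using assms unfolding scaled_matrices_iff[OF \<sigma>] SL2R_subgroup_def
  by (auto intro!: SL2R_uminus SL2R_mult SL2R_adj2)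

lemma scaled_matrices_uminus: "\<sigma> \<in> SL2R \<Longrightarrow> g \<in> scaled_matrices \<Gamma> \<sigma> \<tau> \<Longrightarrow> - g \<in> scaled_matrices \<Gamma> \<sigma> \<tau>"
  by (auto simp: scaled_matrices_iff)

lemma scaling_matrix_SL2R: "scaling_matrix \<Gamma> p \<sigma> \<Longrightarrow> \<sigma> \<in> SL2R"
  by (simp add: scaling_matrix_def)

lemma translation_in_scaled:
  assumes \<sigma>: "scaling_matrix \<Gamma> p \<sigma>"
  shows "translation k \<in> scaled_matrices \<Gamma> \<sigma> \<sigma>"
proof -
  have "translation k \<in> pm ((\<lambda>g. matrix_inv \<sigma> ** g ** \<sigma>) ` boundary_stabilizer \<Gamma> p)"
    using \<sigma> by (simp add: scaling_matrix_def pm_def)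
  then show ?thesis by (auto simp: pm_def scaled_matrices_def boundary_stabilizer_def)
qed

text \<open>An upper triangular element of the scaled group comes from the stabilizer of the cusp, and
  the scaling matrix carries that stabilizer to the integer translations.\<close>
lemma scaled_upper_triangular:
  assumes \<Gamma>: "SL2R_subgroup \<Gamma>" and \<sigma>: "scaling_matrix \<Gamma> p \<sigma>"
    and g: "g \<in> scaled_matrices \<Gamma> \<sigma> \<sigma>" "g$2$1 = 0"
  obtains k where "g = translation k \<or> g = - translation k"
proof -
  note \<sigma>S = scaling_matrix_SL2R[OF \<sigma>]
  obtain \<gamma> where \<gamma>: "\<gamma> \<in> \<Gamma>" "g = adj2 \<sigma> ** \<gamma> ** \<sigma> \<or> g = - (adj2 \<sigma> ** \<gamma> ** \<sigma>)"
    using g(1) by (auto simp: scaled_matrices_iff[OF \<sigma>S])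
  have "\<gamma> \<in> SL2R" using \<gamma>(1) \<Gamma> by (auto simp: SL2R_subgroup_def)
  moreover have "(adj2 \<sigma> ** \<gamma> ** \<sigma>)$2$1 = 0" using \<gamma>(2) g(2) by auto
  ultimately have "boundary_act \<gamma> p = p"
    using boundary_act_scaling_iff[OF _ \<sigma>S \<sigma>S] \<sigma> by (metis scaling_matrix_def)
  then have "adj2 \<sigma> ** \<gamma> ** \<sigma> \<in> (\<lambda>g. matrix_inv \<sigma> ** g ** \<sigma>) ` boundary_stabilizer \<Gamma> p"
    using \<gamma>(1) by (auto simp: boundary_stabilizer_def matrix_inv_SL2R[OF \<sigma>S])
  then have "adj2 \<sigma> ** \<gamma> ** \<sigma> \<in> pm (range translation)"
    using \<sigma> unfolding scaling_matrix_def pm_def by blast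
  then obtain k where "adj2 \<sigma> ** \<gamma> ** \<sigma> = translation k \<or> adj2 \<sigma> ** \<gamma> ** \<sigma> = - translation k"
    by (auto simp: pm_def)
  then show ?thesis using \<gamma>(2) that[of k] by auto
qed

text \<open>If \<open>g\<close> has a small lower-left entry \<open>c\<close>, a left translation makes its upper-left entry \<open>a\<close>
  lie between \<open>1\<close> and \<open>1 + |c|\<close> without changing \<open>c\<close>. Conjugating the unit translation
  \<open>T\<close> by the resulting matrix gives an element of the group whose difference from \<open>T\<close> has entries
  \<open>-ac\<close>, \<open>a\<^sup>2 - 1\<close>, \<open>-c\<^sup>2\<close> and \<open>ac\<close>, all of size \<open>O(|c|)\<close>. By discreteness
  it equals \<open>T\<close> as soon as \<open>c\<close> is small enough, and then \<open>c\<^sup>2 = 0\<close>.\<close>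
lemma scaled_lower_left_bounded_below:
  assumes \<Gamma>: "SL2R_subgroup \<Gamma>" "discrete \<Gamma>" and \<sigma>: "scaling_matrix \<Gamma> p \<sigma>"
  obtains c\<^sub>0 where "c\<^sub>0 > 0" "\<And>g. g \<in> scaled_matrices \<Gamma> \<sigma> \<sigma> \<Longrightarrow> g$2$1 \<noteq> 0 \<Longrightarrow> c\<^sub>0 \<le> \<bar>g$2$1\<bar>"
proof -
  note \<sigma>S = scaling_matrix_SL2R[OF \<sigma>]
  obtain \<eta> where \<eta>: "\<eta> \<in> \<Gamma>" "translation 1 = adj2 \<sigma> ** \<eta> ** \<sigma> \<or> translation 1 = - (adj2 \<sigma> ** \<eta> ** \<sigma>)"
    using translation_in_scaled[OF \<sigma>, of 1] by (auto simp: scaled_matrices_iff[OF \<sigma>S])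
  \<comment> \<open>Only one of the two signs of the unit translation is known to come from \<open>\<Gamma>\<close> itself.\<close>
  define \<tau> where "\<tau> = adj2 \<sigma> ** \<eta> ** \<sigma>"
  have \<tau>: "\<tau> = translation 1 \<or> \<tau> = - translation 1" using \<eta>(2) by (auto simp: \<tau>_def)
  have \<eta>_eq: "\<eta> = \<sigma> ** \<tau> ** adj2 \<sigma>"
  proof -
    have "\<sigma> ** \<tau> ** adj2 \<sigma> = (\<sigma> ** adj2 \<sigma>) ** \<eta> ** (\<sigma> ** adj2 \<sigma>)" by (simp add: \<tau>_def matrix_mul_assoc)
    then show ?thesis by (simp add: adj2_inverse[OF \<sigma>S])
  qed
  obtain e where e: "e > 0" "\<And>\<gamma>. \<gamma> \<in> \<Gamma> \<Longrightarrow> dist \<eta> \<gamma> < e \<Longrightarrow> \<gamma> = \<eta>"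
    using \<Gamma>(2) \<eta>(1) unfolding discrete_def isolated_in_dist_Ex_iff by blast
  have lin: "linear (\<lambda>M. \<sigma> ** M ** adj2 \<sigma>)"
    by (rule linearI) (simp_all add: mat2_simps algebra_simps)
  obtain B where B: "B > 0" "\<And>M. norm (\<sigma> ** M ** adj2 \<sigma>) \<le> B * norm M"
    using linear_bounded_pos[OF lin] by blast
  \<comment> \<open>The entries of the difference add up to at most \<open>8 |c|\<close>, and conjugation by \<open>\<sigma>\<close> costs a factor \<open>B\<close>.\<close>
  define c\<^sub>0 where "c\<^sub>0 = min 1 (e / (8 * B))"
  have "c\<^sub>0 > 0" using e B by (simp add: c\<^sub>0_def)
  moreover have "c\<^sub>0 \<le> \<bar>g$2$1\<bar>" if g: "g \<in> scaled_matrices \<Gamma> \<sigma> \<sigma>" and g0: "g$2$1 \<noteq> 0" for g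
  proof (rule ccontr)
    assume "\<not> ?thesis"
    then have small: "\<bar>g$2$1\<bar> < 1" "\<bar>g$2$1\<bar> < e / (8 * B)" by (auto simp: c\<^sub>0_def)
    define c where "c = g$2$1"
    \<comment> \<open>Left translation moves the upper left entry into the interval from 1 to 1 + |c|.\<close>
    have "\<exists>k. 1 \<le> g$1$1 + of_int k * c \<and> g$1$1 + of_int k * c \<le> 1 + \<bar>c\<bar>"
    proof (cases "c > 0")
      case True
      define k where "k = \<lceil>(1 - g$1$1) / c\<rceil>"
      have "(1 - g$1$1) / c \<le> of_int k" "of_int k < (1 - g$1$1) / c + 1" unfolding k_def by linarith+
      then show ?thesis using True by (intro exI[of _ k]) (auto simp: field_simps)
    next
      case False
      then have c: "c < 0" using g0 by (simp add: c_def)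
      define k where "k = \<lfloor>(1 - g$1$1) / c\<rfloor>"
      have "of_int k \<le> (1 - g$1$1) / c" "(1 - g$1$1) / c < of_int k + 1" unfolding k_def by linarith+
      then show ?thesis using c by (intro exI[of _ k]) (auto simp: field_simps)
    qed
    then obtain k where k: "1 \<le> g$1$1 + of_int k * c" "g$1$1 + of_int k * c \<le> 1 + \<bar>c\<bar>" by blast
    define h where "h = translation k ** g"
    define a where "a = g$1$1 + of_int k * c"
    have ha: "h$1$1 = a" "h$2$1 = c" by (simp_all add: h_def mat2_simps a_def c_def)
    have hS: "h \<in> scaled_matrices \<Gamma> \<sigma> \<sigma>"
      unfolding h_def by (rule scaled_matrices_mult[OF \<Gamma>(1) \<sigma>S \<sigma>S translation_in_scaled[OF \<sigma>] g])
    have h1: "h$1$1 * h$2$2 - h$1$2 * h$2$1 = 1"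
      using scaled_matrices_SL2R[OF \<Gamma>(1) \<sigma>S \<sigma>S hS] by (simp add: SL2R_iff)
    obtain \<gamma> where \<gamma>: "\<gamma> \<in> \<Gamma>" "h = adj2 \<sigma> ** \<gamma> ** \<sigma> \<or> h = - (adj2 \<sigma> ** \<gamma> ** \<sigma>)"
      using hS by (auto simp: scaled_matrices_iff[OF \<sigma>S])
    have adj\<gamma>: "adj2 \<gamma> \<in> \<Gamma>" using \<gamma>(1) \<Gamma>(1) matrix_inv_SL2R unfolding SL2R_subgroup_def by (metis subsetD)
    define \<xi> where "\<xi> = \<gamma> ** \<eta> ** adj2 \<gamma>"
    have \<xi>: "\<xi> \<in> \<Gamma>" using \<gamma>(1) \<eta>(1) adj\<gamma> \<Gamma>(1) unfolding \<xi>_def SL2R_subgroup_def by blast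
    have hc: "h ** \<tau> ** adj2 h = adj2 \<sigma> ** \<xi> ** \<sigma>"
    proof -
      have "h ** \<tau> ** adj2 h = (adj2 \<sigma> ** \<gamma> ** \<sigma>) ** \<tau> ** adj2 (adj2 \<sigma> ** \<gamma> ** \<sigma>)"
        using \<gamma>(2) by (auto simp: adj2_uminus mat2_uminus_mult)
      also have "\<dots> = adj2 \<sigma> ** \<gamma> ** (\<sigma> ** adj2 \<sigma>) ** \<eta> ** (\<sigma> ** adj2 \<sigma>) ** adj2 \<gamma> ** \<sigma>"
        by (simp add: \<tau>_def adj2_mult adj2_adj2 matrix_mul_assoc)
      finally show ?thesis by (simp add: adj2_inverse[OF \<sigma>S] \<xi>_def matrix_mul_assoc)
    qed
    have \<xi>_eq: "\<xi> = \<sigma> ** (h ** \<tau> ** adj2 h) ** adj2 \<sigma>"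
    proof -
      have "\<sigma> ** (adj2 \<sigma> ** \<xi> ** \<sigma>) ** adj2 \<sigma> = (\<sigma> ** adj2 \<sigma>) ** \<xi> ** (\<sigma> ** adj2 \<sigma>)" by (simp add: matrix_mul_assoc)
      then show ?thesis by (simp add: hc adj2_inverse[OF \<sigma>S])
    qed
    define E where "E = h ** \<tau> ** adj2 h - \<tau>"
    have E: "\<bar>E$1$1\<bar> = \<bar>a * c\<bar>" "\<bar>E$1$2\<bar> = \<bar>a\<^sup>2 - 1\<bar>" "\<bar>E$2$1\<bar> = c\<^sup>2" "\<bar>E$2$2\<bar> = \<bar>a * c\<bar>"
    proof -
      have "h ** translation 1 ** adj2 h - translation 1 = vector [vector [- a * c, a\<^sup>2 - 1], vector [- c\<^sup>2, a * c]]"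
        using h1 by (auto simp: mat2_simps ha[symmetric] power2_eq_square algebra_simps)
      then have "E = vector [vector [- a * c, a\<^sup>2 - 1], vector [- c\<^sup>2, a * c]] \<or> E = - vector [vector [- a * c, a\<^sup>2 - 1], vector [- c\<^sup>2, a * c]]"
        using \<tau> unfolding E_def by (auto simp: mat2_uminus_mult) (metis minus_diff_eq minus_diff_commute)
      then show "\<bar>E$1$1\<bar> = \<bar>a * c\<bar>" "\<bar>E$1$2\<bar> = \<bar>a\<^sup>2 - 1\<bar>" "\<bar>E$2$1\<bar> = c\<^sup>2" "\<bar>E$2$2\<bar> = \<bar>a * c\<bar>" by auto
    qed
    have c1: "\<bar>c\<bar> < 1" "\<bar>c\<bar> < e / (8 * B)" "c \<noteq> 0" using small g0 by (auto simp: c_def)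
    have a1: "1 \<le> a" "a \<le> 1 + \<bar>c\<bar>" using k by (auto simp: a_def)
    have "norm E \<le> \<bar>E$1$1\<bar> + \<bar>E$1$2\<bar> + (\<bar>E$2$1\<bar> + \<bar>E$2$2\<bar>)"
    proof -
      have "norm E \<le> (\<Sum>i\<in>UNIV. norm (E$i))" unfolding norm_vec_def by (rule L2_set_le_sum) simp
      also have "\<dots> \<le> (\<Sum>i\<in>UNIV. \<Sum>j\<in>UNIV. \<bar>E$i$j\<bar>)" by (intro sum_mono norm_le_l1_cart)
      finally show ?thesis by (simp add: sum_2)
    qed
    also have "\<dots> \<le> 8 * \<bar>c\<bar>"
    proof -
      have "\<bar>a * c\<bar> \<le> 2 * \<bar>c\<bar>" using a1 c1 unfolding abs_mult by (intro mult_right_mono) auto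
      moreover have "\<bar>c\<bar> * \<bar>c\<bar> \<le> 1 * \<bar>c\<bar>" using c1 by (intro mult_right_mono) auto
      moreover have "c\<^sup>2 = \<bar>c\<bar> * \<bar>c\<bar>" by (simp add: power2_eq_square)
      moreover have "\<bar>a\<^sup>2 - 1\<bar> \<le> 3 * \<bar>c\<bar>"
      proof -
        have "a\<^sup>2 - 1 = (a + 1) * (a - 1)" by (simp add: power2_eq_square algebra_simps)
        also have "\<dots> \<le> 3 * \<bar>c\<bar>" using a1 c1 by (intro mult_mono) auto
        finally show ?thesis using a1 by simp
      qed
      ultimately show ?thesis unfolding E by linarith
    qed
    finally have "B * norm E < e" using c1 B by (simp add: field_simps) (smt (verit) mult_left_mono)
    moreover have "dist \<eta> \<xi> \<le> B * norm E"
    proof -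
      have "\<xi> - \<eta> = \<sigma> ** E ** adj2 \<sigma>"
        unfolding E_def \<xi>_eq \<eta>_eq using linear_diff[OF lin] by simp
      moreover have "dist \<eta> \<xi> = norm (\<xi> - \<eta>)" by (simp add: dist_norm norm_minus_commute)
      ultimately show ?thesis using B(2)[of E] by simp
    qed
    ultimately have "\<xi> = \<eta>" using e(2)[OF \<xi>] by simp
    then have "\<sigma> ** E ** adj2 \<sigma> = 0" unfolding E_def using linear_diff[OF lin] \<xi>_eq \<eta>_eq by simp
    then have "adj2 \<sigma> ** (\<sigma> ** E ** adj2 \<sigma>) ** \<sigma> = 0" by (simp add: mat2_simps)
    then have "(adj2 \<sigma> ** \<sigma>) ** E ** (adj2 \<sigma> ** \<sigma>) = 0" by (simp add: matrix_mul_assoc)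
    then have "E = 0" by (simp add: adj2_inverse[OF \<sigma>S])
    then show False using E(3) c1(3) by simp
  qed
  ultimately show ?thesis using that by blast
qed

section \<open>Cosets and lower rows\<close>

text \<open>The pair of scaling matrices turns \<open>\<Gamma>\<close> into the set \<open>S\<close> of matrices
  \<open>\<plusminus>\<sigma>\<^sup>-\<^sup>1 \<gamma> \<tau>\<close>, on which the integer translations act from both sides.\<close>
locale scaled_cusp_pair =
  fixes \<Gamma> :: "mat2 set" and p q :: boundary and \<sigma> \<tau> :: mat2
  assumes \<Gamma>: "SL2R_subgroup \<Gamma>" "discrete \<Gamma>"
    and \<sigma>: "scaling_matrix \<Gamma> p \<sigma>" and \<tau>: "scaling_matrix \<Gamma> q \<tau>"
begin

abbreviation "S \<equiv> scaled_matrices \<Gamma> \<sigma> \<tau>"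

abbreviation "D \<equiv> D_set \<Gamma> \<sigma> \<tau>"
abbreviation "occ \<equiv> occurring_c \<Gamma> \<sigma> \<tau>"
abbreviation "\<phi> \<equiv> phi \<Gamma> \<sigma> \<tau>"
abbreviation "\<phi>0 \<equiv> phi0 \<Gamma> \<sigma> \<tau>"
abbreviation "\<phi>1 \<equiv> phi1 \<Gamma> \<sigma> \<tau>"
abbreviation "\<phi>2 \<equiv> phi2 \<Gamma> \<sigma> \<tau>"

lemmas \<sigma>_SL2R = scaling_matrix_SL2R[OF \<sigma>] and \<tau>_SL2R = scaling_matrix_SL2R[OF \<tau>]

lemma S_det: "g \<in> S \<Longrightarrow> g$1$1 * g$2$2 - g$1$2 * g$2$1 = 1"
  using scaled_matrices_SL2R[OF \<Gamma>(1) \<sigma>_SL2R \<tau>_SL2R] by (simp add: SL2R_iff)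

lemma S_SL2R: "g \<in> S \<Longrightarrow> g \<in> SL2R"
  using scaled_matrices_SL2R[OF \<Gamma>(1) \<sigma>_SL2R \<tau>_SL2R] .

lemma S_uminus: "g \<in> S \<Longrightarrow> - g \<in> S"
  by (rule scaled_matrices_uminus[OF \<sigma>_SL2R])

lemma S_translate: "g \<in> S \<Longrightarrow> translation k ** g ** translation l \<in> S"
  using scaled_matrices_mult[OF \<Gamma>(1) \<sigma>_SL2R \<tau>_SL2R
      scaled_matrices_mult[OF \<Gamma>(1) \<sigma>_SL2R \<sigma>_SL2R translation_in_scaled[OF \<sigma>]] translation_in_scaled[OF \<tau>]] .

lemma S_quotient: "g \<in> S \<Longrightarrow> h \<in> S \<Longrightarrow> h ** adj2 g \<in> scaled_matrices \<Gamma> \<sigma> \<sigma>"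
  by (intro scaled_matrices_mult[OF \<Gamma>(1) \<sigma>_SL2R \<tau>_SL2R] scaled_matrices_adj2[OF \<Gamma>(1) \<sigma>_SL2R \<tau>_SL2R])

lemma quotient_lower_left: "(h ** adj2 g)$2$1 = h$2$1 * g$2$2 - h$2$2 * g$2$1" for g h :: mat2
  by (simp add: mat2_mult_nth adj2_nth)

text \<open>The hypothesis says that the lower-left entry of \<open>h g\<^sup>-\<^sup>1\<close> vanishes, so this quotient is a
  translation up to sign.\<close>
lemma S_translate_row:
  assumes "g \<in> S" "h \<in> S" "h$2$1 * g$2$2 = h$2$2 * g$2$1"
  obtains k where "h = translation k ** g \<or> h = - (translation k ** g)"
proof -
  obtain k where "h ** adj2 g = translation k \<or> h ** adj2 g = - translation k"
    using scaled_upper_triangular[OF \<Gamma>(1) \<sigma> S_quotient[OF assms(1,2)]] assms(3)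
    by (auto simp: quotient_lower_left)
  moreover have "h ** adj2 g ** g = h"
    using adj2_inverse(1)[OF S_SL2R[OF assms(1)]] by (simp add: matrix_mul_assoc[symmetric])
  ultimately show ?thesis using that by (metis mat2_uminus_mult(1))
qed

lemma translate_row:
  "(translation k ** g ** translation l)$2$1 = g$2$1"
  "(translation k ** g ** translation l)$2$2 = g$2$2 + of_int l * g$2$1"
  "(translation k ** g)$2$1 = g$2$1" "(translation k ** g)$2$2 = g$2$2"
  by (simp_all add: mat2_mult_nth translation_nth)

text \<open>The determinant of two lower rows is the lower-left entry of the quotient of the two
  matrices, to which the lower bound for a single group applies.\<close>
lemma row_separation:
  obtains c\<^sub>0 where "c\<^sub>0 > 0"
    "\<And>g h. g \<in> S \<Longrightarrow> h \<in> S \<Longrightarrow> h$2$1 * g$2$2 \<noteq> h$2$2 * g$2$1 \<Longrightarrow> c\<^sub>0 \<le> \<bar>h$2$1 * g$2$2 - h$2$2 * g$2$1\<bar>"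
proof -
  obtain c\<^sub>0 where c0: "c\<^sub>0 > 0" "\<And>g. g \<in> scaled_matrices \<Gamma> \<sigma> \<sigma> \<Longrightarrow> g$2$1 \<noteq> 0 \<Longrightarrow> c\<^sub>0 \<le> \<bar>g$2$1\<bar>"
    using scaled_lower_left_bounded_below[OF \<Gamma> \<sigma>] by blast
  show ?thesis
    by (rule that[OF c0(1)]) (use c0(2)[OF S_quotient] quotient_lower_left in auto)
qed

text \<open>Conjugation by an upper triangular \<open>g\<close> maps the unit translation to the translation by
  the square of its upper-left entry.\<close>
lemma upper_triangular_square_Ints:
  assumes "g \<in> S" "g$2$1 = 0"
  shows "(g$1$1)\<^sup>2 \<in> \<int>"
proof -
  let ?h = "g ** translation 1 ** adj2 g"
  have "?h \<in> scaled_matrices \<Gamma> \<sigma> \<sigma>"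
    by (intro scaled_matrices_mult[OF \<Gamma>(1) \<sigma>_SL2R \<tau>_SL2R] assms translation_in_scaled[OF \<tau>]
        scaled_matrices_adj2[OF \<Gamma>(1) \<sigma>_SL2R \<tau>_SL2R])
  moreover have "?h$2$1 = 0" using assms(2) by (simp add: mat2_mult_nth adj2_nth translation_nth)
  ultimately obtain k where "?h = translation k \<or> ?h = - translation k"
    using scaled_upper_triangular[OF \<Gamma>(1) \<sigma>] by blast
  then have "?h$1$2 = of_int k \<or> ?h$1$2 = of_int (- k)" by (auto simp: translation_nth)
  moreover have h12: "?h$1$2 = (g$1$1)\<^sup>2"
    by (simp add: mat2_mult_nth adj2_nth translation_nth power2_eq_square algebra_simps)
  ultimately show ?thesis unfolding h12 by (elim disjE) (simp_all only: Ints_of_int)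
qed

end

text \<open>The same holds for \<open>g\<^sup>-\<^sup>1\<close> with the two cusps exchanged. So the squares of both diagonal
  entries are integers, and their product is \<open>1\<close>.\<close>
lemma (in scaled_cusp_pair) upper_triangular_unit_diagonal:
  assumes g: "g \<in> S" "g$2$1 = 0"
  shows "\<bar>g$2$2\<bar> = 1"
proof -
  interpret rev: scaled_cusp_pair \<Gamma> q p \<tau> \<sigma> by unfold_locales (rule \<Gamma> \<sigma> \<tau>)+
  have "(g$1$1)\<^sup>2 \<in> \<int>" by (rule upper_triangular_square_Ints[OF g])
  moreover have "(g$2$2)\<^sup>2 \<in> \<int>"
    using rev.upper_triangular_square_Ints[OF scaled_matrices_adj2[OF \<Gamma>(1) \<sigma>_SL2R \<tau>_SL2R g(1)]] g(2)
    by (simp add: adj2_nth)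
  ultimately obtain m n where mn: "(g$1$1)\<^sup>2 = of_int m" "(g$2$2)\<^sup>2 = of_int n" by (elim Ints_cases)
  have "g$1$1 * g$2$2 = 1" using S_det[OF g(1)] g(2) by simp
  then have "(g$1$1)\<^sup>2 * (g$2$2)\<^sup>2 = 1" by (metis power_mult_distrib power_one)
  then have "m * n = 1" unfolding mn by (metis of_int_1 of_int_eq_iff of_int_mult)
  moreover have "n \<ge> 0" using mn(2) by (metis of_int_0_le_iff zero_le_power2)
  ultimately have "n = 1" by (metis zmult_eq_1_iff abs_of_nonneg abs_minus_cancel abs_one)
  then show ?thesis using mn(2) by (simp add: abs_square_eq_1)
qed

context scaled_cusp_pair
begin

abbreviation scaled :: "mat2 \<Rightarrow> mat2" where
  "scaled \<gamma> \<equiv> adj2 \<sigma> ** \<gamma> ** \<tau>"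

definition lower_rows :: "(real \<times> real) set" where
  "lower_rows = {(c, d). \<exists>g\<in>S. g$2$1 = c \<and> g$2$2 = d}"

text \<open>The condition allows both signs because cosets are taken modulo \<open>\<plusminus>I\<close>.\<close>
definition coset_of_row :: "real \<times> real \<Rightarrow> mat2 set" where
  "coset_of_row r = {\<gamma>\<in>\<Gamma>. let g = scaled \<gamma> in
     g$2$1 = fst r \<and> g$2$2 = snd r \<or> g$2$1 = - fst r \<and> g$2$2 = - snd r}"

lemma conj_in_S: "\<gamma> \<in> \<Gamma> \<Longrightarrow> scaled \<gamma> \<in> S"
  by (auto simp: scaled_matrices_iff[OF \<sigma>_SL2R])

lemma conj_mult: "adj2 \<sigma> ** (h ** \<gamma>) ** \<tau> = (adj2 \<sigma> ** h ** \<sigma>) ** (scaled \<gamma>)"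
proof -
  have "(adj2 \<sigma> ** h ** \<sigma>) ** (scaled \<gamma>) = adj2 \<sigma> ** h ** (\<sigma> ** adj2 \<sigma>) ** \<gamma> ** \<tau>"
    by (simp add: matrix_mul_assoc)
  then show ?thesis by (simp add: adj2_inverse[OF \<sigma>_SL2R] matrix_mul_assoc)
qed

lemma stabilizer_iff:
  assumes "h \<in> \<Gamma>"
  shows "h \<in> boundary_stabilizer \<Gamma> p \<longleftrightarrow> (adj2 \<sigma> ** h ** \<sigma>)$2$1 = 0"
proof -
  have "h \<in> SL2R" using assms \<Gamma>(1) by (auto simp: SL2R_subgroup_def)
  moreover have "boundary_act \<sigma> Infinity = p" using \<sigma> by (simp add: scaling_matrix_def)
  ultimately show ?thesis
    using boundary_act_scaling_iff[of h \<sigma> \<sigma>] \<sigma>_SL2R assms by (simp add: boundary_stabilizer_def)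
qed

text \<open>Multiplication from the left by a stabilizer element becomes, after scaling, multiplication by
  a translation, which keeps the lower row. Conversely, equal lower rows make the quotient upper
  triangular, hence an element of the stabilizer.\<close>
lemma coset_class:
  assumes \<gamma>: "\<gamma> \<in> \<Gamma>"
  defines "g \<equiv> adj2 \<sigma> ** \<gamma> ** \<tau>"
  shows "{(g, g'). g \<in> \<Gamma> \<and> g' \<in> \<Gamma> \<and> (\<exists>h \<in> boundary_stabilizer \<Gamma> p. g' = h ** g \<or> g' = - (h ** g))} `` {\<gamma>}
    = coset_of_row (g$2$1, g$2$2)" (is "?L = ?R")
proof (intro equalityI subsetI)
  fix \<gamma>' assume "\<gamma>' \<in> ?L"
  then obtain h where h: "\<gamma>' \<in> \<Gamma>" "h \<in> boundary_stabilizer \<Gamma> p" "\<gamma>' = h ** \<gamma> \<or> \<gamma>' = - (h ** \<gamma>)" by auto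
  have h\<Gamma>: "h \<in> \<Gamma>" using h(2) by (simp add: boundary_stabilizer_def)
  have "adj2 \<sigma> ** h ** \<sigma> \<in> scaled_matrices \<Gamma> \<sigma> \<sigma>" using h\<Gamma> by (auto simp: scaled_matrices_iff[OF \<sigma>_SL2R])
  then obtain k where k: "adj2 \<sigma> ** h ** \<sigma> = translation k \<or> adj2 \<sigma> ** h ** \<sigma> = - translation k"
    using scaled_upper_triangular[OF \<Gamma>(1) \<sigma>] stabilizer_iff[OF h\<Gamma>] h(2) by metis
  have "scaled \<gamma>' = translation k ** g \<or> scaled \<gamma>' = - (translation k ** g)"
    using h(3) k conj_mult[of h \<gamma>] unfolding g_def by (auto simp: mat2_uminus_mult)
  then show "\<gamma>' \<in> ?R" using h(1) by (auto simp: coset_of_row_def Let_def translate_row)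
next
  fix \<gamma>' assume \<gamma>': "\<gamma>' \<in> ?R"
  define g' where "g' = adj2 \<sigma> ** \<gamma>' ** \<tau>"
  have \<gamma>'\<Gamma>: "\<gamma>' \<in> \<Gamma>" using \<gamma>' by (simp add: coset_of_row_def)
  have SL: "\<gamma> \<in> SL2R" using \<gamma> \<Gamma>(1) by (auto simp: SL2R_subgroup_def)
  define h where "h = \<gamma>' ** adj2 \<gamma>"
  have "adj2 \<gamma> \<in> \<Gamma>" using \<gamma> \<Gamma>(1) matrix_inv_SL2R[OF SL] unfolding SL2R_subgroup_def by metis
  then have h\<Gamma>: "h \<in> \<Gamma>" using \<gamma>'\<Gamma> \<Gamma>(1) unfolding h_def SL2R_subgroup_def by blast
  have h\<gamma>: "\<gamma>' = h ** \<gamma>" using adj2_inverse[OF SL] by (simp add: h_def matrix_mul_assoc[symmetric])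
  have "g' = (adj2 \<sigma> ** h ** \<sigma>) ** g" unfolding g'_def g_def h\<gamma> by (rule conj_mult)
  then have "g' ** adj2 g = (adj2 \<sigma> ** h ** \<sigma>) ** (g ** adj2 g)" by (simp add: matrix_mul_assoc)
  then have "g' ** adj2 g = adj2 \<sigma> ** h ** \<sigma>"
    using adj2_inverse(2)[OF S_SL2R[OF conj_in_S[OF \<gamma>]]] by (simp add: g_def)
  moreover have "(g' ** adj2 g)$2$1 = 0"
    using \<gamma>' unfolding quotient_lower_left by (auto simp: coset_of_row_def Let_def g'_def[symmetric])
  ultimately have "h \<in> boundary_stabilizer \<Gamma> p" using stabilizer_iff[OF h\<Gamma>] by simp
  then show "\<gamma>' \<in> ?L" using \<gamma> \<gamma>'\<Gamma> h\<gamma> by auto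
qed

lemma cusp_cosets_eq:
  "cusp_cosets \<Gamma> p = (\<lambda>\<gamma>. coset_of_row ((scaled \<gamma>)$2$1, (scaled \<gamma>)$2$2)) ` \<Gamma>"
  unfolding cusp_cosets_def quotient_def UNION_singleton_eq_range by (intro image_cong refl coset_class)

text \<open>One representative of each pair of opposite rows.\<close>
definition normal_rows :: "(real \<times> real) set" where
  "normal_rows = {(c, d) \<in> lower_rows. c > 0 \<or> c = 0 \<and> d > 0}"

lemma row_nonzero: "(c, d) \<in> lower_rows \<Longrightarrow> c \<noteq> 0 \<or> d \<noteq> 0"
  using S_det by (fastforce simp: lower_rows_def)

lemma rows_uminus: "(c, d) \<in> lower_rows \<Longrightarrow> (- c, - d) \<in> lower_rows"
proof -
  assume "(c, d) \<in> lower_rows"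
  then obtain g where "g \<in> S" "g$2$1 = c" "g$2$2 = d" by (auto simp: lower_rows_def)
  then have "- g \<in> S" "(- g)$2$1 = - c" "(- g)$2$2 = - d" using S_uminus by auto
  then show ?thesis unfolding lower_rows_def by blast
qed

lemma coset_of_row_uminus: "coset_of_row (- c, - d) = coset_of_row (c, d)"
  by (auto simp: coset_of_row_def Let_def)

lemma coset_of_row_nonempty:
  assumes "(c, d) \<in> lower_rows"
  obtains \<gamma> where "\<gamma> \<in> coset_of_row (c, d)"
proof -
  obtain g where g: "g \<in> S" "g$2$1 = c" "g$2$2 = d" using assms by (auto simp: lower_rows_def)
  then obtain \<gamma> where "\<gamma> \<in> \<Gamma>" "g = scaled \<gamma> \<or> g = - (scaled \<gamma>)"
    by (auto simp: scaled_matrices_iff[OF \<sigma>_SL2R])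
  then have "\<gamma> \<in> coset_of_row (c, d)" using g(2,3) by (auto simp: coset_of_row_def Let_def)
  then show ?thesis by (rule that)
qed

lemma cusp_cosets_bij: "bij_betw coset_of_row normal_rows (cusp_cosets \<Gamma> p)"
proof (rule bij_betwI')
  fix r r' assume r: "r \<in> normal_rows" and r': "r' \<in> normal_rows"
  show "coset_of_row r = coset_of_row r' \<longleftrightarrow> r = r'"
  proof
    assume eq: "coset_of_row r = coset_of_row r'"
    obtain \<gamma> where "\<gamma> \<in> coset_of_row r"
      using r coset_of_row_nonempty[of "fst r" "snd r"] by (auto simp: normal_rows_def)
    then have "\<gamma> \<in> coset_of_row r" "\<gamma> \<in> coset_of_row r'" using eq by auto
    then have "fst r = fst r' \<and> snd r = snd r' \<or> fst r = - fst r' \<and> snd r = - snd r'"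
      by (simp add: coset_of_row_def Let_def) argo
    then show "r = r'" using r r' by (cases r; cases r') (auto simp: normal_rows_def)
  qed simp
next
  fix r assume r: "r \<in> normal_rows"
  then obtain \<gamma> where \<gamma>: "\<gamma> \<in> coset_of_row r"
    using coset_of_row_nonempty[of "fst r" "snd r"] by (auto simp: normal_rows_def)
  define g where "g = adj2 \<sigma> ** \<gamma> ** \<tau>"
  have \<gamma>\<Gamma>: "\<gamma> \<in> \<Gamma>" using \<gamma> by (simp add: coset_of_row_def)
  have "coset_of_row r = coset_of_row (g$2$1, g$2$2)"
  proof -
    have "r = (g$2$1, g$2$2) \<or> r = (- g$2$1, - g$2$2)"
      using \<gamma> by (cases r) (auto simp: coset_of_row_def Let_def g_def[symmetric])
    then show ?thesis using coset_of_row_uminus by metis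
  qed
  then show "coset_of_row r \<in> cusp_cosets \<Gamma> p"
    using \<gamma>\<Gamma> unfolding cusp_cosets_eq g_def by (rule image_eqI)
next
  fix C assume "C \<in> cusp_cosets \<Gamma> p"
  then obtain \<gamma> where \<gamma>: "\<gamma> \<in> \<Gamma>" and C: "C = coset_of_row ((scaled \<gamma>)$2$1, (scaled \<gamma>)$2$2)"
    unfolding cusp_cosets_eq by (elim imageE)
  define g where "g = adj2 \<sigma> ** \<gamma> ** \<tau>"
  have row: "(g$2$1, g$2$2) \<in> lower_rows" using conj_in_S[OF \<gamma>] by (auto simp: lower_rows_def g_def)
  show "\<exists>r\<in>normal_rows. C = coset_of_row r"
  proof (cases "(g$2$1, g$2$2) \<in> normal_rows")
    case False
    then have "(- g$2$1, - g$2$2) \<in> normal_rows"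
      using row rows_uminus[OF row] row_nonzero[OF row] by (auto simp: normal_rows_def)
    then show ?thesis using C coset_of_row_uminus[of "g$2$1" "g$2$2"] unfolding g_def by metis
  qed (use C g_def in auto)
qed

text \<open>A row with \<open>c = 0\<close> belongs to an element of \<open>\<Gamma>\<close> that maps the second cusp to the first,
  and its other entry is \<open>\<plusminus>1\<close>.\<close>
lemma normal_rows_0:
  "normal_rows \<inter> {(c, d). c = 0} = (if \<exists>g\<in>\<Gamma>. boundary_act g q = p then {(0, 1)} else {})"
proof -
  have *: "(\<exists>g\<in>\<Gamma>. boundary_act g q = p) \<longleftrightarrow> (\<exists>g\<in>S. g$2$1 = 0)"
  proof -
    have "boundary_act \<gamma> q = p \<longleftrightarrow> (scaled \<gamma>)$2$1 = 0" if "\<gamma> \<in> \<Gamma>" for \<gamma>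
      using boundary_act_scaling_iff[of \<gamma> \<sigma> \<tau>] that \<Gamma>(1) \<sigma> \<tau> \<sigma>_SL2R \<tau>_SL2R
      unfolding scaling_matrix_def SL2R_subgroup_def by (metis subsetD)
    moreover have "(\<exists>\<gamma>\<in>\<Gamma>. (scaled \<gamma>)$2$1 = 0) \<longleftrightarrow> (\<exists>g\<in>S. g$2$1 = 0)"
    proof
      assume "\<exists>g\<in>S. g$2$1 = 0"
      then obtain g where g: "g \<in> S" "g$2$1 = 0" by blast
      obtain \<gamma> where "\<gamma> \<in> \<Gamma>" "g = scaled \<gamma> \<or> g = - (scaled \<gamma>)"
        using g(1) by (auto simp: scaled_matrices_iff[OF \<sigma>_SL2R])
      moreover from this(2) have "(scaled \<gamma>)$2$1 = 0" using g(2) by auto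
      ultimately show "\<exists>\<gamma>\<in>\<Gamma>. (scaled \<gamma>)$2$1 = 0" by blast
    qed (use conj_in_S in blast)
    ultimately show ?thesis by blast
  qed
  have "d = 1" if "(0, d) \<in> normal_rows" for d
    using that upper_triangular_unit_diagonal by (fastforce simp: normal_rows_def lower_rows_def)
  moreover have "(0, 1) \<in> normal_rows" if "g \<in> S" "g$2$1 = 0" for g
  proof -
    have "g$2$2 = 1 \<or> (- g)$2$2 = 1" using upper_triangular_unit_diagonal[OF that] by auto
    moreover have "- g \<in> S" "(- g)$2$1 = 0" using that S_uminus by auto
    ultimately have "\<exists>g\<in>S. g$2$1 = 0 \<and> g$2$2 = 1" using that by blast
    then show ?thesis by (auto simp: normal_rows_def lower_rows_def)
  qed
  ultimately show ?thesis unfolding * by (auto simp: normal_rows_def lower_rows_def)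
qed

section \<open>Double cosets\<close>

text \<open>The relation that the two-sided action of the translations, modulo sign, induces on lower rows:
  the lower-right entry is determined modulo the lower-left one.\<close>
definition row_equiv :: "mat2 \<Rightarrow> mat2 \<Rightarrow> bool" where
  "row_equiv g h \<longleftrightarrow> (\<exists>l::int. h$2$1 = g$2$1 \<and> h$2$2 = g$2$2 + of_int l * g$2$1 \<or>
     h$2$1 = - g$2$1 \<and> h$2$2 = - (g$2$2 + of_int l * g$2$1))"

lemma row_equiv_refl: "row_equiv g g"
  unfolding row_equiv_def by (rule exI[of _ 0]) simp

lemma row_equiv_sym: "row_equiv g h \<Longrightarrow> row_equiv h g"
proof -
  assume "row_equiv g h"
  then obtain l where "h$2$1 = g$2$1 \<and> h$2$2 = g$2$2 + of_int l * g$2$1 \<or>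
     h$2$1 = - g$2$1 \<and> h$2$2 = - (g$2$2 + of_int l * g$2$1)" by (auto simp: row_equiv_def)
  then show ?thesis unfolding row_equiv_def by (intro exI[of _ "- l"]) auto
qed

lemma row_equiv_trans: "row_equiv g h \<Longrightarrow> row_equiv h k \<Longrightarrow> row_equiv g k"
proof -
  assume "row_equiv g h" "row_equiv h k"
  then obtain l m where "h$2$1 = g$2$1 \<and> h$2$2 = g$2$2 + of_int l * g$2$1 \<or>
     h$2$1 = - g$2$1 \<and> h$2$2 = - (g$2$2 + of_int l * g$2$1)"
     "k$2$1 = h$2$1 \<and> k$2$2 = h$2$2 + of_int m * h$2$1 \<or>
     k$2$1 = - h$2$1 \<and> k$2$2 = - (h$2$2 + of_int m * h$2$1)" by (auto simp: row_equiv_def)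
  then show ?thesis unfolding row_equiv_def by (intro exI[of _ "l + m"]) (auto simp: algebra_simps)
qed

definition dcoset :: "mat2 \<Rightarrow> mat2 set" where
  "dcoset g = {h\<in>S. row_equiv g h}"

text \<open>A translation from the right adds a multiple of \<open>c\<close> to \<open>d\<close>. After matching the lower rows in
  this way, the remaining difference is a translation from the left.\<close>
lemma double_coset_class:
  assumes g: "g \<in> S"
  shows "{(g, g'). g \<in> S \<and> g' \<in> S \<and> (\<exists>k l. g' = translation k ** g ** translation l \<or>
              g' = - (translation k ** g ** translation l))} `` {g} = dcoset g" (is "?L = _")
proof (intro equalityI subsetI)
  fix h assume "h \<in> ?L"
  then obtain k l where h: "h \<in> S" "h = translation k ** g ** translation l \<or> h = - (translation k ** g ** translation l)"
    by auto
  then have "row_equiv g h" unfolding row_equiv_def by (intro exI[of _ l]) (auto simp: translate_row)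
  with h(1) show "h \<in> dcoset g" by (simp add: dcoset_def)
next
  fix h assume "h \<in> dcoset g"
  then obtain l where h: "h \<in> S" "h$2$1 = g$2$1 \<and> h$2$2 = g$2$2 + of_int l * g$2$1 \<or>
     h$2$1 = - g$2$1 \<and> h$2$2 = - (g$2$2 + of_int l * g$2$1)" by (auto simp: dcoset_def row_equiv_def)
  have "translation 0 ** g ** translation l \<in> S" by (rule S_translate[OF g])
  moreover have "translation 0 = mat 1" by (simp add: mat2_simps)
  ultimately have gl: "g ** translation l \<in> S" by simp
  have row: "(g ** translation l)$2$1 = g$2$1" "(g ** translation l)$2$2 = g$2$2 + of_int l * g$2$1"
    by (simp_all add: mat2_mult_nth translation_nth)
  have "h$2$1 * (g ** translation l)$2$2 = h$2$2 * (g ** translation l)$2$1" using h(2) unfolding row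
    by (elim disjE conjE) (simp_all only:, simp_all add: algebra_simps)
  then obtain k where "h = translation k ** (g ** translation l) \<or> h = - (translation k ** (g ** translation l))"
    by (rule S_translate_row[OF gl h(1)])
  then show "h \<in> ?L" using g h(1) by (auto simp: matrix_mul_assoc)
qed

lemma double_cosets_eq: "double_cosets \<Gamma> \<sigma> \<tau> = dcoset ` S"
  unfolding double_cosets_def quotient_def UNION_singleton_eq_range by (intro image_cong refl double_coset_class)

lemma dcoset_eq: "row_equiv g h \<Longrightarrow> dcoset g = dcoset h"
  unfolding dcoset_def by (blast intro: row_equiv_trans row_equiv_sym)

lemma D_set_iff: "C \<in> D c \<longleftrightarrow> (\<exists>g\<in>S. g$2$1 = c \<and> C = dcoset g)"
proof
  assume "C \<in> D c"
  then obtain g where g: "C \<in> double_cosets \<Gamma> \<sigma> \<tau>" "g \<in> C" "g$2$1 = c" by (auto simp: D_set_def)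
  from g(1) obtain h where "h \<in> S" "C = dcoset h"
    unfolding double_cosets_eq by (elim imageE)
  moreover from this g(2) have "g \<in> S" "row_equiv h g" by (auto simp: dcoset_def)
  ultimately show "\<exists>g\<in>S. g$2$1 = c \<and> C = dcoset g" using g(3) dcoset_eq by metis
next
  assume "\<exists>g\<in>S. g$2$1 = c \<and> C = dcoset g"
  then obtain g where g: "g \<in> S" "g$2$1 = c" "C = dcoset g" by blast
  have "C \<in> double_cosets \<Gamma> \<sigma> \<tau>"
    unfolding double_cosets_eq using g(3,1) by (rule image_eqI)
  moreover have "g \<in> C" using g row_equiv_refl by (simp add: dcoset_def)
  ultimately show "C \<in> D c" using g(2) by (auto simp: D_set_def)
qed

lemma lower_right_representative:
  assumes "C \<in> D c"
  obtains g where "g \<in> S" "g$2$1 = c" "g$2$2 = lower_right c C" "C = dcoset g"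
proof -
  define g where "g = (SOME g. g \<in> C \<and> g$2$1 = c)"
  obtain h where h: "h \<in> S" "h$2$1 = c" "C = dcoset h" using assms by (auto simp: D_set_iff)
  then have "h \<in> C \<and> h$2$1 = c" using row_equiv_refl by (simp add: dcoset_def)
  then have g: "g \<in> C \<and> g$2$1 = c" unfolding g_def by (rule someI)
  have "g \<in> dcoset h" using g h(3) by simp
  then have gS: "g \<in> S" "row_equiv h g" by (simp_all add: dcoset_def)
  moreover have "g$2$2 = lower_right c C" unfolding lower_right_def g_def ..
  moreover have "C = dcoset g" unfolding h(3) by (rule dcoset_eq) fact
  ultimately show ?thesis using that[of g] g by simp
qed

definition index :: "(real \<times> mat2 set) set" where
  "index = Sigma occ D"

lemma index_iff: "(c, C) \<in> index \<longleftrightarrow> c > 0 \<and> C \<in> D c"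
  by (auto simp: index_def occurring_c_def)

text \<open>The class \<open>C\<close> fixes \<open>d\<close> modulo \<open>c\<close>, and the integer \<open>m\<close> runs through that residue
  class.\<close>
lemma lower_rows_bij:
  "bij_betw (\<lambda>((c, C), m). (c, lower_right c C + of_int m * c)) (index \<times> (UNIV :: int set))
     {(c, d) \<in> lower_rows. c > 0}" (is "bij_betw ?f _ _")
proof (rule bij_betwI')
  fix u v :: "(real \<times> mat2 set) \<times> int" assume "u \<in> index \<times> UNIV" "v \<in> index \<times> UNIV"
  then obtain c C m c' C' m' where uv: "u = ((c, C), m)" "v = ((c', C'), m')"
    and C: "c > 0" "C \<in> D c" and C': "c' > 0" "C' \<in> D c'"
    by (auto simp: index_iff)
  obtain g where g: "g \<in> S" "g$2$1 = c" "g$2$2 = lower_right c C" "C = dcoset g"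
    using lower_right_representative[OF C(2)] .
  obtain g' where g': "g' \<in> S" "g'$2$1 = c'" "g'$2$2 = lower_right c' C'" "C' = dcoset g'"
    using lower_right_representative[OF C'(2)] .
  have "u = v" if "c = c'" "lower_right c C + of_int m * c = lower_right c' C' + of_int m' * c'"
  proof -
    have "row_equiv g g'" unfolding row_equiv_def
      using that g g' by (intro exI[of _ "m - m'"]) (auto simp: algebra_simps)
    then have "C = C'" using g g' dcoset_eq by simp
    then show ?thesis using that C uv by simp
  qed
  then show "?f u = ?f v \<longleftrightarrow> u = v"
    unfolding uv by auto
next
  fix u :: "(real \<times> mat2 set) \<times> int" assume "u \<in> index \<times> UNIV"
  then obtain c C m where u: "u = ((c, C), m)" "c > 0" "C \<in> D c" by (auto simp: index_iff)
  obtain g where g: "g \<in> S" "g$2$1 = c" "g$2$2 = lower_right c C" "C = dcoset g"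
    using lower_right_representative[OF u(3)] .
  have "translation 0 ** g ** translation m \<in> S" by (rule S_translate[OF g(1)])
  then have "\<exists>h\<in>S. h$2$1 = c \<and> h$2$2 = lower_right c C + of_int m * c"
    using translate_row(1,2)[of 0 g m] g by metis
  then show "?f u \<in> {(c, d) \<in> lower_rows. c > 0}"
    using u by (auto simp: lower_rows_def)
next
  fix r assume "r \<in> {(c, d) \<in> lower_rows. c > 0}"
  then obtain g where g: "g \<in> S" "g$2$1 > 0" "r = (g$2$1, g$2$2)" by (auto simp: lower_rows_def)
  define c where "c = g$2$1"
  have C: "dcoset g \<in> D c" using g D_set_iff by (auto simp: c_def)
  obtain h where h: "h \<in> S" "h$2$1 = c" "h$2$2 = lower_right c (dcoset g)" "dcoset g = dcoset h"
    using lower_right_representative[OF C] .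
  have "g \<in> dcoset h" using g(1) row_equiv_refl h(4) by (auto simp: dcoset_def)
  then have "row_equiv h g" by (simp add: dcoset_def)
  then obtain l where "g$2$2 = h$2$2 + of_int l * c" using g(2) h(2) by (auto simp: row_equiv_def c_def)
  then have "r = (c, lower_right c (dcoset g) + of_int l * c)" using h(3) g(3) by (simp add: c_def)
  then show "\<exists>u\<in>index \<times> UNIV. r = ?f u"
    using C g(2) by (intro bexI[of _ "((c, dcoset g), l)"]) (auto simp: index_iff c_def)
qed


section \<open>Counting double cosets\<close>

text \<open>Each class contains a matrix whose lower row is \<open>c\<close> times \<open>(1, \<xi>)\<close>, with \<open>\<xi>\<close> the fractional
  part of \<open>d/c\<close>. For two classes the determinant of these rows is \<open>cc'(\<xi> - \<xi>')\<close>, and it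
  does not vanish because the classes differ.\<close>
lemma fractional_part_separation:
  obtains c\<^sub>0 where "c\<^sub>0 > 0"
    "\<And>c C c' C'. (c, C) \<in> index \<Longrightarrow> (c', C') \<in> index \<Longrightarrow> (c, C) \<noteq> (c', C') \<Longrightarrow>
      c\<^sub>0 / (c * c') \<le> \<bar>frac (lower_right c C / c) - frac (lower_right c' C' / c')\<bar>"
proof -
  obtain c\<^sub>0 where c0: "c\<^sub>0 > 0"
    "\<And>g h. g \<in> S \<Longrightarrow> h \<in> S \<Longrightarrow> h$2$1 * g$2$2 \<noteq> h$2$2 * g$2$1 \<Longrightarrow> c\<^sub>0 \<le> \<bar>h$2$1 * g$2$2 - h$2$2 * g$2$1\<bar>"
    using row_separation by blast
  have rep: "\<exists>g\<in>S. g$2$1 = c \<and> g$2$2 = frac (lower_right c C / c) * c \<and> C = dcoset g" if C: "(c, C) \<in> index" for c C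
  proof -
    have c: "c > 0" "C \<in> D c" using C by (auto simp: index_iff)
    obtain g where g: "g \<in> S" "g$2$1 = c" "g$2$2 = lower_right c C" "C = dcoset g"
      using lower_right_representative[OF c(2)] .
    \<comment> \<open>A translation from the right that replaces \<open>d/c\<close> by its fractional part.\<close>
    define l where "l = - \<lfloor>lower_right c C / c\<rfloor>"
    define h where "h = translation 0 ** g ** translation l"
    have hS: "h \<in> S" unfolding h_def by (rule S_translate[OF g(1)])
    have h: "h$2$1 = c" "h$2$2 = lower_right c C + of_int l * c" using g(2,3) by (simp_all add: h_def translate_row)
    have "row_equiv g h" unfolding row_equiv_def using g(2,3) h by (intro exI[of _ l]) simp
    then have C_eq: "C = dcoset h" unfolding g(4) by (rule dcoset_eq)
    have "lower_right c C + of_int l * c = frac (lower_right c C / c) * c"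
      using c by (simp add: frac_def l_def field_simps)
    then show ?thesis using hS h C_eq by (intro bexI[of _ h]) simp_all
  qed
  show ?thesis
  proof (rule that[OF c0(1)])
    fix c C c' C' assume C: "(c, C) \<in> index" and C': "(c', C') \<in> index" and neq: "(c, C) \<noteq> (c', C')"
    define \<xi> \<xi>' where "\<xi> = frac (lower_right c C / c)" and "\<xi>' = frac (lower_right c' C' / c')"
    have c: "c > 0" "c' > 0" using C C' by (auto simp: index_iff)
    obtain g where g: "g \<in> S" "g$2$1 = c" "g$2$2 = \<xi> * c" "C = dcoset g" using rep[OF C] by (auto simp: \<xi>_def)
    obtain h where h: "h \<in> S" "h$2$1 = c'" "h$2$2 = \<xi>' * c'" "C' = dcoset h" using rep[OF C'] by (auto simp: \<xi>'_def)
    have "h$2$1 * g$2$2 \<noteq> h$2$2 * g$2$1"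
    proof
      assume "h$2$1 * g$2$2 = h$2$2 * g$2$1"
      then obtain k where "h = translation k ** g \<or> h = - (translation k ** g)"
        using S_translate_row[OF g(1) h(1)] by blast
      then have *: "h$2$1 = g$2$1 \<and> h$2$2 = g$2$2 \<or> h$2$1 = - g$2$1 \<and> h$2$2 = - g$2$2"
        by (auto simp: translate_row)
      then have "row_equiv g h" unfolding row_equiv_def by (intro exI[of _ 0]) auto
      then have "C = C'" using g h dcoset_eq by simp
      moreover have "c = c'" using * g h c by auto
      ultimately show False using neq by simp
    qed
    then have "c\<^sub>0 \<le> \<bar>h$2$1 * g$2$2 - h$2$2 * g$2$1\<bar>" by (rule c0(2)[OF g(1) h(1)])
    also have "h$2$1 * g$2$2 - h$2$2 * g$2$1 = (c * c') * (\<xi> - \<xi>')" using g h by (simp add: algebra_simps)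
    also have "\<bar>\<dots>\<bar> = (c * c') * \<bar>\<xi> - \<xi>'\<bar>" using c by (simp add: abs_mult)
    also have "\<dots> = \<bar>\<xi> - \<xi>'\<bar> * (c * c')" by (rule mult.commute)
    finally have "c\<^sub>0 / (c * c') \<le> \<bar>\<xi> - \<xi>'\<bar>"
      unfolding pos_divide_le_eq[OF mult_pos_pos[OF c]] .
    then show "c\<^sub>0 / (c * c') \<le> \<bar>frac (lower_right c C / c) - frac (lower_right c' C' / c')\<bar>"
      unfolding \<xi>_def \<xi>'_def .
  qed
qed

end

text \<open>Dividing by \<open>\<delta>\<close> and rounding down is injective on separated points.\<close>
lemma card_separated_points:
  fixes f :: "'a \<Rightarrow> real"
  assumes \<delta>: "\<delta> > 0" and range: "\<And>a. a \<in> A \<Longrightarrow> 0 \<le> f a \<and> f a < 1"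
    and sep: "\<And>a b. a \<in> A \<Longrightarrow> b \<in> A \<Longrightarrow> a \<noteq> b \<Longrightarrow> \<delta> \<le> \<bar>f a - f b\<bar>"
  shows "finite A" and "real (card A) \<le> 1 / \<delta> + 1"
proof -
  let ?h = "\<lambda>a. \<lfloor>f a / \<delta>\<rfloor>"
  have inj: "inj_on ?h A"
  proof (rule inj_onI, rule ccontr)
    fix a b assume ab: "a \<in> A" "b \<in> A" "?h a = ?h b" "a \<noteq> b"
    then have "\<bar>f a / \<delta> - f b / \<delta>\<bar> < 1" by linarith
    then have "\<bar>f a - f b\<bar> < \<delta>" using \<delta> by (simp add: field_simps flip: diff_divide_distrib) 
    then show False using sep[OF ab(1,2,4)] by simp
  qed
  have sub: "?h ` A \<subseteq> {0..\<lfloor>1 / \<delta>\<rfloor>}"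
  proof safe
    fix a assume "a \<in> A"
    then have "0 \<le> f a / \<delta>" "f a / \<delta> \<le> 1 / \<delta>" using range[of a] \<delta> by (auto simp: divide_right_mono)
    then show "?h a \<in> {0..\<lfloor>1 / \<delta>\<rfloor>}" by (auto intro: floor_mono)
  qed
  show "finite A" using inj sub by (meson finite_atLeastAtMost_int finite_imageD finite_subset)
  have "card A = card (?h ` A)" using inj by (simp add: card_image)
  also have "\<dots> \<le> card {0..\<lfloor>1 / \<delta>\<rfloor>}" by (intro card_mono sub) simp
  finally have "card A \<le> nat (\<lfloor>1 / \<delta>\<rfloor> + 1)" by simp
  moreover have "0 \<le> \<lfloor>1 / \<delta>\<rfloor>" using \<delta> by simp
  ultimately have "real (card A) \<le> real_of_int \<lfloor>1 / \<delta>\<rfloor> + 1" by linarith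
  then show "real (card A) \<le> 1 / \<delta> + 1" by linarith
qed

context scaled_cusp_pair
begin

lemma card_index_le:
  obtains K where "K \<ge> 0"
    "\<And>X. X > 0 \<Longrightarrow> finite {(c, C) \<in> index. c \<le> X}"
    "\<And>X. X > 0 \<Longrightarrow> real (card {(c, C) \<in> index. c \<le> X}) \<le> K * X\<^sup>2 + 1"
proof -
  obtain c\<^sub>0 where c0: "c\<^sub>0 > 0"
    "\<And>c C c' C'. (c, C) \<in> index \<Longrightarrow> (c', C') \<in> index \<Longrightarrow> (c, C) \<noteq> (c', C') \<Longrightarrow>
      c\<^sub>0 / (c * c') \<le> \<bar>frac (lower_right c C / c) - frac (lower_right c' C' / c')\<bar>"
    using fractional_part_separation by blast
  have *: "finite {(c, C) \<in> index. c \<le> X}" "real (card {(c, C) \<in> index. c \<le> X}) \<le> 1 / (c\<^sub>0 / X\<^sup>2) + 1" if X: "X > 0" for X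
  proof -
    let ?f = "\<lambda>(c, C). frac (lower_right c C / c)"
    have sep: "c\<^sub>0 / X\<^sup>2 \<le> \<bar>?f a - ?f b\<bar>" if ab: "a \<in> {(c, C) \<in> index. c \<le> X}" "b \<in> {(c, C) \<in> index. c \<le> X}" "a \<noteq> b" for a b
    proof -
      obtain c C c' C' where eq: "a = (c, C)" "b = (c', C')" by (cases a; cases b)
      have c: "0 < c" "c \<le> X" "0 < c'" "c' \<le> X" "(c, C) \<in> index" "(c', C') \<in> index" using ab eq by (auto simp: index_iff)
      have "c * c' \<le> X * X" using c by (intro mult_mono) auto
      then have "c\<^sub>0 / X\<^sup>2 \<le> c\<^sub>0 / (c * c')" using c c0(1) X by (intro divide_left_mono) (auto simp: power2_eq_square)
      then show ?thesis using c0(2)[OF c(5,6)] ab(3) eq by force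
    qed
    show "finite {(c, C) \<in> index. c \<le> X}" "real (card {(c, C) \<in> index. c \<le> X}) \<le> 1 / (c\<^sub>0 / X\<^sup>2) + 1"
      by (rule card_separated_points[of "c\<^sub>0 / X\<^sup>2" _ ?f]; use c0(1) X sep in \<open>auto simp: frac_lt_1\<close>)+
  qed
  show ?thesis
    by (rule that[of "1 / c\<^sub>0"]) (use * c0(1) in auto)
qed

lemma finite_D_set:
  assumes "c > 0"
  shows "finite (D c)"
proof -
  obtain K where "\<And>X. X > 0 \<Longrightarrow> finite {(c, C) \<in> index. c \<le> X}" using card_index_le by blast
  from this[OF assms] have "finite {(c', C) \<in> index. c' \<le> c}" .
  moreover have "Pair c ` D c \<subseteq> {(c', C) \<in> index. c' \<le> c}" using assms by (auto simp: index_iff)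
  ultimately have "finite (Pair c ` D c)" by (rule finite_subset[rotated])
  then show ?thesis by (rule finite_imageD) (auto simp: inj_on_def)
qed

text \<open>There are \<open>O(k\<^sup>2)\<close> classes with \<open>k < c \<le> k + 1\<close>, and each contributes at most
  \<open>k\<^sup>-\<^sup>w\<close> when \<open>k\<close> is positive.\<close>
lemma index_summable:
  assumes w: "w > 3"
  shows "(\<lambda>(c, C). c powr (- w)) summable_on index"
proof -
  obtain K where K: "K \<ge> 0"
    "\<And>X. X > 0 \<Longrightarrow> finite {(c, C) \<in> index. c \<le> X}"
    "\<And>X. X > 0 \<Longrightarrow> real (card {(c, C) \<in> index. c \<le> X}) \<le> K * X\<^sup>2 + 1"
    using card_index_le by blast
  \<comment> \<open>Half-open on the left, so that every positive \<open>c\<close> lies in exactly one interval.\<close>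
  define J where "J k = {(c, C) \<in> index. real k < c \<and> c \<le> real k + 1}" for k :: nat
  have sub: "J k \<subseteq> {(c, C) \<in> index. c \<le> real k + 1}" for k by (auto simp: J_def)
  have fin: "finite (J k)" for k using finite_subset[OF sub K(2)] by simp
  define g where "g k = (\<Sum>(c, C)\<in>J k. c powr (- w))" for k
  have "summable g"
  proof (rule summable_comparison_test_ev)
    have bigo: "(\<lambda>k. (K * (real k + 1)\<^sup>2 + 1) * real k powr (- w)) \<in> O(\<lambda>k. real k powr (2 - w))"
      by real_asymp
    have "summable (\<lambda>k. norm (real k powr (2 - w)))" using w by (simp add: summable_real_powr_iff)
    from summable_comparison_test_bigo[OF this bigo]
    show "summable (\<lambda>k. (K * (real k + 1)\<^sup>2 + 1) * real k powr (- w))" .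
    show "\<forall>\<^sub>F k in sequentially. norm (g k) \<le> (K * (real k + 1)\<^sup>2 + 1) * real k powr (- w)"
      using eventually_gt_at_top[of 0]
    proof eventually_elim
      case (elim k)
      have "norm (g k) = (\<Sum>(c, C)\<in>J k. c powr (- w))" unfolding g_def by (simp add: sum_nonneg case_prod_unfold)
      also have "\<dots> \<le> (\<Sum>(c, C)\<in>J k. real k powr (- w))"
        using elim w by (intro sum_mono) (auto simp: J_def intro!: powr_mono2')
      also have "\<dots> = real (card (J k)) * real k powr (- w)" by simp
      also have "\<dots> \<le> (K * (real k + 1)\<^sup>2 + 1) * real k powr (- w)"
        using order_trans[OF _ K(3)[of "real k + 1"]] card_mono[OF K(2) sub[of k]]
        by (intro mult_right_mono) auto
      finally show ?case .
    qed
  qed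
  then have g: "g summable_on UNIV"
    by (subst summable_on_UNIV_nonneg_real_iff) (auto simp: g_def intro!: sum_nonneg)
  have "(\<lambda>(k, c, C). c powr (- w)) summable_on Sigma UNIV J"
    by (rule summable_on_SigmaI[OF _ g]) (auto simp: g_def case_prod_unfold intro: has_sum_finite fin)
  also have "?this \<longleftrightarrow> ?thesis"
  proof (rule summable_on_reindex_bij_witness[of _ "\<lambda>(c, C). (nat (\<lceil>c\<rceil> - 1), c, C)" "\<lambda>(k, c, C). (c, C)"])
    fix u assume "u \<in> Sigma UNIV J"
    then obtain k c C where u: "u = (k, c, C)" "(c, C) \<in> index" "real k < c" "c \<le> real k + 1" by (auto simp: J_def)
    have "\<lceil>c\<rceil> = int k + 1" using u by (intro ceiling_unique) auto
    then show "(case case u of (k, c, C) \<Rightarrow> (c, C) of (c, C) \<Rightarrow> (nat (\<lceil>c\<rceil> - 1), c, C)) = u"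
      using u by simp
    show "(case u of (k, c, C) \<Rightarrow> (c, C)) \<in> index" using u by simp
    show "(case case u of (k, c, C) \<Rightarrow> (c, C) of (c, C) \<Rightarrow> c powr - w) = (case u of (k, c, C) \<Rightarrow> c powr - w)"
      using u by simp
  next
    fix v assume v: "v \<in> index"
    then obtain c C where v': "v = (c, C)" "c > 0" by (cases v) (auto simp: index_iff)
    have "\<lceil>c\<rceil> \<ge> 1" using v'(2) by simp
    then have "real (nat (\<lceil>c\<rceil> - 1)) = real_of_int \<lceil>c\<rceil> - 1" by simp
    then show "(case v of (c, C) \<Rightarrow> (nat (\<lceil>c\<rceil> - 1), c, C)) \<in> Sigma UNIV J"
      using v v' by (auto simp: J_def) linarith+
  qed auto
  finally show ?thesis .
qed

end

section \<open>A reflection formula\<close>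

text \<open>Away from the integers this is the reflection formula at \<open>s + 2\<close>; the right-hand side is
  entire, so the limit that defines the left-hand side at an integer is its value there.\<close>
lemma sin_Gamma_eq: "sin_Gamma s = of_real pi * rGamma (s + 2)"
proof -
  have eq: "sin (of_real pi * w) * Gamma (- w - 1) = of_real pi * rGamma (w + 2)" if w: "w \<notin> \<int>" for w :: complex
  proof -
    have sin0: "sin (of_real pi * w) \<noteq> 0" using w by (auto simp: sin_eq_0 mult.commute)
    have "w + 2 \<notin> \<int>" using w by (metis Ints_diff Ints_numeral add_diff_cancel_right')
    then have "Gamma (w + 2) \<noteq> 0" using Gamma_eq_zero_iff nonpos_Ints_Int by blast
    moreover have "sin (of_real pi * (w + 2)) = sin (of_real pi * w)"
    proof -
      have "sin (complex_of_real pi * 2) = 0" "cos (complex_of_real pi * 2) = 1"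
        using sin_of_real[of "2 * pi", where 'a = complex] cos_of_real[of "2 * pi", where 'a = complex]
        by (simp_all add: mult.commute)
      then show ?thesis by (simp add: distrib_left sin_add)
    qed
    moreover have "Gamma (w + 2) * Gamma (- w - 1) = of_real pi / sin (of_real pi * (w + 2))"
    proof -
      have "1 - (w + 2) = - w - 1" by simp
      then show ?thesis using Gamma_reflection_complex[of "w + 2"] by (simp only:)
    qed
    ultimately show ?thesis using sin0 by (simp add: rGamma_inverse_Gamma field_simps)
  qed
  show ?thesis
  proof (cases "s \<in> \<int>")
    case False
    then show ?thesis by (simp add: sin_Gamma_def eq)
  next
    case True
    have "((\<lambda>w. of_real pi * rGamma (w + 2)) \<longlongrightarrow> of_real pi * rGamma (s + 2)) (at s)"
      by (intro isContD continuous_intros)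
    moreover have "\<forall>\<^sub>F w in at s. of_real pi * rGamma (w + 2) = sin (of_real pi * w) * Gamma (- w - 1)"
      unfolding eventually_at
    proof (intro exI[of _ 1] conjI ballI impI)
      fix w assume "w \<noteq> s \<and> dist w s < 1"
      then have "w \<notin> \<int>" using True by (auto elim!: Ints_cases simp: dist_of_int)
      then show "of_real pi * rGamma (w + 2) = sin (of_real pi * w) * Gamma (- w - 1)" by (simp add: eq)
    qed simp
    ultimately have "((\<lambda>w. sin (of_real pi * w) * Gamma (- w - 1)) \<longlongrightarrow> of_real pi * rGamma (s + 2)) (at s)"
      by (rule Lim_transform_eventually)
    then have "Lim (at s) (\<lambda>w. sin (of_real pi * w) * Gamma (- w - 1)) = of_real pi * rGamma (s + 2)"
      by (intro tendsto_Lim) auto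
    then show ?thesis using True by (simp add: sin_Gamma_def)
  qed
qed

section \<open>The summands of the Eisenstein series\<close>

lemma autfac_nonzero:
  assumes "g \<in> SL2R" "Im z > 0"
  shows "autfac g z \<noteq> 0"
proof
  assume "autfac g z = 0"
  then have "g$2$1 * Im z = 0" "g$2$1 * Re z + g$2$2 = 0" by (auto simp: autfac_def complex_eq_iff)
  then show False using assms by (auto simp: SL2R_iff)
qed

lemma tangent_act_mult:
  assumes "g \<in> SL2R" "h \<in> SL2R" "Im z > 0"
  shows "tangent_act g (tangent_act h (z, v)) = tangent_act (g ** h) (z, v)"
proof -
  have h: "autfac h z \<noteq> 0" by (rule autfac_nonzero) fact+
  have "autfac (g ** h) z = (of_real (g$2$1) * (of_real (h$1$1) * z + of_real (h$1$2)) + of_real (g$2$2) * autfac h z)"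
    by (simp add: autfac_def mat2_mult_nth algebra_simps)
  then have 1: "autfac (g ** h) z = autfac g (moebius h z) * autfac h z"
    using h by (simp add: moebius_def autfac_def[of g] field_simps)
  have "of_real ((g ** h)$1$1) * z + of_real ((g ** h)$1$2) = (of_real (g$1$1) * (of_real (h$1$1) * z + of_real (h$1$2)) + of_real (g$1$2) * autfac h z)"
    by (simp add: autfac_def mat2_mult_nth algebra_simps)
  then have 2: "of_real ((g ** h)$1$1) * z + of_real ((g ** h)$1$2) = (of_real (g$1$1) * moebius h z + of_real (g$1$2)) * autfac h z"
    using h by (simp add: moebius_def[of h] field_simps)
  have "moebius (g ** h) z = moebius g (moebius h z)"
    unfolding moebius_def[of "g ** h"] 1 2 using h by (simp add: moebius_def[of g])
  then show ?thesis by (simp add: tangent_act_def 1 power_mult_distrib mult.commute)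
qed

lemma Im_moebius:
  assumes "g \<in> SL2R" "Im z > 0"
  shows "Im (moebius g z) = Im z / (norm (autfac g z))\<^sup>2"
proof -
  have "Im (moebius g z) = Im ((of_real (g$1$1) * z + of_real (g$1$2)) * cnj (autfac g z)) / (norm (autfac g z))\<^sup>2"
    unfolding moebius_def by (simp add: complex_div_cnj[of _ "autfac g z"] Im_divide_of_real flip: of_real_power)
  also have "Im ((of_real (g$1$1) * z + of_real (g$1$2)) * cnj (autfac g z)) = (g$1$1 * g$2$2 - g$1$2 * g$2$1) * Im z"
    by (simp add: autfac_def algebra_simps)
  also have "\<dots> = Im z" using assms by (simp add: SL2R_iff)
  finally show ?thesis .
qed

text \<open>The contribution of a matrix with lower row \<open>(c, d)\<close>; \<open>j\<close> is its automorphy factor.\<close>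
definition row_term :: "complex \<Rightarrow> complex \<Rightarrow> complex \<Rightarrow> real \<times> real \<Rightarrow> complex" where
  "row_term s z v = (\<lambda>(c, d). let j = of_real c * z + of_real d in
     of_real (Im z / (norm j)\<^sup>2) powr s * of_real (Re (v / j\<^sup>2)))"

lemma row_term_uminus: "row_term s z v (- c, - d) = row_term s z v (c, d)"
proof -
  have "of_real (- c) * z + of_real (- d) = - (of_real c * z + of_real d)" by simp
  then show ?thesis unfolding row_term_def prod.case Let_def by (simp only: norm_minus_cancel power2_minus)
qed

lemma alpha1_tangent_act:
  assumes "g \<in> SL2R" "Im z > 0"
  shows "alpha1 s (tangent_act g (z, v)) = row_term s z v (g$2$1, g$2$2)"
  using Im_moebius[OF assms] by (simp add: alpha1_def tangent_act_def row_term_def autfac_def Let_def)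

text \<open>The contribution of a row with \<open>c > 0\<close>, stripped of \<open>c\<^sup>-\<^sup>2\<^sup>s\<^sup>-\<^sup>2\<close>, as a function of
  \<open>t = x + d/c\<close>. It arises from
  \<open>y\<^sup>s\<^sup>+\<^sup>1 (t\<^sup>2 + y\<^sup>2)\<^sup>-\<^sup>s\<^sup>-\<^sup>2 (- (t\<^sup>2 - y\<^sup>2) sin \<theta> + 2ty cos \<theta>)\<close> by writing
  \<open>t\<^sup>2 - y\<^sup>2\<close> as \<open>(t\<^sup>2 + y\<^sup>2) - 2y\<^sup>2\<close>.\<close>
definition summand :: "complex \<Rightarrow> real \<Rightarrow> real \<Rightarrow> real \<Rightarrow> complex" where
  "summand s y \<theta> t = of_real y powr (s + 1) *
     (- of_real (sin \<theta>) * (radial y (s + 1) t - 2 * of_real (y\<^sup>2) * radial y (s + 2) t)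
      + 2 * of_real (y * cos \<theta>) * (of_real t * radial y (s + 2) t))"

text \<open>The automorphy factor is \<open>c (t + iy)\<close> with \<open>t = x + d/c\<close>; this reduces the claim to a
  computation with \<open>(t + iy)\<^sup>2\<close> and \<open>Q = t\<^sup>2 + y\<^sup>2\<close>.\<close>
lemma row_term_eq_summand:
  assumes y: "y > 0" and c: "c > 0"
  shows "row_term s (Complex x y) (unit_tangent (Complex x y) \<theta>) (c, d)
    = of_real c powr (- 2 * s - 2) * summand s y \<theta> (x + d / c)"
proof -
  define t where "t = x + d / c"
  define Q where "Q = t\<^sup>2 + y\<^sup>2"
  have Q: "Q > 0" using y by (auto simp: Q_def add_nonneg_pos)
  have j: "of_real c * Complex x y + of_real d = of_real c * Complex t y"
    using c by (simp add: complex_eq_iff t_def field_simps)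
  have norm_j: "(norm (of_real c * Complex t y))\<^sup>2 = c\<^sup>2 * Q"
    by (simp add: norm_mult power_mult_distrib cmod_power2 Q_def)
  have "Re (unit_tangent (Complex x y) \<theta> / (of_real c * Complex t y)\<^sup>2)
      = y * (- sin \<theta> * (t\<^sup>2 - y\<^sup>2) + 2 * cos \<theta> * y * t) / (c\<^sup>2 * Q\<^sup>2)"
  proof -
    have v: "unit_tangent (Complex x y) \<theta> = of_real y * Complex (- sin \<theta>) (cos \<theta>)" by (simp add: unit_tangent_def)
    have "(of_real c * Complex t y)\<^sup>2 = of_real (c\<^sup>2) * Complex (t\<^sup>2 - y\<^sup>2) (2 * t * y)"
      by (simp add: complex_eq_iff power2_eq_square algebra_simps)
    then have "unit_tangent (Complex x y) \<theta> / (of_real c * Complex t y)\<^sup>2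
       = of_real (y / c\<^sup>2) * (Complex (- sin \<theta>) (cos \<theta>) / Complex (t\<^sup>2 - y\<^sup>2) (2 * t * y))" by (simp add: v)
    also have "Re \<dots> = y / c\<^sup>2 * Re (Complex (- sin \<theta>) (cos \<theta>) / Complex (t\<^sup>2 - y\<^sup>2) (2 * t * y))"
    proof -
      have "Re (of_real r * w) = r * Re w" for r w by simp
      then show ?thesis .
    qed
    also have "Re (Complex (- sin \<theta>) (cos \<theta>) / Complex (t\<^sup>2 - y\<^sup>2) (2 * t * y))
        = (- sin \<theta> * (t\<^sup>2 - y\<^sup>2) + 2 * cos \<theta> * y * t) / ((t\<^sup>2 - y\<^sup>2)\<^sup>2 + (2 * t * y)\<^sup>2)"
      by (simp add: Re_divide algebra_simps)
    also have "(t\<^sup>2 - y\<^sup>2)\<^sup>2 + (2 * t * y)\<^sup>2 = Q\<^sup>2" by (simp add: Q_def power2_eq_square algebra_simps)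
    finally show ?thesis by simp
  qed
  then have "row_term s (Complex x y) (unit_tangent (Complex x y) \<theta>) (c, d)
    = of_real (y / (c\<^sup>2 * Q)) powr s * of_real (y * (- sin \<theta> * (t\<^sup>2 - y\<^sup>2) + 2 * cos \<theta> * y * t) / (c\<^sup>2 * Q\<^sup>2))"
    unfolding row_term_def prod.case Let_def j norm_j by simp
  also have "of_real (y / (c\<^sup>2 * Q)) powr s = of_real c powr (- 2 * s) * of_real y powr s * of_real Q powr (- s)"
  proof -
    have "ln (y / (c\<^sup>2 * Q)) = ln y - 2 * ln c - ln Q" using y c Q by (simp add: ln_div ln_mult ln_realpow)
    moreover have "y / (c\<^sup>2 * Q) > 0" using y c Q by simp
    moreover have "of_real r powr s = exp (s * of_real (ln r))" if "r > 0" for r :: real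
      using that by (simp add: powr_def Ln_of_real)
    ultimately have "of_real (y / (c\<^sup>2 * Q)) powr s = exp (s * of_real (ln y - 2 * ln c - ln Q))"
      by metis
    then show ?thesis using y c Q by (simp add: powr_def Ln_of_real algebra_simps flip: exp_add)
  qed
  also have "of_real (y * (- sin \<theta> * (t\<^sup>2 - y\<^sup>2) + 2 * cos \<theta> * y * t) / (c\<^sup>2 * Q\<^sup>2))
    = of_real y * (1 / of_real c ^ 2) * (1 / of_real Q ^ 2) * (- of_real (sin \<theta>) * (of_real Q - 2 * of_real (y\<^sup>2)) + 2 * of_real (y * cos \<theta>) * complex_of_real t)"
  proof -
    have num: "- sin \<theta> * (t\<^sup>2 - y\<^sup>2) + 2 * cos \<theta> * y * t = - sin \<theta> * (Q - 2 * y\<^sup>2) + 2 * (y * cos \<theta>) * t"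
      by (simp add: Q_def algebra_simps)
    show ?thesis unfolding num by simp
  qed
  also have "of_real c powr (- 2 * s) * of_real y powr s * of_real Q powr (- s) *
     (of_real y * (1 / of_real c ^ 2) * (1 / of_real Q ^ 2) * (- of_real (sin \<theta>) * (of_real Q - 2 * of_real (y\<^sup>2)) + 2 * of_real (y * cos \<theta>) * complex_of_real t))
    = (of_real c powr (- 2 * s) * (1 / of_real c ^ 2)) * (of_real y powr s * of_real y) *
       (- of_real (sin \<theta>) * ((of_real Q powr (- s) * (1 / of_real Q ^ 2)) * of_real Q - 2 * of_real (y\<^sup>2) * (of_real Q powr (- s) * (1 / of_real Q ^ 2)))
         + 2 * of_real (y * cos \<theta>) * (complex_of_real t * (of_real Q powr (- s) * (1 / of_real Q ^ 2))))"
    by (simp add: algebra_simps)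
  also have "of_real c powr (- 2 * s) * (1 / complex_of_real c ^ 2) = of_real c powr (- 2 * s - 2)"
    using c by (simp add: powr_diff)
  also have "of_real y powr s * of_real y = complex_of_real y powr (s + 1)" using y by (simp add: powr_add)
  also have "of_real Q powr (- s) * (1 / of_real Q ^ 2) = radial y (s + 2) t"
    using Q powr_diff[of "complex_of_real Q" "- s" 2] by (simp add: radial_def Q_def)
  also have "radial y (s + 2) t * of_real Q = radial y (s + 1) t"
  proof -
    have e: "- (s + 2) + 1 = - (s + 1)" by simp
    show ?thesis using Q powr_add[of "complex_of_real Q" "- (s + 2)" 1] unfolding e by (simp add: radial_def Q_def)
  qed
  finally show ?thesis by (simp add: summand_def t_def)
qed

lemma abs_summable_times_bounded:
  fixes f g :: "'a \<Rightarrow> complex"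
  assumes f: "(\<lambda>n. norm (f n)) summable_on A" and g: "\<And>n. n \<in> A \<Longrightarrow> norm (g n) \<le> B"
  shows "(\<lambda>n. norm (f n * g n)) summable_on A" "(\<lambda>n. f n * g n) summable_on A"
proof -
  show "(\<lambda>n. norm (f n * g n)) summable_on A"
    by (rule summable_on_comparison_test[OF summable_on_cmult_left[OF f, of B]])
       (auto simp: norm_mult intro!: mult_left_mono g)
  then show "(\<lambda>n. f n * g n) summable_on A" by (rule abs_summable_summable)
qed

section \<open>Summation over the double cosets\<close>

context scaled_cusp_pair
begin

definition weight :: "complex \<Rightarrow> real \<times> mat2 set \<Rightarrow> complex" where
  "weight s i = of_real (fst i) powr (- 2 * s - 2)"

definition ratio :: "real \<times> mat2 set \<Rightarrow> real" where
  "ratio i = lower_right (fst i) (snd i) / fst i"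

lemma weight_abs_summable:
  assumes "Re s > 1"
  shows "(\<lambda>i. norm (weight s i)) summable_on index"
proof -
  have "(\<lambda>(c, C). c powr (- (2 * Re s + 2))) summable_on index"
    using assms by (intro index_summable) simp
  also have "?this \<longleftrightarrow> ?thesis"
    by (intro summable_on_cong) (auto simp: weight_def norm_powr_real_powr index_iff)
  finally show ?thesis .
qed

text \<open>Each double coset is counted once in \<open>index\<close>, and the classes over a fixed \<open>c\<close> are finite in
  number, so sums over \<open>index\<close> are the iterated sums in the definitions of the Dirichlet series.\<close>
lemma index_sum:
  assumes s: "Re s > 1" and b: "\<And>i. norm (b i) \<le> 1"
  shows "(\<lambda>i. weight s i * b i) summable_on index"
    and "(\<lambda>c. of_real c powr (- 2 * s - 2) * (\<Sum>C\<in>D c. b (c, C))) summable_on occ"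
    and "(\<Sum>\<^sub>\<infinity>c\<in>occ. of_real c powr (- 2 * s - 2) * (\<Sum>C\<in>D c. b (c, C)))
      = (\<Sum>\<^sub>\<infinity>i\<in>index. weight s i * b i)"
proof -
  show 1: "(\<lambda>i. weight s i * b i) summable_on index"
    using b by (intro abs_summable_times_bounded(2)[OF weight_abs_summable[OF s], of _ 1])
  have inner: "(\<Sum>\<^sub>\<infinity>C\<in>D c. weight s (c, C) * b (c, C)) = of_real c powr (- 2 * s - 2) * (\<Sum>C\<in>D c. b (c, C))"
    if "c \<in> occ" for c
    using that finite_D_set[of c] by (simp add: occurring_c_def weight_def sum_distrib_left)
  have 2: "(\<lambda>(c, C). weight s (c, C) * b (c, C)) summable_on Sigma occ D"
    using 1 by (simp add: index_def case_prod_unfold)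
  show "(\<lambda>c. of_real c powr (- 2 * s - 2) * (\<Sum>C\<in>D c. b (c, C))) summable_on occ"
    using summable_on_Sigma_banach[OF 2] by (rule summable_on_cong[THEN iffD1, rotated]) (rule inner)
  have "(\<Sum>\<^sub>\<infinity>c\<in>occ. of_real c powr (- 2 * s - 2) * (\<Sum>C\<in>D c. b (c, C)))
     = (\<Sum>\<^sub>\<infinity>c\<in>occ. \<Sum>\<^sub>\<infinity>C\<in>D c. weight s (c, C) * b (c, C))"
    by (intro infsum_cong inner[symmetric])
  also have "\<dots> = (\<Sum>\<^sub>\<infinity>i\<in>index. weight s i * b i)"
    unfolding infsum_Sigma'_banach[OF 2] by (simp add: index_def case_prod_unfold)
  finally show "(\<Sum>\<^sub>\<infinity>c\<in>occ. of_real c powr (- 2 * s - 2) * (\<Sum>C\<in>D c. b (c, C)))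
      = (\<Sum>\<^sub>\<infinity>i\<in>index. weight s i * b i)" .
qed

lemma phi_eq:
  assumes s: "Re s > 1"
  shows "\<phi> n s = (\<Sum>\<^sub>\<infinity>i\<in>index. weight s i * e_char (of_int n * ratio i))"
  unfolding phi_def using index_sum(3)[OF s, of "\<lambda>i. e_char (of_int n * ratio i)"]
  by (simp add: ratio_def)

lemma phi1_eq:
  assumes s: "Re s > 1"
  shows "\<phi>1 n s = (\<Sum>\<^sub>\<infinity>i\<in>index. weight s i * of_real (cos (2 * pi * of_int n * ratio i)))"
  unfolding phi1_def of_real_sum using index_sum(3)[OF s, of "\<lambda>i. of_real (cos (2 * pi * of_int n * ratio i))"]
  by (simp add: ratio_def)

lemma phi2_eq:
  assumes s: "Re s > 1"
  shows "\<phi>2 n s = (\<Sum>\<^sub>\<infinity>i\<in>index. weight s i * of_real (sin (2 * pi * of_int n * ratio i)))"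
  unfolding phi2_def of_real_sum using index_sum(3)[OF s, of "\<lambda>i. of_real (sin (2 * pi * of_int n * ratio i))"]
  by (simp add: ratio_def)

lemma phi0_summable:
  assumes s: "Re s > 1"
  shows "(\<lambda>c. of_real c powr (- 2 * s - 2) * of_nat (card (D c))) summable_on occ"
  using index_sum(2)[OF s, of "\<lambda>_. 1"] by simp

lemma phi_0: "\<phi> 0 s = \<phi>0 s"
  by (simp add: phi_def phi0_def)

lemma phi_bound:
  assumes s: "Re s > 1"
  obtains B where "\<And>n. norm (\<phi> n s) \<le> B" "\<And>n. norm (\<phi>1 n s) \<le> B" "\<And>n. norm (\<phi>2 n s) \<le> B"
proof -
  have *: "norm (\<Sum>\<^sub>\<infinity>i\<in>index. weight s i * b i) \<le> (\<Sum>\<^sub>\<infinity>i\<in>index. norm (weight s i))" if b: "\<And>i. norm (b i) \<le> 1" for b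
    by (rule norm_infsum_le[OF has_sum_infsum[OF index_sum(1)[OF s b]] has_sum_infsum[OF weight_abs_summable[OF s]]])
       (simp add: norm_mult mult_left_le b)
  show ?thesis
    by (rule that; unfold phi_eq[OF s] phi1_eq[OF s] phi2_eq[OF s]; rule *) simp_all
qed

lemma phi_decompose:
  assumes s: "Re s > 1"
  shows "\<phi> n s = \<phi>1 n s + \<i> * \<phi>2 n s"
    and "\<phi> (- n) s = \<phi>1 n s - \<i> * \<phi>2 n s"
proof -
  have h: "((\<lambda>i. weight s i * of_real (cos (2 * pi * of_int n * ratio i))) has_sum \<phi>1 n s) index"
    "((\<lambda>i. weight s i * of_real (sin (2 * pi * of_int n * ratio i))) has_sum \<phi>2 n s) index"
    unfolding phi1_eq[OF s] phi2_eq[OF s] by (intro has_sum_infsum index_sum(1)[OF s]; simp)+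
  have e: "e_char (of_int n * r) = of_real (cos (2 * pi * of_int n * r)) + \<i> * of_real (sin (2 * pi * of_int n * r))"
    "e_char (of_int (- n) * r) = of_real (cos (2 * pi * of_int n * r)) + (- \<i>) * of_real (sin (2 * pi * of_int n * r))" for r
    by (simp_all add: e_char_eq_cis cis.code complex_eq_iff mult.assoc)
  have "((\<lambda>i. weight s i * of_real (cos (2 * pi * of_int n * ratio i)) + \<i> * (weight s i * of_real (sin (2 * pi * of_int n * ratio i))))
     has_sum (\<phi>1 n s + \<i> * \<phi>2 n s)) index"
    by (intro has_sum_add has_sum_cmult_right h)
  then show "\<phi> n s = \<phi>1 n s + \<i> * \<phi>2 n s"
    unfolding phi_eq[OF s] e by (intro infsumI) (simp add: algebra_simps)
  have "((\<lambda>i. weight s i * of_real (cos (2 * pi * of_int n * ratio i)) + (- \<i>) * (weight s i * of_real (sin (2 * pi * of_int n * ratio i))))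
     has_sum (\<phi>1 n s + (- \<i>) * \<phi>2 n s)) index"
    by (intro has_sum_add has_sum_cmult_right h)
  then show "\<phi> (- n) s = \<phi>1 n s - \<i> * \<phi>2 n s"
    unfolding phi_eq[OF s] e by (intro infsumI) (simp add: algebra_simps)
qed

text \<open>The double series converges absolutely, because the characters have norm \<open>1\<close>; summing first
  over the double cosets produces the Dirichlet series.\<close>
lemma dirichlet_swap:
  assumes s: "Re s > 1" and A: "(\<lambda>n. norm (A n)) summable_on (UNIV :: int set)"
  shows "(\<Sum>\<^sub>\<infinity>i\<in>index. weight s i * (\<Sum>\<^sub>\<infinity>n. A n * e_char (of_int n * (x + ratio i))))
    = (\<Sum>\<^sub>\<infinity>n. A n * (e_char (of_int n * x) * \<phi> n s))"
proof -
  let ?f = "\<lambda>i n. weight s i * (A n * e_char (of_int n * (x + ratio i)))"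
  have abs: "(\<lambda>(i, n). norm (?f i n)) summable_on index \<times> UNIV"
  proof (rule summable_on_SigmaI)
    show "((\<lambda>n. case (i, n) of (i, n) \<Rightarrow> norm (?f i n)) has_sum norm (weight s i) * (\<Sum>\<^sub>\<infinity>n. norm (A n))) UNIV" for i
      using has_sum_cmult_right[OF has_sum_infsum[OF A]] by (simp add: norm_mult)
    show "(\<lambda>i. norm (weight s i) * (\<Sum>\<^sub>\<infinity>n. norm (A n))) summable_on index"
      by (intro summable_on_cmult_left weight_abs_summable[OF s])
  qed auto
  then have "(\<lambda>p. norm (case p of (i, n) \<Rightarrow> ?f i n)) summable_on index \<times> UNIV"
    by (simp only: case_prod_unfold)
  then have sum: "(\<lambda>(i, n). ?f i n) summable_on index \<times> UNIV"
    by (rule abs_summable_summable)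
  have "(\<Sum>\<^sub>\<infinity>i\<in>index. weight s i * (\<Sum>\<^sub>\<infinity>n. A n * e_char (of_int n * (x + ratio i)))) = (\<Sum>\<^sub>\<infinity>i\<in>index. \<Sum>\<^sub>\<infinity>n. ?f i n)"
    by (simp only: infsum_cmult_right')
  also have "\<dots> = (\<Sum>\<^sub>\<infinity>n. \<Sum>\<^sub>\<infinity>i\<in>index. ?f i n)" by (rule infsum_swap_banach[OF sum])
  also have "\<dots> = (\<Sum>\<^sub>\<infinity>n. \<Sum>\<^sub>\<infinity>i\<in>index. A n * e_char (of_int n * x) * (weight s i * e_char (of_int n * ratio i)))"
    by (intro infsum_cong) (simp add: distrib_left e_char_add)
  also have "\<dots> = (\<Sum>\<^sub>\<infinity>n. A n * (e_char (of_int n * x) * \<phi> n s))"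
    by (simp only: infsum_cmult_right' phi_eq[OF s] mult.assoc)
  finally show ?thesis .
qed

text \<open>Absolute convergence is uniform in the class: the sum over \<open>m\<close> of the majorants depends on the
  argument \<open>x + d/c\<close> only modulo \<open>1\<close>, so it is bounded by a constant.\<close>
lemma poisson_double_sum:
  assumes s: "Re s > 1" and decay: "quadratic_decay f"
    and abs: "(\<lambda>n. norm (fourier f n)) summable_on UNIV"
    and poisson: "\<And>u. (\<Sum>\<^sub>\<infinity>m::int. f (u + of_int m)) = (\<Sum>\<^sub>\<infinity>n. fourier f n * e_char (of_int n * u))"
  shows "((\<lambda>(i, m::int). weight s i * f (x + ratio i + of_int m)) has_sum
    (\<Sum>\<^sub>\<infinity>n. fourier f n * (e_char (of_int n * x) * \<phi> n s))) (index \<times> UNIV)"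
proof -
  obtain A where A: "A \<ge> 0" "\<And>t. norm (f t) \<le> A * (1 / (1 + t\<^sup>2))"
    using quadratic_decayE[OF decay] by blast
  define S\<^sub>0 where "S\<^sub>0 = (\<Sum>\<^sub>\<infinity>m::int. 1 / (1 + (of_int m)\<^sup>2 :: real))"
  let ?b = "\<lambda>i m. norm (weight s i) * (A * 4) * (1 / (1 + (of_int (m + \<lfloor>x + ratio i\<rfloor>))\<^sup>2))"
  have bound: "norm (weight s i * f (x + ratio i + of_int m)) \<le> ?b i m" for i m
  proof -
    \<comment> \<open>Shifting \<open>m\<close> by the integer part leaves an argument in the unit interval, where the shift costs a factor \<open>4\<close>.\<close>
    define u where "u = frac (x + ratio i)"
    define k where "k = m + \<lfloor>x + ratio i\<rfloor>"
    have t: "x + ratio i + of_int m = u + of_int k" by (simp add: u_def k_def frac_def)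
    have u: "u\<^sup>2 \<le> 1" using frac_lt_1[of "x + ratio i"] frac_ge_0[of "x + ratio i"] by (simp add: u_def power_le_one)
    have "norm (f (u + of_int k)) \<le> A * (1 / (1 + (u + of_int k)\<^sup>2))" by (rule A(2))
    also have "\<dots> \<le> A * (2 * (1 + u\<^sup>2) / (1 + (of_int k)\<^sup>2))"
      by (intro mult_left_mono inverse_one_plus_square_shift A(1))
    also have "\<dots> \<le> A * (4 / (1 + (of_int k)\<^sup>2))"
      using u by (intro mult_left_mono divide_right_mono A(1)) auto
    finally have "norm (weight s i) * norm (f (u + of_int k)) \<le> norm (weight s i) * (A * (4 / (1 + (of_int k)\<^sup>2)))"
      by (rule mult_left_mono) auto
    then show ?thesis unfolding t k_def[symmetric] norm_mult by (simp add: mult.assoc)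
  qed
  have shift: "((\<lambda>m::int. 1 / (1 + (of_int (m + k))\<^sup>2 :: real)) has_sum S\<^sub>0) UNIV" for k
    using has_sum_infsum[OF summable_on_int_inverse_square] unfolding S\<^sub>0_def
    by (subst has_sum_reindex_bij_witness[of UNIV "\<lambda>m. m - k" "\<lambda>m. m + k" UNIV]) auto
  have "(\<lambda>(i, m). ?b i m) summable_on index \<times> (UNIV :: int set)"
  proof (rule summable_on_SigmaI)
    show "((\<lambda>m. case (i, m) of (i, m) \<Rightarrow> ?b i m) has_sum norm (weight s i) * (A * 4) * S\<^sub>0) (UNIV :: int set)" for i
      unfolding prod.case by (intro has_sum_cmult_right shift)
    show "(\<lambda>i. norm (weight s i) * (A * 4) * S\<^sub>0) summable_on index"
      by (intro summable_on_cmult_left weight_abs_summable[OF s])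
  qed (use A in auto)
  then have "(\<lambda>p. norm (case p of (i, m::int) \<Rightarrow> weight s i * f (x + ratio i + of_int m))) summable_on index \<times> UNIV"
    by (rule summable_on_comparison_test) (use bound in \<open>auto simp: case_prod_unfold\<close>)
  then have sum: "(\<lambda>(i, m::int). weight s i * f (x + ratio i + of_int m)) summable_on index \<times> UNIV"
    by (rule abs_summable_summable)
  have "(\<Sum>\<^sub>\<infinity>(i, m)\<in>index \<times> UNIV. weight s i * f (x + ratio i + of_int m))
    = (\<Sum>\<^sub>\<infinity>i\<in>index. \<Sum>\<^sub>\<infinity>m. weight s i * f (x + ratio i + of_int m))"
    by (rule infsum_Sigma'_banach[OF sum, symmetric])
  also have "\<dots> = (\<Sum>\<^sub>\<infinity>i\<in>index. weight s i * (\<Sum>\<^sub>\<infinity>n. fourier f n * e_char (of_int n * (x + ratio i))))"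
    by (simp only: infsum_cmult_right' poisson)
  also have "\<dots> = (\<Sum>\<^sub>\<infinity>n. fourier f n * (e_char (of_int n * x) * \<phi> n s))"
    by (rule dirichlet_swap[OF s abs])
  finally show ?thesis using has_sum_infsum[OF sum] by (simp only:)
qed

text \<open>The total contribution of the rows with \<open>c > 0\<close>, after Poisson summation.\<close>
definition eisenstein_main :: "complex \<Rightarrow> real \<Rightarrow> real \<Rightarrow> real \<Rightarrow> complex" where
  "eisenstein_main s x y \<theta> = of_real y powr (s + 1) *
     (- of_real (sin \<theta>) * ((\<Sum>\<^sub>\<infinity>n. fourier (radial y (s + 1)) n * (e_char (of_int n * x) * \<phi> n s))
         - 2 * of_real (y\<^sup>2) * (\<Sum>\<^sub>\<infinity>n. fourier (radial y (s + 2)) n * (e_char (of_int n * x) * \<phi> n s)))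
      + 2 * of_real (y * cos \<theta>) *
         (\<Sum>\<^sub>\<infinity>n. fourier (\<lambda>t. of_real t * radial y (s + 2) t) n * (e_char (of_int n * x) * \<phi> n s)))"

lemma summand_double_sum:
  assumes y: "y > 0" and s: "Re s > 1"
  shows "((\<lambda>(i, m::int). weight s i * summand s y \<theta> (x + ratio i + of_int m)) has_sum eisenstein_main s x y \<theta>) (index \<times> UNIV)"
proof -
  have e: "s + 1 + 1 = s + 2" by simp
  have r: "Re (s + 1) \<ge> 1" "Re (s + 2) \<ge> 1" using s by auto
  let ?h = "\<lambda>f p. case p of (i, m) \<Rightarrow> weight s i * f (x + ratio i + of_int (m :: int))"
  note H = poisson_double_sum[OF s quadratic_decay_radial[OF y r(1)] fourier_radial_summable(1)[OF y r(1)] poisson_radial[OF y r(1)], of x]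
    poisson_double_sum[OF s quadratic_decay_radial[OF y r(2)] fourier_radial_summable(1)[OF y r(2)] poisson_radial[OF y r(2)], of x]
    poisson_double_sum[OF s quadratic_decay_moment_radial(1)[OF y r(1)] fourier_radial_summable(2)[OF y r(1)] poisson_moment_radial[OF y r(1)], of x, unfolded e]
  have "((\<lambda>p. of_real y powr (s + 1) * (- of_real (sin \<theta>) * (?h (radial y (s + 1)) p + (- (2 * of_real (y\<^sup>2))) * ?h (radial y (s + 2)) p)
      + 2 * of_real (y * cos \<theta>) * ?h (\<lambda>t. of_real t * radial y (s + 2) t) p)) has_sum eisenstein_main s x y \<theta>) (index \<times> UNIV)"
    unfolding eisenstein_main_def diff_conv_add_uminus mult_minus_left[symmetric]
    by (intro has_sum_cmult_right has_sum_add H)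
  then show ?thesis
    by (rule has_sum_cong[THEN iffD1, rotated]) (auto simp: summand_def algebra_simps)
qed

lemma eisenstein_term_coset_of_row:
  assumes r: "r \<in> normal_rows" and z: "Im z > 0"
  shows "eisenstein_term \<sigma> s (tangent_act \<tau> (z, v)) (coset_of_row r) = row_term s z v r"
proof -
  \<comment> \<open>The representative chosen in the definition of the series; every representative gives the same value.\<close>
  define \<gamma> where "\<gamma> = (SOME g. g \<in> coset_of_row r)"
  have "\<exists>g. g \<in> coset_of_row r"
    using r coset_of_row_nonempty[of "fst r" "snd r"] by (auto simp: normal_rows_def)
  then have \<gamma>: "\<gamma> \<in> coset_of_row r" unfolding \<gamma>_def by (rule someI_ex)
  then have \<gamma>\<Gamma>: "\<gamma> \<in> \<Gamma>" by (simp add: coset_of_row_def)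
  define g where "g = adj2 \<sigma> ** \<gamma> ** \<tau>"
  have SL: "adj2 \<sigma> ** \<gamma> \<in> SL2R" "g \<in> SL2R"
    using \<gamma>\<Gamma> \<Gamma>(1) SL2R_adj2[OF \<sigma>_SL2R] \<tau>_SL2R unfolding g_def SL2R_subgroup_def by (auto intro!: SL2R_mult)
  have "eisenstein_term \<sigma> s (tangent_act \<tau> (z, v)) (coset_of_row r) = alpha1 s (tangent_act g (z, v))"
    unfolding eisenstein_term_def \<gamma>_def[symmetric] matrix_inv_SL2R[OF \<sigma>_SL2R] tangent_act_mult[OF SL(1) \<tau>_SL2R z] g_def ..
  also have "\<dots> = row_term s z v (g$2$1, g$2$2)" by (rule alpha1_tangent_act[OF SL(2) z])
  also have "\<dots> = row_term s z v r"
  proof -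
    have "(g$2$1, g$2$2) = r \<or> (g$2$1, g$2$2) = (- fst r, - snd r)"
      using \<gamma> by (cases r) (simp add: coset_of_row_def Let_def g_def)
    then show ?thesis using row_term_uminus[of s z v "fst r" "snd r"] by auto
  qed
  finally show ?thesis .
qed

lemma eisenstein_expansion:
  fixes x y \<theta> :: real
  assumes y: "y > 0" and s: "Re s > 1"
  defines "z \<equiv> Complex x y"
  shows "eisenstein_term \<sigma> s (tangent_act \<tau> (z, unit_tangent z \<theta>)) summable_on cusp_cosets \<Gamma> p"
    and "eisenstein1 \<Gamma> p \<sigma> (tangent_act \<tau> (z, unit_tangent z \<theta>)) s =
       - cusp_delta \<Gamma> p q * of_real y powr (s + 1) * of_real (sin \<theta>)
       + eisenstein_main s x y \<theta>"
proof -
  have z: "Im z > 0" using y by (simp add: z_def)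
  let ?R = "row_term s z (unit_tangent z \<theta>)"
  define H where "H = eisenstein_main s x y \<theta>"
  define N where "N = normal_rows \<inter> {(c, d). c = 0}"
  define P where "P = {(c, d) \<in> lower_rows. c > 0}"
  have split: "normal_rows = N \<union> P" "N \<inter> P = {}" by (auto simp: N_def P_def normal_rows_def)
  have "((\<lambda>(i, m). weight s i * summand s y \<theta> (x + ratio i + of_int m)) has_sum H) (index \<times> UNIV)"
    unfolding H_def by (rule summand_double_sum[OF y s])
  also have "?this \<longleftrightarrow> ((\<lambda>u. ?R ((\<lambda>((c, C), m). (c, lower_right c C + of_int m * c)) u)) has_sum H) (index \<times> (UNIV :: int set))"
  proof (intro has_sum_cong)
    fix u :: "(real \<times> mat2 set) \<times> int" assume "u \<in> index \<times> UNIV"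
    then obtain c C m where u: "u = ((c, C), m)" and c: "c > 0" by (auto simp: index_iff)
    have t: "x + (lower_right c C + of_int m * c) / c = x + ratio (c, C) + of_int m"
      using c by (simp add: ratio_def add_divide_distrib add.assoc)
    show "(case u of (i, m) \<Rightarrow> weight s i * summand s y \<theta> (x + ratio i + of_int m)) = ?R ((\<lambda>((c, C), m). (c, lower_right c C + of_int m * c)) u)"
      unfolding u z_def by (simp only: prod.case row_term_eq_summand[OF y c] weight_def fst_conv t)
  qed
  also have "\<dots> \<longleftrightarrow> (?R has_sum H) P"
    unfolding P_def by (rule has_sum_reindex_bij_betw[OF lower_rows_bij])
  finally have sumP: "(?R has_sum H) P" .
  have "(?R has_sum - cusp_delta \<Gamma> p q * of_real y powr (s + 1) * of_real (sin \<theta>)) N"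
  proof -
    have "?R (0, 1) = - (of_real y powr (s + 1) * of_real (sin \<theta>))"
      using alpha1_unit_tangent[OF z, of s \<theta>] by (simp add: row_term_def alpha1_def z_def)
    moreover have "N = (if \<exists>g\<in>\<Gamma>. boundary_act g q = p then {(0, 1)} else {})" unfolding N_def by (rule normal_rows_0)
    ultimately show ?thesis by (auto simp: cusp_delta_def has_sum_finite_iff)
  qed
  then have "(?R has_sum (- cusp_delta \<Gamma> p q * of_real y powr (s + 1) * of_real (sin \<theta>) + H)) normal_rows"
    unfolding split(1) by (rule has_sum_Un_disjoint[OF _ sumP split(2)])
  also have "?this \<longleftrightarrow> ((\<lambda>r. eisenstein_term \<sigma> s (tangent_act \<tau> (z, unit_tangent z \<theta>)) (coset_of_row r)) has_sum
      (- cusp_delta \<Gamma> p q * of_real y powr (s + 1) * of_real (sin \<theta>) + H)) normal_rows"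
    by (intro has_sum_cong eisenstein_term_coset_of_row[symmetric] z)
  also have "\<dots> \<longleftrightarrow> (eisenstein_term \<sigma> s (tangent_act \<tau> (z, unit_tangent z \<theta>)) has_sum
      (- cusp_delta \<Gamma> p q * of_real y powr (s + 1) * of_real (sin \<theta>) + H)) (cusp_cosets \<Gamma> p)"
    by (rule has_sum_reindex_bij_betw[OF cusp_cosets_bij])
  finally have *: "(eisenstein_term \<sigma> s (tangent_act \<tau> (z, unit_tangent z \<theta>)) has_sum
      (- cusp_delta \<Gamma> p q * of_real y powr (s + 1) * of_real (sin \<theta>) + H)) (cusp_cosets \<Gamma> p)" .
  then show "eisenstein_term \<sigma> s (tangent_act \<tau> (z, unit_tangent z \<theta>)) summable_on cusp_cosets \<Gamma> p"
    by (rule has_sum_imp_summable)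
  show "eisenstein1 \<Gamma> p \<sigma> (tangent_act \<tau> (z, unit_tangent z \<theta>)) s =
       - cusp_delta \<Gamma> p q * of_real y powr (s + 1) * of_real (sin \<theta>)
       + eisenstein_main s x y \<theta>"
    unfolding eisenstein1_def H_def[symmetric] by (rule infsumI[OF *])
qed

end

section \<open>The Fourier expansion\<close>

lemma infsum_int_split_0:
  fixes f :: "int \<Rightarrow> complex"
  assumes "f summable_on UNIV"
  shows "(\<Sum>\<^sub>\<infinity>n. f n) = f 0 + (\<Sum>\<^sub>\<infinity>n\<in>{n. n \<noteq> 0}. f n)" "f summable_on {n. n \<noteq> 0}"
proof -
  show s: "f summable_on {n. n \<noteq> 0}" by (rule summable_on_subset[OF assms]) auto
  have "(f has_sum (f 0 + (\<Sum>\<^sub>\<infinity>n\<in>{n. n \<noteq> 0}. f n))) (insert 0 {n. n \<noteq> 0})"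
    by (intro has_sum_insert has_sum_infsum s) auto
  also have "insert 0 {n. n \<noteq> 0} = (UNIV :: int set)" by auto
  finally show "(\<Sum>\<^sub>\<infinity>n. f n) = f 0 + (\<Sum>\<^sub>\<infinity>n\<in>{n. n \<noteq> 0}. f n)" by (rule infsumI)
qed

lemma infsum_int_pairing:
  fixes f :: "int \<Rightarrow> complex"
  assumes f: "f summable_on {n. n \<noteq> 0}"
  shows "(\<Sum>\<^sub>\<infinity>n\<in>{n. n \<noteq> 0}. f n) = (\<Sum>\<^sub>\<infinity>n\<in>{n. n > 0}. f n + f (- n))"
proof -
  have pos: "f summable_on {n. n > 0}" and neg: "f summable_on {n. n < 0}"
    by (rule summable_on_subset[OF f]; auto)+
  have neg': "((\<lambda>n. f (- n)) has_sum (\<Sum>\<^sub>\<infinity>n\<in>{n. n < 0}. f n)) {n. n > 0}"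
    using has_sum_infsum[OF neg]
    by (subst has_sum_reindex_bij_witness[of "{n. n > 0}" uminus uminus "{n. n < 0}"]) auto
  have "(f has_sum ((\<Sum>\<^sub>\<infinity>n\<in>{n. n > 0}. f n) + (\<Sum>\<^sub>\<infinity>n\<in>{n. n < 0}. f n))) ({n. n > 0} \<union> {n. n < 0})"
    by (intro has_sum_Un_disjoint has_sum_infsum pos neg) auto
  also have "{n. n > 0} \<union> {n. n < 0} = {n::int. n \<noteq> 0}" by auto
  finally have "(\<Sum>\<^sub>\<infinity>n\<in>{n. n \<noteq> 0}. f n) = (\<Sum>\<^sub>\<infinity>n\<in>{n. n > 0}. f n) + (\<Sum>\<^sub>\<infinity>n\<in>{n. n < 0}. f n)" by (rule infsumI)
  also have "\<dots> = (\<Sum>\<^sub>\<infinity>n\<in>{n. n > 0}. f n + f (- n))"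
    by (intro infsumI[symmetric] has_sum_add has_sum_infsum pos neg')
  finally show ?thesis .
qed

context scaled_cusp_pair
begin

abbreviation exp_term :: "real \<Rightarrow> real \<Rightarrow> complex \<Rightarrow> complex \<Rightarrow> int \<Rightarrow> complex" where
  "exp_term x y s \<nu> n \<equiv> e_char (of_int n * x) * of_int \<bar>n\<bar> powr \<nu> *
     bessel_K \<nu> (2 * pi * of_int \<bar>n\<bar> * y) * \<phi> n s"

abbreviation sin_term :: "real \<Rightarrow> real \<Rightarrow> complex \<Rightarrow> complex \<Rightarrow> complex \<Rightarrow> int \<Rightarrow> complex" where
  "sin_term x y s \<mu> \<nu> n \<equiv> of_real (sin (2 * pi * of_int n * x)) * of_int n powr \<mu> *
     bessel_K \<nu> (2 * pi * of_int n * y) * \<phi>1 n s"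

abbreviation cos_term :: "real \<Rightarrow> real \<Rightarrow> complex \<Rightarrow> complex \<Rightarrow> complex \<Rightarrow> int \<Rightarrow> complex" where
  "cos_term x y s \<mu> \<nu> n \<equiv> of_real (cos (2 * pi * of_int n * x)) * of_int n powr \<mu> *
     bessel_K \<nu> (2 * pi * of_int n * y) * \<phi>2 n s"

lemma fourier_radial_sum:
  assumes y: "y > 0" and a: "Re a \<ge> 1" and s: "Re s > 1"
  shows "(\<lambda>n. exp_term x y s (a - 1/2) n) summable_on {n. n \<noteq> 0}" (is "?f summable_on _")
    and "(\<lambda>n. fourier (radial y a) n * (e_char (of_int n * x) * \<phi> n s)) summable_on UNIV" (is "?g summable_on _")
    and "(\<Sum>\<^sub>\<infinity>n. fourier (radial y a) n * (e_char (of_int n * x) * \<phi> n s))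
      = of_real (sqrt pi) * Gamma (a - 1/2) / Gamma a * of_real y powr (1 - 2 * a) * \<phi>0 s
       + 2 * of_real pi powr a * of_real y powr (1/2 - a) / Gamma a *
         (\<Sum>\<^sub>\<infinity>n\<in>{n. n \<noteq> 0}. exp_term x y s (a - 1/2) n)"
proof -
  let ?k = "2 * of_real pi powr a * of_real y powr (1/2 - a) / Gamma a"
  have "Gamma a \<noteq> 0" using Gamma_eq_zero_iff[of a] a by (auto elim!: nonpos_Ints_cases)
  then have k: "?k \<noteq> 0" using y by (simp add: powr_def)
  obtain B where B: "\<And>n. norm (\<phi> n s) \<le> B" "\<And>n. norm (\<phi>1 n s) \<le> B" "\<And>n. norm (\<phi>2 n s) \<le> B"
    using phi_bound[OF s] by blast
  show g: "?g summable_on UNIV"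
    by (rule abs_summable_times_bounded(2)[OF fourier_radial_summable(1)[OF y a], where B = B]) (simp add: norm_mult B)
  have eq: "?g n = ?k * ?f n" if "n \<in> {n. n \<noteq> 0}" for n
    using that fourier_radial[OF y a, of n] by (simp add: mult_ac)
  have "(\<lambda>n. ?k * ?f n) summable_on {n. n \<noteq> 0}"
    using infsum_int_split_0(2)[OF g] by (rule summable_on_cong[THEN iffD1, rotated]) (rule eq)
  then show "?f summable_on {n. n \<noteq> 0}" by (subst (asm) summable_on_cmult_right'[OF k])
  have "(\<Sum>\<^sub>\<infinity>n. ?g n) = ?g 0 + (\<Sum>\<^sub>\<infinity>n\<in>{n. n \<noteq> 0}. ?g n)" by (rule infsum_int_split_0(1)[OF g])
  also have "(\<Sum>\<^sub>\<infinity>n\<in>{n. n \<noteq> 0}. ?g n) = (\<Sum>\<^sub>\<infinity>n\<in>{n. n \<noteq> 0}. ?k * ?f n)" by (intro infsum_cong eq)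
  also have "\<dots> = ?k * (\<Sum>\<^sub>\<infinity>n\<in>{n. n \<noteq> 0}. ?f n)" by (rule infsum_cmult_right')
  also have "?g 0 = of_real (sqrt pi) * Gamma (a - 1/2) / Gamma a * of_real y powr (1 - 2 * a) * \<phi>0 s"
    using fourier_radial_0[OF y a] by (simp add: phi_0)
  finally show "(\<Sum>\<^sub>\<infinity>n. ?g n) = of_real (sqrt pi) * Gamma (a - 1/2) / Gamma a * of_real y powr (1 - 2 * a) * \<phi>0 s
       + ?k * (\<Sum>\<^sub>\<infinity>n\<in>{n. n \<noteq> 0}. ?f n)" .
qed

text \<open>The coefficients are odd in \<open>n\<close>, and \<open>\<phi> (- n)\<close> differs from \<open>\<phi> n\<close> by the sign of
  its sine part. Pairing \<open>n\<close> with \<open>-n\<close> therefore leaves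
  \<open>sin (2\<pi>nx) \<phi>1 + cos (2\<pi>nx) \<phi>2\<close> in each pair.\<close>
lemma fourier_moment_radial_sum:
  assumes y: "y > 0" and a: "Re a \<ge> 1" and s: "Re s > 1"
  shows "(\<lambda>n. sin_term x y s (a + 1/2) (a - 1/2) n) summable_on {n. n > 0}" (is "?f1 summable_on _")
    and "(\<lambda>n. cos_term x y s (a + 1/2) (a - 1/2) n) summable_on {n. n > 0}" (is "?f2 summable_on _")
    and "(\<lambda>n. fourier (\<lambda>t. of_real t * radial y (a + 1) t) n * (e_char (of_int n * x) * \<phi> n s)) summable_on UNIV" (is "?g summable_on _")
    and "(\<Sum>\<^sub>\<infinity>n. fourier (\<lambda>t. of_real t * radial y (a + 1) t) n * (e_char (of_int n * x) * \<phi> n s))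
      = 4 * of_real pi powr (a + 1) * of_real y powr (1/2 - a) * rGamma (a + 1) *
         ((\<Sum>\<^sub>\<infinity>n\<in>{n. n > 0}. sin_term x y s (a + 1/2) (a - 1/2) n)
       + (\<Sum>\<^sub>\<infinity>n\<in>{n. n > 0}. cos_term x y s (a + 1/2) (a - 1/2) n))"
proof -
  define F where "F = fourier (\<lambda>t. of_real t * radial y (a + 1) t)"
  define b where "b n = of_int n powr (a + 1/2) * bessel_K (a - 1/2) (2 * pi * of_int n * y)" for n :: int
  define k where "k = 2 * of_real pi powr (a + 1) * of_real y powr (1/2 - a) * rGamma (a + 1)"
  have a0: "a \<noteq> 0" "a \<notin> \<int>\<^sub>\<le>\<^sub>0" "a + 1 \<notin> \<int>\<^sub>\<le>\<^sub>0" using a by (auto elim!: nonpos_Ints_cases simp: complex_eq_iff)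
  have k0: "k \<noteq> 0" using y a0 by (simp add: k_def powr_def rGamma_eq_zero_iff)
  have Fs: "(\<lambda>n. norm (F n)) summable_on UNIV" unfolding F_def by (rule fourier_radial_summable(2)[OF y a])
  have F: "F n = - \<i> * k * b n" "F (- n) = \<i> * k * b n" if n: "n > 0" for n
  proof -
    have pw: "of_int n * of_int n powr (a - 1/2) = (of_int n :: complex) powr (a + 1/2)"
    proof -
      have e: "a - 1/2 + 1 = a + 1/2" by simp
      show ?thesis using powr_add[of "of_int n :: complex" "a - 1/2" 1] n unfolding e by simp
    qed
    have pp: "of_real pi * complex_of_real pi powr a = of_real pi powr (a + 1)"
      using powr_add[of "of_real pi :: complex" a 1] by simp
    have G: "1 / (a * Gamma a) = rGamma (a + 1)"
      using a0 Gamma_plus1[of a] by (simp add: rGamma_inverse_Gamma inverse_eq_divide)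
    have "of_real pi * of_int n / a * fourier (radial y a) n = k * b n"
      "of_real pi * of_int n / a * fourier (radial y a) (- n) = k * b n"
    proof -
      have "of_real pi * of_int n / a * (2 * of_real pi powr a * of_int n powr (a - 1/2) * of_real y powr (1/2 - a)
          * bessel_K (a - 1/2) (2 * pi * of_int n * y) / Gamma a)
        = 2 * (of_real pi * of_real pi powr a) * of_real y powr (1/2 - a) * (1 / (a * Gamma a)) *
           (of_int n * of_int n powr (a - 1/2) * bessel_K (a - 1/2) (2 * pi * of_int n * y))"
        by simp
      also have "\<dots> = k * b n" unfolding pw pp G k_def b_def ..
      finally have "of_real pi * of_int n / a * (2 * of_real pi powr a * of_int n powr (a - 1/2) * of_real y powr (1/2 - a)
          * bessel_K (a - 1/2) (2 * pi * of_int n * y) / Gamma a) = k * b n" .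
      then show "of_real pi * of_int n / a * fourier (radial y a) n = k * b n"
        "of_real pi * of_int n / a * fourier (radial y a) (- n) = k * b n"
        using fourier_radial[OF y a, of n] fourier_radial[OF y a, of "- n"] n by simp_all
    qed
    note kb = this
    have "F n = - \<i> * (of_real pi * of_int n / a * fourier (radial y a) n)"
      "F (- n) = \<i> * (of_real pi * of_int n / a * fourier (radial y a) (- n))"
      unfolding F_def fourier_moment_radial[OF y a] by simp_all
    then show "F n = - \<i> * k * b n" "F (- n) = \<i> * k * b n"
      unfolding kb by simp_all
  qed
  obtain B where B: "\<And>n. norm (\<phi> n s) \<le> B" "\<And>n. norm (\<phi>1 n s) \<le> B" "\<And>n. norm (\<phi>2 n s) \<le> B"
    using phi_bound[OF s] by blast
  have "(\<lambda>n. norm (F n)) summable_on {n. n > 0}" by (rule summable_on_subset[OF Fs]) auto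
  also have "?this \<longleftrightarrow> (\<lambda>n. norm k * norm (b n)) summable_on {n. n > 0}"
    by (intro summable_on_cong) (simp add: F norm_mult)
  finally have bs: "(\<lambda>n. norm (b n)) summable_on {n. n > 0}"
    using k0 by (subst (asm) summable_on_cmult_right') auto
  have bound: "norm (of_real u * w) \<le> B" if "\<bar>u\<bar> \<le> 1" "norm w \<le> B" for u and w :: complex
    using mult_mono[OF that] by (simp add: norm_mult)
  have "(\<lambda>n. b n * (of_real (sin (2 * pi * of_int n * x)) * \<phi>1 n s)) summable_on {n. n > 0}"
    by (rule abs_summable_times_bounded(2)[OF bs, where B = B]) (rule bound[OF _ B(2)], simp)
  then show f1: "?f1 summable_on {n. n > 0}" by (simp add: b_def mult_ac)
  have "(\<lambda>n. b n * (of_real (cos (2 * pi * of_int n * x)) * \<phi>2 n s)) summable_on {n. n > 0}"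
    by (rule abs_summable_times_bounded(2)[OF bs, where B = B]) (rule bound[OF _ B(3)], simp)
  then show f2: "?f2 summable_on {n. n > 0}" by (simp add: b_def mult_ac)
  show g: "?g summable_on UNIV"
    by (rule abs_summable_times_bounded(2)[OF Fs[unfolded F_def], where B = B]) (simp add: norm_mult B)
  have pair: "?g n + ?g (- n) = 2 * k * (?f1 n + ?f2 n)" if n: "n \<in> {n. n > 0}" for n
  proof -
    have e: "e_char (of_int n * x) = of_real (cos (2 * pi * of_int n * x)) + \<i> * of_real (sin (2 * pi * of_int n * x))"
      "e_char (of_int (- n) * x) = of_real (cos (2 * pi * of_int n * x)) - \<i> * of_real (sin (2 * pi * of_int n * x))"
      by (simp_all add: e_char_eq_cis cis.code complex_eq_iff mult.assoc)
    have "?g n + ?g (- n) = \<i> * k * b n * (e_char (of_int (- n) * x) * \<phi> (- n) s - e_char (of_int n * x) * \<phi> n s)"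
      using F[of n] n unfolding F_def by (simp add: algebra_simps)
    also have "e_char (of_int (- n) * x) * \<phi> (- n) s - e_char (of_int n * x) * \<phi> n s
      = - 2 * \<i> * (of_real (sin (2 * pi * of_int n * x)) * \<phi>1 n s + of_real (cos (2 * pi * of_int n * x)) * \<phi>2 n s)"
      unfolding e phi_decompose[OF s, of n] by (simp add: algebra_simps)
    also have "\<i> * k * b n * (- 2 * \<i> * (of_real (sin (2 * pi * of_int n * x)) * \<phi>1 n s + of_real (cos (2 * pi * of_int n * x)) * \<phi>2 n s))
      = 2 * k * (?f1 n + ?f2 n)"
      by (simp add: b_def algebra_simps)
    finally show ?thesis .
  qed
  have "(\<Sum>\<^sub>\<infinity>n. ?g n) = ?g 0 + (\<Sum>\<^sub>\<infinity>n\<in>{n. n \<noteq> 0}. ?g n)" by (rule infsum_int_split_0(1)[OF g])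
  also have "?g 0 = 0" using fourier_moment_radial[OF y a, of 0] by simp
  also have "(\<Sum>\<^sub>\<infinity>n\<in>{n. n \<noteq> 0}. ?g n) = (\<Sum>\<^sub>\<infinity>n\<in>{n. n > 0}. ?g n + ?g (- n))"
    by (rule infsum_int_pairing[OF infsum_int_split_0(2)[OF g]])
  also have "\<dots> = (\<Sum>\<^sub>\<infinity>n\<in>{n. n > 0}. 2 * k * (?f1 n + ?f2 n))" by (intro infsum_cong pair)
  also have "\<dots> = 2 * k * (\<Sum>\<^sub>\<infinity>n\<in>{n. n > 0}. ?f1 n + ?f2 n)" by (rule infsum_cmult_right')
  also have "(\<Sum>\<^sub>\<infinity>n\<in>{n. n > 0}. ?f1 n + ?f2 n) = (\<Sum>\<^sub>\<infinity>n\<in>{n. n > 0}. ?f1 n) + (\<Sum>\<^sub>\<infinity>n\<in>{n. n > 0}. ?f2 n)"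
    by (rule infsum_add[OF f1 f2])
  finally show "(\<Sum>\<^sub>\<infinity>n. ?g n) = 4 * of_real pi powr (a + 1) * of_real y powr (1/2 - a) * rGamma (a + 1) *
     ((\<Sum>\<^sub>\<infinity>n\<in>{n. n > 0}. ?f1 n) + (\<Sum>\<^sub>\<infinity>n\<in>{n. n > 0}. ?f2 n))"
    by (simp add: k_def)
qed

text \<open>Only the constants remain to be collected. The zeroth terms of the first two series combine through
  \<open>2 (s + 1/2) / (s + 1) - 1 = s / (s + 1)\<close>, which changes \<open>Gamma (s + 1)\<close> into
  \<open>Gamma s\<close>; \<open>Y u\<close> stands for \<open>y\<^sup>u\<close>.\<close>
lemma eisenstein_main_eq:
  assumes y: "y > 0" and s: "Re s > 1"
  shows "eisenstein_main s x y \<theta>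
    = of_real (sqrt pi) * of_real y powr (- s) * of_real (sin \<theta>) * (1 / (s + 1)) *
           (Gamma (s + 1/2) / Gamma s) * \<phi>0 s
       - 2 * of_real pi powr (s + 1) * of_real y powr (1/2) * of_real (sin \<theta>) *
           inverse (Gamma (s + 1)) *
           (\<Sum>\<^sub>\<infinity>n\<in>{n. n \<noteq> 0}. exp_term x y s (s + 1/2) n)
       + 4 * of_real pi powr (s + 2) * of_real y powr (3/2) * of_real (sin \<theta>) *
           inverse (Gamma (s + 2)) *
           (\<Sum>\<^sub>\<infinity>n\<in>{n. n \<noteq> 0}. exp_term x y s (s + 3/2) n)
       + 8 * of_real pi powr (s + 1) * of_real y powr (3/2) * of_real (cos \<theta>) * sin_Gamma s *
           (\<Sum>\<^sub>\<infinity>n\<in>{n. n > 0}. sin_term x y s (s + 3/2) (- s - 1/2) n)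
       + 8 * of_real pi powr (s + 1) * of_real y powr (3/2) * of_real (cos \<theta>) * sin_Gamma s *
           (\<Sum>\<^sub>\<infinity>n\<in>{n. n > 0}. cos_term x y s (s + 3/2) (- s - 1/2) n)"
proof -
  have r: "Re (s + 1) \<ge> 1" "Re (s + 2) \<ge> 1" using s by auto
  have e: "s + 1 - 1/2 = s + 1/2" "s + 2 - 1/2 = s + 3/2" "s + 1 + 1 = s + 2" "s + 1 + 1/2 = s + 3/2" by simp_all
  have K: "bessel_K (- s - 1/2) = bessel_K (s + 1/2)"
    using bessel_K_minus[of "s + 1/2"] by (simp add: fun_eq_iff)
  define \<Phi> where "\<Phi> = \<phi>0 s"
  define \<Sigma>1 where "\<Sigma>1 = (\<Sum>\<^sub>\<infinity>n\<in>{n. n \<noteq> 0}. exp_term x y s (s + 1/2) n)"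
  define \<Sigma>2 where "\<Sigma>2 = (\<Sum>\<^sub>\<infinity>n\<in>{n. n \<noteq> 0}. exp_term x y s (s + 3/2) n)"
  define \<Sigma>3 where "\<Sigma>3 = (\<Sum>\<^sub>\<infinity>n\<in>{n. n > 0}. sin_term x y s (s + 3/2) (s + 1/2) n)"
  define \<Sigma>4 where "\<Sigma>4 = (\<Sum>\<^sub>\<infinity>n\<in>{n. n > 0}. cos_term x y s (s + 3/2) (s + 1/2) n)"
  define Y where "Y u = complex_of_real y powr u" for u
  define sn where "sn = complex_of_real (sin \<theta>)"
  define cs where "cs = complex_of_real (cos \<theta>)"
  define \<pi> where "\<pi> = complex_of_real pi"
  have Y_add: "Y u * Y v = Y (u + v)" for u v unfolding Y_def by (rule powr_add[symmetric])
  have Y1: "complex_of_real y = Y 1" "complex_of_real (y\<^sup>2) = Y 2"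
    using y by (simp_all add: Y_def)
  have g0: "Gamma s \<noteq> 0" "s \<noteq> 0" "s + 1 \<noteq> 0"
    using Gamma_eq_zero_iff[of s] s by (auto elim!: nonpos_Ints_cases simp: complex_eq_iff)
  have Gamma_shift: "Gamma (w + 1) = w * Gamma w" if "Re w > 0" for w :: complex
    using that by (intro Gamma_plus1) (auto elim!: nonpos_Ints_cases)
  have G1: "Gamma (s + 1) = s * Gamma s" using s by (intro Gamma_shift) simp
  have G2: "Gamma (s + 2) = (s + 1) * (s * Gamma s)"
    using Gamma_shift[of "s + 1"] s unfolding G1 e(3) by simp
  have G3: "Gamma (s + 3/2) = (s + 1/2) * Gamma (s + 1/2)"
  proof -
    have shift: "s + 1/2 + 1 = s + 3/2" by simp
    show ?thesis using Gamma_shift[of "s + 1/2"] s unfolding shift by simp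
  qed
  note S1 = fourier_radial_sum[OF y r(1) s, of x] and S2 = fourier_radial_sum[OF y r(2) s, of x]
    and S3 = fourier_moment_radial_sum[OF y r(1) s, of x]
  define T1 where "T1 = (\<Sum>\<^sub>\<infinity>n. fourier (radial y (s + 1)) n * (e_char (of_int n * x) * \<phi> n s))"
  define T2 where "T2 = (\<Sum>\<^sub>\<infinity>n. fourier (radial y (s + 2)) n * (e_char (of_int n * x) * \<phi> n s))"
  define T3 where "T3 = (\<Sum>\<^sub>\<infinity>n. fourier (\<lambda>t. of_real t * radial y (s + 2) t) n * (e_char (of_int n * x) * \<phi> n s))"
  have T1: "T1 = of_real (sqrt pi) * Gamma (s + 1/2) / Gamma (s + 1) * Y (1 - 2 * (s + 1)) * \<Phi>
       + 2 * \<pi> powr (s + 1) * Y (1/2 - (s + 1)) / Gamma (s + 1) * \<Sigma>1"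
    unfolding T1_def \<Phi>_def \<Sigma>1_def Y_def \<pi>_def using S1(3) by (simp only: e)
  have T2: "T2 = of_real (sqrt pi) * Gamma (s + 3/2) / Gamma (s + 2) * Y (1 - 2 * (s + 2)) * \<Phi>
       + 2 * \<pi> powr (s + 2) * Y (1/2 - (s + 2)) / Gamma (s + 2) * \<Sigma>2"
    unfolding T2_def \<Phi>_def \<Sigma>2_def Y_def \<pi>_def using S2(3) by (simp only: e)
  have T3: "T3 = 4 * \<pi> powr (s + 2) * Y (1/2 - (s + 1)) * rGamma (s + 2) * (\<Sigma>3 + \<Sigma>4)"
    unfolding T3_def \<Sigma>3_def \<Sigma>4_def Y_def \<pi>_def using S3(4) by (simp only: e)
  define A1 where "A1 = Gamma (s + 1/2) / Gamma (s + 1)"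
  define A2 where "A2 = Gamma (s + 3/2) / Gamma (s + 2)"
  define i1 where "i1 = inverse (Gamma (s + 1))"
  define i2 where "i2 = inverse (Gamma (s + 2))"
  have "eisenstein_main s x y \<theta> = of_real y powr (s + 1) * (- of_real (sin \<theta>) * (T1 - 2 * of_real (y\<^sup>2) * T2) + 2 * of_real (y * cos \<theta>) * T3)"
    unfolding T1_def T2_def T3_def eisenstein_main_def ..
  also have "\<dots> = - sn * (Y (s + 1) * T1) + 2 * sn * (Y (s + 1) * Y 2 * T2) + 2 * cs * (Y (s + 1) * Y 1 * T3)"
    unfolding Y1(2) of_real_mult[of y "cos \<theta>"] Y1(1) sn_def cs_def Y_def[of "s + 1"] by (simp add: algebra_simps)
  also have "Y (s + 1) * T1 = of_real (sqrt pi) * A1 * Y (- s) * \<Phi> + 2 * \<pi> powr (s + 1) * Y (1/2) * i1 * \<Sigma>1"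
  proof -
    have Y_eqs: "Y (s + 1) * Y (1 - 2 * (s + 1)) = Y (- s)" "Y (s + 1) * Y (1/2 - (s + 1)) = Y (1/2)"
      unfolding Y_add by (rule arg_cong[where f = Y]; simp)+
    have "Y (s + 1) * T1 = of_real (sqrt pi) * A1 * (Y (s + 1) * Y (1 - 2 * (s + 1))) * \<Phi>
       + 2 * \<pi> powr (s + 1) * (Y (s + 1) * Y (1/2 - (s + 1))) * i1 * \<Sigma>1"
      unfolding T1 A1_def i1_def divide_inverse by (simp only: distrib_left mult_ac)
    then show ?thesis unfolding Y_eqs .
  qed
  also have "Y (s + 1) * Y 2 * T2 = of_real (sqrt pi) * A2 * Y (- s) * \<Phi> + 2 * \<pi> powr (s + 2) * Y (3/2) * i2 * \<Sigma>2"
  proof -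
    have Y_eqs: "Y (s + 1) * Y 2 * Y (1 - 2 * (s + 2)) = Y (- s)" "Y (s + 1) * Y 2 * Y (1/2 - (s + 2)) = Y (3/2)"
      unfolding Y_add by (rule arg_cong[where f = Y]; simp)+
    have "Y (s + 1) * Y 2 * T2 = of_real (sqrt pi) * A2 * (Y (s + 1) * Y 2 * Y (1 - 2 * (s + 2))) * \<Phi>
       + 2 * \<pi> powr (s + 2) * (Y (s + 1) * Y 2 * Y (1/2 - (s + 2))) * i2 * \<Sigma>2"
      unfolding T2 A2_def i2_def divide_inverse by (simp only: distrib_left mult_ac)
    then show ?thesis unfolding Y_eqs .
  qed
  also have "Y (s + 1) * Y 1 * T3 = 4 * \<pi> powr (s + 1) * Y (3/2) * sin_Gamma s * (\<Sigma>3 + \<Sigma>4)"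
  proof -
    have Y_eq: "Y (s + 1) * Y 1 * Y (1/2 - (s + 1)) = Y (3/2)"
      unfolding Y_add by (rule arg_cong[where f = Y]; simp)
    have \<pi>_eq: "\<pi> powr (s + 2) = \<pi> powr (s + 1) * \<pi>"
      using powr_add[of \<pi> "s + 1" 1] unfolding e(3) by (simp add: \<pi>_def)
    have "Y (s + 1) * Y 1 * T3 = 4 * \<pi> powr (s + 2) * (Y (s + 1) * Y 1 * Y (1/2 - (s + 1))) * rGamma (s + 2) * (\<Sigma>3 + \<Sigma>4)"
      unfolding T3 by (simp only: mult_ac)
    then have "Y (s + 1) * Y 1 * T3 = 4 * (\<pi> powr (s + 1) * \<pi>) * Y (3/2) * rGamma (s + 2) * (\<Sigma>3 + \<Sigma>4)"
      unfolding Y_eq \<pi>_eq .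
    then show ?thesis unfolding sin_Gamma_eq \<pi>_def[symmetric] by (simp only: mult_ac)
  qed
  also have "- sn * (of_real (sqrt pi) * A1 * Y (- s) * \<Phi> + 2 * \<pi> powr (s + 1) * Y (1/2) * i1 * \<Sigma>1)
      + 2 * sn * (of_real (sqrt pi) * A2 * Y (- s) * \<Phi> + 2 * \<pi> powr (s + 2) * Y (3/2) * i2 * \<Sigma>2)
      + 2 * cs * (4 * \<pi> powr (s + 1) * Y (3/2) * sin_Gamma s * (\<Sigma>3 + \<Sigma>4))
    = sn * of_real (sqrt pi) * Y (- s) * \<Phi> * (2 * A2 - A1)
      - 2 * \<pi> powr (s + 1) * Y (1/2) * sn * i1 * \<Sigma>1
      + 4 * \<pi> powr (s + 2) * Y (3/2) * sn * i2 * \<Sigma>2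
      + 8 * \<pi> powr (s + 1) * Y (3/2) * cs * sin_Gamma s * \<Sigma>3
      + 8 * \<pi> powr (s + 1) * Y (3/2) * cs * sin_Gamma s * \<Sigma>4"
  proof -
    have "- sn * (r * A1 * u * \<Phi> + 2 * P * v * i1 * \<Sigma>1) + 2 * sn * (r * A2 * u * \<Phi> + 2 * P' * w * i2 * \<Sigma>2)
        + 2 * cs * (4 * P * w * g * (\<Sigma>3 + \<Sigma>4))
      = sn * r * u * \<Phi> * (2 * A2 - A1) - 2 * P * v * sn * i1 * \<Sigma>1 + 4 * P' * w * sn * i2 * \<Sigma>2
        + 8 * P * w * cs * g * \<Sigma>3 + 8 * P * w * cs * g * \<Sigma>4" for r u v w P P' g :: complex
      by (simp add: algebra_simps)
    then show ?thesis .
  qed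
  finally have main: "eisenstein_main s x y \<theta>
    = sn * of_real (sqrt pi) * Y (- s) * \<Phi> * (2 * A2 - A1)
      - 2 * \<pi> powr (s + 1) * Y (1/2) * sn * i1 * \<Sigma>1
      + 4 * \<pi> powr (s + 2) * Y (3/2) * sn * i2 * \<Sigma>2
      + 8 * \<pi> powr (s + 1) * Y (3/2) * cs * sin_Gamma s * \<Sigma>3
      + 8 * \<pi> powr (s + 1) * Y (3/2) * cs * sin_Gamma s * \<Sigma>4" .
  have "2 * A2 - A1 = 1 / (s + 1) * (Gamma (s + 1/2) / Gamma s)"
  proof -
    have "2 * ((s + 1/2) * g / ((s + 1) * (s * h))) - g / (s * h) = 1 / (s + 1) * (g / h)" if "h \<noteq> 0" for g h
      using that g0(2,3) by (simp add: divide_simps) (simp add: algebra_simps)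
    from this[OF g0(1)] show ?thesis unfolding A1_def A2_def G1 G2 G3 .
  qed
  then have const: "sn * of_real (sqrt pi) * Y (- s) * \<Phi> * (2 * A2 - A1)
     = of_real (sqrt pi) * Y (- s) * sn * (1 / (s + 1)) * (Gamma (s + 1/2) / Gamma s) * \<Phi>"
    by (simp only: mult_ac)
  show ?thesis
    unfolding main K const i1_def i2_def \<Phi>_def[symmetric] \<Sigma>1_def[symmetric] \<Sigma>2_def[symmetric] \<Sigma>3_def[symmetric] \<Sigma>4_def[symmetric]
      Y_def[symmetric] sn_def[symmetric] cs_def[symmetric] \<pi>_def[symmetric] ..
qed

end

theorem theorem3p1:
  fixes \<Gamma> :: "mat2 set" and \<aa> \<bb> :: boundary and \<sigma>\<^sub>a \<sigma>\<^sub>b :: mat2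
    and x y \<theta> :: real and z s :: complex
  assumes "fuchsian_first_kind \<Gamma>" and "\<not> compact_space (orbit_space \<Gamma>)"
    and "cusp \<Gamma> \<aa>" and "cusp \<Gamma> \<bb>"
    and "scaling_matrix \<Gamma> \<aa> \<sigma>\<^sub>a" and "scaling_matrix \<Gamma> \<bb> \<sigma>\<^sub>b"
    and "z = Complex x y" and "y > 0"
    and "0 \<le> \<theta>" and "\<theta> < 2 * pi"
    and "Re s > 1"
  shows
    "eisenstein_term \<sigma>\<^sub>a s (tangent_act \<sigma>\<^sub>b (z, unit_tangent z \<theta>)) summable_on cusp_cosets \<Gamma> \<aa> \<and>
     (\<forall>c>0. finite (D_set \<Gamma> \<sigma>\<^sub>a \<sigma>\<^sub>b c)) \<and>
     (\<lambda>c. complex_of_real c powr (- 2 * s - 2) * of_nat (card (D_set \<Gamma> \<sigma>\<^sub>a \<sigma>\<^sub>b c)))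
       summable_on occurring_c \<Gamma> \<sigma>\<^sub>a \<sigma>\<^sub>b \<and>
     (\<lambda>n. e_char (of_int n * x) * of_int \<bar>n\<bar> powr (s + 1/2) *
        bessel_K (s + 1/2) (2 * pi * of_int \<bar>n\<bar> * y) * phi \<Gamma> \<sigma>\<^sub>a \<sigma>\<^sub>b n s) summable_on {n. n \<noteq> 0} \<and>
     (\<lambda>n. e_char (of_int n * x) * of_int \<bar>n\<bar> powr (s + 3/2) *
        bessel_K (s + 3/2) (2 * pi * of_int \<bar>n\<bar> * y) * phi \<Gamma> \<sigma>\<^sub>a \<sigma>\<^sub>b n s) summable_on {n. n \<noteq> 0} \<and>
     (\<lambda>n. of_real (sin (2 * pi * of_int n * x)) * of_int n powr (s + 3/2) *
        bessel_K (- s - 1/2) (2 * pi * of_int n * y) * phi1 \<Gamma> \<sigma>\<^sub>a \<sigma>\<^sub>b n s) summable_on {n. n > 0} \<and>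
     (\<lambda>n. of_real (cos (2 * pi * of_int n * x)) * of_int n powr (s + 3/2) *
        bessel_K (- s - 1/2) (2 * pi * of_int n * y) * phi2 \<Gamma> \<sigma>\<^sub>a \<sigma>\<^sub>b n s) summable_on {n. n > 0} \<and>
     eisenstein1 \<Gamma> \<aa> \<sigma>\<^sub>a (tangent_act \<sigma>\<^sub>b (z, unit_tangent z \<theta>)) s =
       - cusp_delta \<Gamma> \<aa> \<bb> * of_real y powr (s + 1) * of_real (sin \<theta>)
       + of_real (sqrt pi) * of_real y powr (- s) * of_real (sin \<theta>) * (1 / (s + 1)) *
           (Gamma (s + 1/2) / Gamma s) * phi0 \<Gamma> \<sigma>\<^sub>a \<sigma>\<^sub>b s
       - 2 * of_real pi powr (s + 1) * of_real y powr (1/2) * of_real (sin \<theta>) *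
           inverse (Gamma (s + 1)) *
           (\<Sum>\<^sub>\<infinity>n\<in>{n. n \<noteq> 0}. e_char (of_int n * x) * of_int \<bar>n\<bar> powr (s + 1/2) *
              bessel_K (s + 1/2) (2 * pi * of_int \<bar>n\<bar> * y) * phi \<Gamma> \<sigma>\<^sub>a \<sigma>\<^sub>b n s)
       + 4 * of_real pi powr (s + 2) * of_real y powr (3/2) * of_real (sin \<theta>) *
           inverse (Gamma (s + 2)) *
           (\<Sum>\<^sub>\<infinity>n\<in>{n. n \<noteq> 0}. e_char (of_int n * x) * of_int \<bar>n\<bar> powr (s + 3/2) *
              bessel_K (s + 3/2) (2 * pi * of_int \<bar>n\<bar> * y) * phi \<Gamma> \<sigma>\<^sub>a \<sigma>\<^sub>b n s)
       + 8 * of_real pi powr (s + 1) * of_real y powr (3/2) * of_real (cos \<theta>) * sin_Gamma s *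
           (\<Sum>\<^sub>\<infinity>n\<in>{n. n > 0}. of_real (sin (2 * pi * of_int n * x)) * of_int n powr (s + 3/2) *
              bessel_K (- s - 1/2) (2 * pi * of_int n * y) * phi1 \<Gamma> \<sigma>\<^sub>a \<sigma>\<^sub>b n s)
       + 8 * of_real pi powr (s + 1) * of_real y powr (3/2) * of_real (cos \<theta>) * sin_Gamma s *
           (\<Sum>\<^sub>\<infinity>n\<in>{n. n > 0}. of_real (cos (2 * pi * of_int n * x)) * of_int n powr (s + 3/2) *
              bessel_K (- s - 1/2) (2 * pi * of_int n * y) * phi2 \<Gamma> \<sigma>\<^sub>a \<sigma>\<^sub>b n s)"
proof -
  interpret scaled_cusp_pair \<Gamma> \<aa> \<bb> \<sigma>\<^sub>a \<sigma>\<^sub>b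
    using assms(1,5,6) by unfold_locales (auto simp: fuchsian_first_kind_def)
  note y = \<open>y > 0\<close> and s = \<open>Re s > 1\<close>
  have r: "Re (s + 1) \<ge> 1" "Re (s + 2) \<ge> 1" using s by auto
  have e: "s + 1 - 1/2 = s + 1/2" "s + 2 - 1/2 = s + 3/2" "s + 1 + 1 = s + 2" "s + 1 + 1/2 = s + 3/2" by simp_all
  have K: "bessel_K (- s - 1/2) = bessel_K (s + 1/2)"
    using bessel_K_minus[of "s + 1/2"] by (simp add: fun_eq_iff)
  note S1 = fourier_radial_sum(1)[OF y r(1) s, of x, unfolded e]
    and S2 = fourier_radial_sum(1)[OF y r(2) s, of x, unfolded e]
    and S3 = fourier_moment_radial_sum(1,2)[OF y r(1) s, of x, unfolded e, folded K]
  show ?thesis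
    unfolding \<open>z = Complex x y\<close>
    by (intro conjI allI impI, (fact eisenstein_expansion(1)[OF y s] finite_D_set phi0_summable[OF s] S1 S2 S3)+)
      (simp only: eisenstein_expansion(2)[OF y s] eisenstein_main_eq[OF y s] add.assoc[symmetric] add_diff_eq)
qed

end
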